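(* Assume $h_m(x)$, $m\ge1$, satisfies $Th_m=(2m-1)h_m$ and $\|h_m\|_{L^2(\mathbb R)}=1$, where $T=-\partial_{xx}+x^2$. For any real $k\neq0$, $$\left|\int_{\mathbb R}\langle x\rangle^\mu e^{\mathrm i k|x|^\beta}h_m(x)\overline{h_n(x)}\,dx\right|\le C\cdot C_{k,\beta}\,(mn)^{-l(\beta,\mu)},\qquad m,n\ge1,$$ for some absolute constant $C>0$, where $\mu\ge0$, $\beta>1$, $$l(\beta,\mu)=\begin{cases}\frac14\left(\frac\beta6-\mu\right),&1<\beta<2,\\ \frac14\left(\frac29-\mu\right),&\beta=2,\\ \frac14\left(\frac{\beta-2}{4\beta-2}-\mu\right),&\beta>2,\end{cases}$$ and $$C_{k,\beta}=\begin{cases}|\beta(\beta-1)(\beta-2)k|^{-\frac13}\vee|k|^{-1}\vee|k|^{\frac1{4-2\beta}},&1<\beta<2,\\ |k|^{-1}\vee1,&\beta=2,\\ |\beta k|^{-1}\vee1,&\beta>2.\end{cases}$$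
   Context: $\langle x\rangle=\sqrt{1+x^2}$ and $a\vee b=\max\{a,b\}$. The functions $(h_m)_{m\ge1}$ are the Hermite functions, i.e. the $L^2(\mathbb R)$-normalized eigenfunctions of the harmonic oscillator $T=-\partial_{xx}+x^2$ on $\mathbb R$. The indices $m,n$ are positive integers.
   Formalization: The constant C may depend on μ (but not on k, β, m, n or the choice of h_m); a C independent of μ is impossible, since for k=1, β=2, m=n=1 the right side is C while the left side tends to infinity as μ→∞. *)

theory Defs
  imports "HOL-Analysis.Analysis"
begin

definition japanese :: "real \<Rightarrow> real" where
  "japanese x = sqrt (1 + x\<^sup>2)"

definition twice_differentiable :: "(real \<Rightarrow> complex) \<Rightarrow> bool" where
  "twice_differentiable u \<longleftrightarrow>
     (\<forall>x. u differentiable (at x)) \<and>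
     (\<forall>x. (\<lambda>y. vector_derivative u (at y)) differentiable (at x))"

text \<open>
  The harmonic oscillator \<open>T = - d\<^sup>2/dx\<^sup>2 + x\<^sup>2\<close>, acting pointwise. It is meant for twice
  differentiable arguments only, since \<^const>\<open>vector_derivative\<close> is unspecified at points of
  non-differentiability.
\<close>

definition harmonic_oscillator :: "(real \<Rightarrow> complex) \<Rightarrow> real \<Rightarrow> complex" where
  "harmonic_oscillator u x =
     - vector_derivative (\<lambda>y. vector_derivative u (at y)) (at x) + complex_of_real (x\<^sup>2) * u x"

definition square_integrable :: "(real \<Rightarrow> complex) \<Rightarrow> bool" where
  "square_integrable u \<longleftrightarrow>
     u \<in> borel_measurable lborel \<and> integrable lborel (\<lambda>x. (cmod (u x))\<^sup>2)"

definition L2_norm_on_line :: "(real \<Rightarrow> complex) \<Rightarrow> real" where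
  "L2_norm_on_line u = sqrt (LINT x|lborel. (cmod (u x))\<^sup>2)"

text \<open>
  Each \<open>h m\<close> is only determined up to a unimodular factor, so this is a predicate on families.
  The value \<open>h 0\<close> is irrelevant.
\<close>

definition hermite_family :: "(nat \<Rightarrow> real \<Rightarrow> complex) \<Rightarrow> bool" where
  "hermite_family h \<longleftrightarrow>
     (\<forall>m\<ge>1. twice_differentiable (h m) \<and>
            (\<forall>x. harmonic_oscillator (h m) x = complex_of_real (2 * real m - 1) * h m x) \<and>
            square_integrable (h m) \<and> L2_norm_on_line (h m) = 1)"

text \<open>The next two definitions are meant for \<open>\<beta> > 1\<close>.\<close>

definition decay_exponent :: "real \<Rightarrow> real \<Rightarrow> real" where
  "decay_exponent \<beta> \<mu> =
     (if \<beta> < 2 then 1/4 * (\<beta>/6 - \<mu>)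
      else if \<beta> = 2 then 1/4 * (2/9 - \<mu>)
      else 1/4 * ((\<beta> - 2) / (4 * \<beta> - 2) - \<mu>))"

definition osc_const :: "real \<Rightarrow> real \<Rightarrow> real" where
  "osc_const k \<beta> =
     (if \<beta> < 2 then
        max (\<bar>\<beta> * (\<beta> - 1) * (\<beta> - 2) * k\<bar> powr (- (1/3)))
          (max (\<bar>k\<bar> powr (- 1)) (\<bar>k\<bar> powr (1 / (4 - 2 * \<beta>))))
      else if \<beta> = 2 then max (\<bar>k\<bar> powr (- 1)) 1
      else max (\<bar>\<beta> * k\<bar> powr (- 1)) 1)"

end

theory Submission
  imports Defs
begin

text \<open>
  On a half line the real and imaginary parts of the Hermite functions solve \<open>u'' = (x\<^sup>2 - \<lambda>) u\<close>, and
  nothing but this equation and square integrability is used. Let \<open>u\<close>, \<open>v\<close> be two such solutions with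
  \<open>\<lambda> \<le> \<Lambda>\<close>, and put \<open>q = \<surd>(\<lambda> - x\<^sup>2)\<close>. The corrected WKB energy
  \<open>q u\<^sup>2 + u'\<^sup>2 / q - x u u' / q\<^sup>3\<close> shows that \<open>u\<^sup>2\<close> is bounded by a multiple of \<open>1 / q\<close> up to the Airy
  zone, and virial identities show that the weighted mass of \<open>u\<close> beyond \<open>\<surd>(\<lambda> (1 - \<delta>))\<close> is \<open>O(\<delta>\<^bsup>1/2\<^esup>)\<close>.
  In the interior \<open>u = Re (c e\<^bsup>iS\<^esup>)\<close> with \<open>S' = q\<close> and \<open>c = (u - i u' / q) e\<^bsup>-iS\<^esup>\<close>, whose derivative is only
  \<open>- i x u' / q\<^sup>3 e\<^bsup>-iS\<^esup>\<close>. So the product of \<open>u\<close> and \<open>v\<close> splits into four terms with slowly varying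
  amplitudes, and van der Corput's lemma applies to the phases \<open>k x\<^bsup>\<beta>\<^esup> \<plusminus> S \<plusminus> T\<close>. For \<open>\<beta> \<le> 2\<close> the second
  derivative of the phase can vanish only where the eigenphases have a large third derivative of the favourable sign;
  for \<open>\<beta> > 2\<close> the term \<open>k x\<^bsup>\<beta>\<^esup>\<close> dominates the second derivative unless the claim is trivial.
  Optimizing \<open>\<delta>\<close> gives the exponents.
\<close>

section \<open>Van der Corput estimates\<close>

text \<open>The eigenvalues \<open>lam\<close> and \<open>Lam\<close> may be of very different size,
  and normalization alone then loses the decay in the larger one. All cuts are therefore made at the
  scale of the smaller eigenvalue, where the other solution has size about
  \<open>Lam powr (- 1/4)\<close>. This yields a factor
  \<open>\<rho> = (lam / Lam) powr (1/4)\<close>, kept through every bound. As the decay exponent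
  \<open>d\<close> for \<mu> = 0 is at most 1/4, \<rho> turns \<open>lam powr (- 2 * d)\<close> into
  \<open>(lam * Lam) powr (- d)\<close>. The exponents come from a balance. With the last cut at
  relative distance \<delta> from the turning point, the edge costs
  \<open>\<delta> powr (1/4)\<close> and an interior piece costs
  \<open>V / sqrt (\<delta> * lam)\<close>, where \<open>V\<close> is its van der Corput bound. For
  \<beta> \<le> 2, three pieces ending at \<delta> = \<open>y ^ 8\<close> make every cost
  \<open>y\<^sup>2\<close>; the curvature of \<open>k x^\<beta>\<close>, about
  \<open>lam powr ((\<beta> - 2) / 2)\<close>, makes \<open>y ^ 12\<close> comparable with
  \<open>lam powr (- \<beta> / 2)\<close> up to factors of \<open>k\<close>, hence
  \<open>lam powr (- \<beta> / 12)\<close>. For \<beta> > 2, one piece with \<delta> =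
  \<open>lam powr (- 4 * \<theta>)\<close> gives \<open>lam powr (- \<theta>)\<close>, where
  \<theta> = \<open>2 * d\<close>.\<close>

abbreviation osc_integral :: "real \<Rightarrow> real \<Rightarrow> (real \<Rightarrow> real) \<Rightarrow> complex" where
  "osc_integral a b \<phi> \<equiv> integral {a..b} (\<lambda>x. exp (\<i> * complex_of_real (\<phi> x)))"

text \<open>Integration by parts with \<open>e / (i \<phi>')\<close>. The two boundary terms cost
  \<open>1 / \<rho>\<close> each. The remainder costs the variation of \<open>1 / \<phi>'\<close>,
  which is a single difference because \<phi>' is monotone and at most \<open>1 / \<rho>\<close>
  because \<phi>' keeps its sign.\<close>

lemma oscillatory_first_derivative_bound:
  fixes \<phi> \<phi>' \<phi>'' :: "real \<Rightarrow> real"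
  assumes "a \<le> b" and \<rho>: "\<rho> > 0"
    and d1: "\<And>x. x \<in> {a..b} \<Longrightarrow> (\<phi> has_real_derivative \<phi>' x) (at x within {a..b})"
    and d2: "\<And>x. x \<in> {a..b} \<Longrightarrow> (\<phi>' has_real_derivative \<phi>'' x) (at x within {a..b})"
    and nonneg: "\<And>x. x \<in> {a..b} \<Longrightarrow> \<phi>'' x \<ge> 0"
    and large: "(\<forall>x\<in>{a..b}. \<phi>' x \<ge> \<rho>) \<or> (\<forall>x\<in>{a..b}. \<phi>' x \<le> - \<rho>)"
  shows "cmod (osc_integral a b \<phi>) \<le> 3 / \<rho>"
proof -
  define e where "e = (\<lambda>x. exp (\<i> * complex_of_real (\<phi> x)))"
  define F where "F = (\<lambda>x. e x / (\<i> * complex_of_real (\<phi>' x)))"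
  define R where "R = (\<lambda>x. e x * complex_of_real (\<phi>'' x) / (\<i> * complex_of_real ((\<phi>' x)\<^sup>2)))"
  have nz: "\<phi>' x \<noteq> 0" if "x \<in> {a..b}" for x
    using large \<rho> that by fastforce
  have ab: "\<bar>\<phi>' x\<bar> \<ge> \<rho>" if "x \<in> {a..b}" for x
    using large \<rho> that by fastforce
  have dF: "(F has_vector_derivative (e x - R x)) (at x within {a..b})" if x: "x \<in> {a..b}" for x
  proof -
    have p: "((\<lambda>x. complex_of_real (\<phi> x)) has_vector_derivative complex_of_real (\<phi>' x)) (at x within {a..b})"
      using d1[OF x] by (rule has_vector_derivative_of_real)
    have p': "((\<lambda>x. complex_of_real (\<phi>' x)) has_vector_derivative complex_of_real (\<phi>'' x)) (at x within {a..b})"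
      using d2[OF x] by (rule has_vector_derivative_of_real)
    have "((\<lambda>x. \<i> * complex_of_real (\<phi> x)) has_vector_derivative \<i> * complex_of_real (\<phi>' x)) (at x within {a..b})"
      using p by (intro has_vector_derivative_mult_right)
    from field_vector_diff_chain_within[OF this DERIV_exp[THEN DERIV_subset, OF subset_UNIV]]
    have ed: "(e has_vector_derivative \<i> * complex_of_real (\<phi>' x) * e x) (at x within {a..b})"
      by (simp add: e_def o_def)
    have g: "((\<lambda>y. 1 / (\<i> * y)) has_field_derivative (- 1 / (\<i> * (complex_of_real (\<phi>' x))\<^sup>2)))
               (at (complex_of_real (\<phi>' x)) within S)" for S
      using nz[OF x] by (auto intro!: derivative_eq_intros simp: power2_eq_square field_simps)
    have "((\<lambda>x. 1 / (\<i> * complex_of_real (\<phi>' x))) has_vector_derivative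
             complex_of_real (\<phi>'' x) * (- 1 / (\<i> * (complex_of_real (\<phi>' x))\<^sup>2))) (at x within {a..b})"
      using field_vector_diff_chain_within[OF p' g] by (simp add: o_def)
    from has_vector_derivative_mult[OF ed this]
    have "((\<lambda>x. e x * (1 / (\<i> * complex_of_real (\<phi>' x)))) has_vector_derivative
      e x * (complex_of_real (\<phi>'' x) * (- 1 / (\<i> * (complex_of_real (\<phi>' x))\<^sup>2)))
      + \<i> * complex_of_real (\<phi>' x) * e x * (1 / (\<i> * complex_of_real (\<phi>' x)))) (at x within {a..b})" .
    moreover have "e x * (complex_of_real (\<phi>'' x) * (- 1 / (\<i> * (complex_of_real (\<phi>' x))\<^sup>2)))
      + \<i> * complex_of_real (\<phi>' x) * e x * (1 / (\<i> * complex_of_real (\<phi>' x))) = e x - R x"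
      using nz[OF x] by (simp add: R_def field_simps)
    ultimately show ?thesis by (simp add: F_def)
  qed
  have i1: "((\<lambda>x. e x - R x) has_integral (F b - F a)) {a..b}"
    using fundamental_theorem_of_calculus[OF \<open>a \<le> b\<close> dF] by simp
  have c\<phi>: "continuous_on {a..b} \<phi>"
    using d1 by (rule DERIV_continuous_on)
  have ie: "e integrable_on {a..b}"
    unfolding e_def by (intro integrable_continuous_interval continuous_intros c\<phi>)
  have iR: "(R has_integral (integral {a..b} e - (F b - F a))) {a..b}"
    using has_integral_diff[OF integrable_integral[OF ie] i1] by simp
  have dinv: "((\<lambda>x. - (1 / \<phi>' x)) has_vector_derivative \<phi>'' x / (\<phi>' x)\<^sup>2) (at x within {a..b})"
    if x: "x \<in> {a..b}" for x
    unfolding has_real_derivative_iff_has_vector_derivative[symmetric]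
    using nz[OF x] by (auto intro!: derivative_eq_intros d2[OF x] simp: power2_eq_square)
  have i2: "((\<lambda>x. \<phi>'' x / (\<phi>' x)\<^sup>2) has_integral (1 / \<phi>' a - 1 / \<phi>' b)) {a..b}"
    using fundamental_theorem_of_calculus[OF \<open>a \<le> b\<close> dinv] by simp
  have "cmod (integral {a..b} R) \<le> integral {a..b} (\<lambda>x. \<phi>'' x / (\<phi>' x)\<^sup>2)"
  proof (rule Henstock_Kurzweil_Integration.integral_norm_bound_integral)
    show "R integrable_on {a..b}" using iR by blast
    show "(\<lambda>x. \<phi>'' x / (\<phi>' x)\<^sup>2) integrable_on {a..b}" using i2 by blast
    show "cmod (R x) \<le> \<phi>'' x / (\<phi>' x)\<^sup>2" if "x \<in> {a..b}" for x
      using nonneg[OF that] by (simp add: R_def e_def norm_mult norm_divide norm_power)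
  qed
  then have nR: "cmod (integral {a..b} e - (F b - F a)) \<le> 1 / \<phi>' a - 1 / \<phi>' b"
    using integral_unique[OF iR] integral_unique[OF i2] by simp
  have nF: "cmod (F x) = 1 / \<bar>\<phi>' x\<bar>" for x
    by (simp add: F_def e_def norm_mult norm_divide)
  have aa: "a \<in> {a..b}" "b \<in> {a..b}" using \<open>a \<le> b\<close> by auto
  have le: "1 / \<bar>\<phi>' a\<bar> \<le> 1 / \<rho>" "1 / \<bar>\<phi>' b\<bar> \<le> 1 / \<rho>"
    using ab[OF aa(1)] ab[OF aa(2)] \<rho> by (auto intro!: frac_le)
  have "1 / \<phi>' a - 1 / \<phi>' b \<le> 1 / \<rho>"
  proof (cases "\<forall>x\<in>{a..b}. \<phi>' x \<ge> \<rho>")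
    case True
    then have "\<phi>' a > 0" "\<phi>' b > 0" using aa \<rho> by force+
    then have "1 / \<phi>' b > 0" "1 / \<bar>\<phi>' a\<bar> = 1 / \<phi>' a" by auto
    then show ?thesis using le by linarith
  next
    case False
    with large have "\<forall>x\<in>{a..b}. \<phi>' x \<le> - \<rho>" by blast
    then have "\<phi>' a < 0" "\<phi>' b < 0" using aa \<rho> by force+
    then have "1 / \<bar>\<phi>' b\<bar> = - (1 / \<phi>' b)" "1 / \<phi>' a < 0" by auto
    then show ?thesis using le by linarith
  qed
  moreover have "cmod (integral {a..b} e) \<le> cmod (integral {a..b} e - (F b - F a)) + cmod (F b) + cmod (F a)"
    by (smt (verit) norm_triangle_ineq4 norm_triangle_sub)
  ultimately have "cmod (integral {a..b} e) \<le> 1 / \<rho> + 1 / \<rho> + 1 / \<rho>"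
    using nR le nF[of a] nF[of b] by linarith
  then show ?thesis by (simp add: e_def)
qed

lemma increment_ge:
  fixes f f' :: "real \<Rightarrow> real"
  assumes d: "\<And>x. x \<in> {a..b} \<Longrightarrow> (f has_real_derivative f' x) (at x within {a..b})"
    and m: "\<And>x. x \<in> {a..b} \<Longrightarrow> f' x \<ge> m"
    and "a \<le> x" "x \<le> y" "y \<le> b"
  shows "f y - f x \<ge> m * (y - x)"
proof -
  have "(f has_derivative (\<lambda>h. f' z * h)) (at z within {x..y})" if "x \<le> z" "z \<le> y" for z
    using d[of z] that assms(3-5) DERIV_subset[of f "f' z" z "{a..b}" "{x..y}"]
    by (auto simp: has_field_derivative_def)
  from mvt_very_simple[OF \<open>x \<le> y\<close> this]
  obtain z where "z \<in> {x..y}" "f y - f x = f' z * (y - x)" by auto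
  then show ?thesis
    using m[of z] assms(3-5) by (auto intro: mult_right_mono)
qed

text \<open>A function growing at rate at least \<open>m\<close> spends length at most
  \<open>2 * \<tau> / m\<close> between -\<tau> and \<tau>. The alternatives \<open>c = a\<close>
  and \<open>d = b\<close> cover outer pieces that degenerate to a point.\<close>

lemma small_values_of_expanding_function:
  fixes f f' :: "real \<Rightarrow> real"
  assumes "a \<le> b" "m > 0" "\<tau> > 0"
    and d: "\<And>x. x \<in> {a..b} \<Longrightarrow> (f has_real_derivative f' x) (at x within {a..b})"
    and m: "\<And>x. x \<in> {a..b} \<Longrightarrow> f' x \<ge> m"
  obtains c d where "a \<le> c" "c \<le> d" "d \<le> b" "m * (d - c) \<le> 2 * \<tau>"
    "c = a \<or> (\<forall>x\<in>{a..c}. f x \<le> - \<tau>)" "d = b \<or> (\<forall>x\<in>{d..b}. f x \<ge> \<tau>)"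
proof -
  have inc: "f y - f x \<ge> m * (y - x)" if "a \<le> x" "x \<le> y" "y \<le> b" for x y
    using increment_ge[of a b f f' m, OF d m that] .
  have mono: "f x \<le> f y" if "a \<le> x" "x \<le> y" "y \<le> b" for x y
    using inc[OF that] that \<open>m > 0\<close> by (smt (verit) mult_nonneg_nonneg)
  have cont: "continuous_on {a..b} f"
    using d by (rule DERIV_continuous_on)
  have hit: "\<exists>c. a \<le> c \<and> c \<le> b \<and> f c = t" if "f a \<le> t" "t \<le> f b" for t
    using IVT'[OF that \<open>a \<le> b\<close> cont] by auto
  consider (low) "f b \<le> - \<tau>" | (high) "f a \<ge> \<tau>" | (mid) "f b > - \<tau>" "f a < \<tau>" by linarith
  then show thesis
  proof cases
    case low
    show thesis
    proof (rule that[of b b])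
      show "b = a \<or> (\<forall>x\<in>{a..b}. f x \<le> - \<tau>)"
        using low mono[of _ b] by force
    qed (use \<open>a \<le> b\<close> \<open>\<tau> > 0\<close> in auto)
  next
    case high
    show thesis
    proof (rule that[of a a])
      show "a = b \<or> (\<forall>x\<in>{a..b}. f x \<ge> \<tau>)"
        using high mono[of a] by force
    qed (use \<open>a \<le> b\<close> \<open>\<tau> > 0\<close> in auto)
  next
    case mid
    obtain c where c: "a \<le> c" "c \<le> b" "f c \<ge> - \<tau>" "c = a \<or> f c = - \<tau>"
    proof (cases "f a \<ge> - \<tau>")
      case True then show ?thesis using that[of a] \<open>a \<le> b\<close> by auto
    next
      case False
      then show ?thesis using hit[of "- \<tau>"] mid that by fastforce
    qed
    obtain d where d: "a \<le> d" "d \<le> b" "f d \<le> \<tau>" "d = b \<or> f d = \<tau>"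
    proof (cases "f b \<le> \<tau>")
      case True then show ?thesis using that[of b] \<open>a \<le> b\<close> by auto
    next
      case False
      then show ?thesis using hit[of "\<tau>"] mid that by fastforce
    qed
    have "c \<le> d"
    proof (rule ccontr)
      assume "\<not> c \<le> d"
      then have cd: "d < c" by simp
      then have "f c = - \<tau>" "f d = \<tau>" using c d by auto
      then show False using mono[of d c] cd c d \<open>\<tau> > 0\<close> by auto
    qed
    moreover have "m * (d - c) \<le> 2 * \<tau>"
      using inc[of c d] c d calculation by linarith
    moreover have "c = a \<or> (\<forall>x\<in>{a..c}. f x \<le> - \<tau>)"
      using c mono[of _ c] by force
    moreover have "d = b \<or> (\<forall>x\<in>{d..b}. f x \<ge> \<tau>)"
      using d mono[of d] by force
    ultimately show thesis using that[of c d] c d by blast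
  qed
qed

lemma cmod_integral_cis_le_length:
  fixes \<phi> :: "real \<Rightarrow> real"
  assumes "a \<le> b" "continuous_on {a..b} \<phi>"
  shows "cmod (osc_integral a b \<phi>) \<le> b - a"
proof -
  have "(\<lambda>x. exp (\<i> * complex_of_real (\<phi> x))) integrable_on {a..b}"
    by (intro integrable_continuous_interval continuous_intros assms)
  then have "cmod (osc_integral a b \<phi>) \<le> integral {a..b} (\<lambda>x. 1 :: real)"
    by (intro Henstock_Kurzweil_Integration.integral_norm_bound_integral) auto
  then show ?thesis using \<open>a \<le> b\<close> by simp
qed

lemma cmod_integral_combine_three:
  fixes f :: "real \<Rightarrow> complex"
  assumes "a \<le> c" "c \<le> d" "d \<le> b" "f integrable_on {a..b}"
    and "cmod (integral {a..c} f) \<le> A" "cmod (integral {c..d} f) \<le> B" "cmod (integral {d..b} f) \<le> C"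
  shows "cmod (integral {a..b} f) \<le> A + B + C"
proof -
  have "f integrable_on {a..d}"
    using assms by (auto intro: integrable_subinterval_real)
  then have "integral {a..b} f = integral {a..c} f + integral {c..d} f + integral {d..b} f"
    using assms Henstock_Kurzweil_Integration.integral_combine[of a d b f]
      Henstock_Kurzweil_Integration.integral_combine[of a c d f] by simp
  then show ?thesis
    using assms norm_triangle_ineq[of "integral {a..c} f + integral {c..d} f" "integral {d..b} f"]
      norm_triangle_ineq[of "integral {a..c} f" "integral {c..d} f"] by simp
qed

text \<open>The size of \<phi>'' is encoded as \<open>1 / L\<^sup>2\<close> so that the bound is
  linear in \<open>L\<close>. Cutting where \<phi>' reaches size \<open>1 / L\<close> balances the
  pieces: the outer ones cost \<open>3 * L\<close> each, and the middle one has length at most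
  \<open>2 * L\<close>.\<close>

lemma second_derivative_test:
  fixes \<phi> \<phi>' \<phi>'' :: "real \<Rightarrow> real"
  assumes "a \<le> b" and L: "L > 0"
    and d1: "\<And>x. x \<in> {a..b} \<Longrightarrow> (\<phi> has_real_derivative \<phi>' x) (at x within {a..b})"
    and d2: "\<And>x. x \<in> {a..b} \<Longrightarrow> (\<phi>' has_real_derivative \<phi>'' x) (at x within {a..b})"
    and large: "\<And>x. x \<in> {a..b} \<Longrightarrow> \<phi>'' x \<ge> 1 / L^2"
  shows "cmod (osc_integral a b \<phi>) \<le> 8 * L"
proof -
  have pos: "1 / L^2 > 0" "1 / L > 0" using L by auto
  obtain c d where cd: "a \<le> c" "c \<le> d" "d \<le> b" "1 / L^2 * (d - c) \<le> 2 * (1 / L)"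
    "c = a \<or> (\<forall>x\<in>{a..c}. \<phi>' x \<le> - (1 / L))" "d = b \<or> (\<forall>x\<in>{d..b}. \<phi>' x \<ge> 1 / L)"
    using small_values_of_expanding_function[OF \<open>a \<le> b\<close> pos d2 large] by blast
  have cont: "continuous_on {a..b} \<phi>"
    using d1 by (rule DERIV_continuous_on)
  have nonneg: "\<phi>'' x \<ge> 0" if "x \<in> {a..b}" for x
    using large[OF that] pos by linarith
  have fst: "cmod (osc_integral s t \<phi>) \<le> 3 * L"
    if "a \<le> s" "s \<le> t" "t \<le> b" and
      "s = t \<or> (\<forall>x\<in>{s..t}. \<phi>' x \<ge> 1 / L) \<or> (\<forall>x\<in>{s..t}. \<phi>' x \<le> - (1 / L))" for s t
  proof (cases "s = t")
    case True
    then show ?thesis using L by simp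
  next
    case False
    have "cmod (osc_integral s t \<phi>) \<le> 3 / (1 / L)"
    proof (rule oscillatory_first_derivative_bound[where \<phi>' = \<phi>' and \<phi>'' = \<phi>''])
      show "(\<phi> has_real_derivative \<phi>' x) (at x within {s..t})" if "x \<in> {s..t}" for x
        using d1[of x] that \<open>a \<le> s\<close> \<open>t \<le> b\<close> by (auto intro: DERIV_subset)
      show "(\<phi>' has_real_derivative \<phi>'' x) (at x within {s..t})" if "x \<in> {s..t}" for x
        using d2[of x] that \<open>a \<le> s\<close> \<open>t \<le> b\<close> by (auto intro: DERIV_subset)
    qed (use that nonneg L False in auto)
    then show ?thesis by simp
  qed
  have "cmod (osc_integral a b \<phi>) \<le> 3 * L + 2 * L + 3 * L"
  proof (rule cmod_integral_combine_three[OF cd(1-3)])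
    show "(\<lambda>x. exp (\<i> * complex_of_real (\<phi> x))) integrable_on {a..b}"
      by (intro integrable_continuous_interval continuous_intros cont)
    show "cmod (osc_integral a c \<phi>) \<le> 3 * L"
      using cd by (intro fst) auto
    show "cmod (osc_integral d b \<phi>) \<le> 3 * L"
      using cd by (intro fst) auto
    have "cmod (osc_integral c d \<phi>) \<le> d - c"
      using cd by (intro cmod_integral_cis_le_length continuous_on_subset[OF cont]) auto
    moreover have "L^2 * (1 / L^2 * (d - c)) \<le> L^2 * (2 * (1 / L))"
      using cd(4) by (rule mult_left_mono) simp
    then have "d - c \<le> 2 * L"
      using L by (simp add: power2_eq_square)
    ultimately show "cmod (osc_integral c d \<phi>) \<le> 2 * L" by simp
  qed
  then show ?thesis by simp
qed

lemma cmod_integral_cis_uminus: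
  fixes \<phi> :: "real \<Rightarrow> real"
  shows "cmod (osc_integral a b (\<lambda>x. - \<phi> x)) =
         cmod (osc_integral a b \<phi>)"
proof -
  have "(\<lambda>x. exp (\<i> * complex_of_real (- \<phi> x))) = (\<lambda>x. cnj (exp (\<i> * complex_of_real (\<phi> x))))"
    by (simp add: exp_cnj)
  then show ?thesis by (simp add: integral_cnj[symmetric])
qed

text \<open>The same scheme one order higher, with the second derivative cut at
  \<open>1 / L\<^sup>2\<close>: 8 + 2 + 8. On the left piece the second derivative is negative, so
  the test is applied to -\<phi>, whose oscillatory integral is the complex conjugate.\<close>

lemma third_derivative_test:
  fixes \<phi> \<phi>1 \<phi>2 \<phi>3 :: "real \<Rightarrow> real"
  assumes "a \<le> b" and L: "L > 0"
    and d1: "\<And>x. x \<in> {a..b} \<Longrightarrow> (\<phi> has_real_derivative \<phi>1 x) (at x within {a..b})"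
    and d2: "\<And>x. x \<in> {a..b} \<Longrightarrow> (\<phi>1 has_real_derivative \<phi>2 x) (at x within {a..b})"
    and d3: "\<And>x. x \<in> {a..b} \<Longrightarrow> (\<phi>2 has_real_derivative \<phi>3 x) (at x within {a..b})"
    and large: "\<And>x. x \<in> {a..b} \<Longrightarrow> \<phi>3 x \<ge> 1 / L^3"
  shows "cmod (osc_integral a b \<phi>) \<le> 18 * L"
proof -
  have pos: "1 / L^3 > 0" "1 / L^2 > 0" using L by auto
  obtain c d where cd: "a \<le> c" "c \<le> d" "d \<le> b" "1 / L^3 * (d - c) \<le> 2 * (1 / L^2)"
    "c = a \<or> (\<forall>x\<in>{a..c}. \<phi>2 x \<le> - (1 / L^2))" "d = b \<or> (\<forall>x\<in>{d..b}. \<phi>2 x \<ge> 1 / L^2)"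
    using small_values_of_expanding_function[OF \<open>a \<le> b\<close> pos d3 large] by blast
  have cont: "continuous_on {a..b} \<phi>"
    using d1 by (rule DERIV_continuous_on)
  \<comment> \<open>The factor \<open>s\<close> lets the same derivative facts serve both -\<phi>
    and \<phi>.\<close>
  have D: "((\<lambda>x. s * \<phi> x) has_real_derivative s * \<phi>1 x) (at x within {u..v})"
    "((\<lambda>x. s * \<phi>1 x) has_real_derivative s * \<phi>2 x) (at x within {u..v})"
    if "x \<in> {u..v}" "a \<le> u" "v \<le> b" for x s u v
    using d1[of x] d2[of x] that by (auto intro!: DERIV_cmult intro: DERIV_subset)
  have "cmod (osc_integral a b \<phi>) \<le> 8 * L + 2 * L + 8 * L"
  proof (rule cmod_integral_combine_three[OF cd(1-3)])
    show "(\<lambda>x. exp (\<i> * complex_of_real (\<phi> x))) integrable_on {a..b}"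
      by (intro integrable_continuous_interval continuous_intros cont)
    show "cmod (osc_integral a c \<phi>) \<le> 8 * L"
    proof (cases "c = a")
      case False
      have "cmod (osc_integral a c (\<lambda>x. - 1 * \<phi> x)) \<le> 8 * L"
        by (rule second_derivative_test[OF cd(1) L D(1) D(2)]) (use cd False in force)+
      then show ?thesis using cmod_integral_cis_uminus[of a c \<phi>] by simp
    qed (use L in auto)
    show "cmod (osc_integral d b \<phi>) \<le> 8 * L"
    proof (cases "d = b")
      case False
      have "cmod (osc_integral d b (\<lambda>x. 1 * \<phi> x)) \<le> 8 * L"
        by (rule second_derivative_test[OF cd(3) L D(1) D(2)]) (use cd False in force)+
      then show ?thesis by simp
    qed (use L in auto)
    have "cmod (osc_integral c d \<phi>) \<le> d - c"
      using cd by (intro cmod_integral_cis_le_length continuous_on_subset[OF cont]) auto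
    moreover have "L^3 * (1 / L^3 * (d - c)) \<le> L^3 * (2 * (1 / L^2))"
      using cd(4) L by (intro mult_left_mono) auto
    then have "d - c \<le> 2 * L"
      using L by (simp add: power2_eq_square power3_eq_cube)
    ultimately show "cmod (osc_integral c d \<phi>) \<le> 2 * L" by simp
  qed
  then show ?thesis by simp
qed

text \<open>Integration by parts against the primitive of \<open>e\<close> that vanishes at
  \<open>a\<close>. \<open>M\<close> is any function whose growth dominates the variation of
  \<open>A\<close>, so the integral of the norm of \<open>A'\<close> never has to be
  computed.\<close>

lemma oscillatory_integral_with_amplitude:
  fixes A A' e :: "real \<Rightarrow> complex" and M M' :: "real \<Rightarrow> real"
  assumes "a \<le> b" and e: "continuous_on {a..b} e"
    and V: "\<And>t. t \<in> {a..b} \<Longrightarrow> cmod (integral {a..t} e) \<le> V"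
    and dA: "\<And>x. x \<in> {a..b} \<Longrightarrow> (A has_vector_derivative A' x) (at x within {a..b})"
    and dM: "\<And>x. x \<in> {a..b} \<Longrightarrow> (M has_real_derivative M' x) (at x within {a..b})"
    and le: "\<And>x. x \<in> {a..b} \<Longrightarrow> cmod (A' x) \<le> M' x"
  shows "cmod (integral {a..b} (\<lambda>x. A x * e x)) \<le> V * (cmod (A b) + (M b - M a))"
proof -
  define F where "F = (\<lambda>t. integral {a..t} e)"
  have dF: "(F has_vector_derivative e x) (at x within {a..b})" if "x \<in> {a..b}" for x
    unfolding F_def using integral_has_vector_derivative[OF e that] .
  have "((\<lambda>x. A x * F x) has_vector_derivative (A x * e x + A' x * F x)) (at x within {a..b})"
    if "x \<in> {a..b}" for x
    using has_vector_derivative_mult[OF dA[OF that] dF[OF that]] .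
  from fundamental_theorem_of_calculus[OF \<open>a \<le> b\<close> this]
  have i1: "((\<lambda>x. A x * e x + A' x * F x) has_integral A b * F b) {a..b}"
    by (simp add: F_def)
  have "continuous_on {a..b} A"
    using dA by (meson continuous_on_vector_derivative)
  then have i2: "(\<lambda>x. A x * e x) integrable_on {a..b}"
    by (intro integrable_continuous_interval continuous_intros e)
  have i3: "((\<lambda>x. A' x * F x) has_integral (A b * F b - integral {a..b} (\<lambda>x. A x * e x))) {a..b}"
    using has_integral_diff[OF i1 integrable_integral[OF i2]] by simp
  have i4: "(M' has_integral (M b - M a)) {a..b}"
    using fundamental_theorem_of_calculus[OF \<open>a \<le> b\<close>, of M M'] dM
    by (simp add: has_real_derivative_iff_has_vector_derivative)
  have "cmod (integral {a..b} (\<lambda>x. A' x * F x)) \<le> integral {a..b} (\<lambda>x. V * M' x)"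
  proof (rule Henstock_Kurzweil_Integration.integral_norm_bound_integral)
    show "(\<lambda>x. A' x * F x) integrable_on {a..b}" using i3 by blast
    show "(\<lambda>x. V * M' x) integrable_on {a..b}" using i4 has_integral_mult_right by blast
    show "cmod (A' x * F x) \<le> V * M' x" if "x \<in> {a..b}" for x
      using mult_mono'[OF V[OF that] le[OF that]] by (simp add: F_def norm_mult mult.commute)
  qed
  then have "cmod (A b * F b - integral {a..b} (\<lambda>x. A x * e x)) \<le> V * (M b - M a)"
    using integral_unique[OF i3] integral_unique[OF i4] by simp
  moreover have "cmod (A b * F b) \<le> V * cmod (A b)"
    using mult_right_mono[OF V[of b], of "cmod (A b)"] \<open>a \<le> b\<close> by (simp add: F_def norm_mult mult.commute)
  moreover have "cmod (integral {a..b} (\<lambda>x. A x * e x)) \<le>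
      cmod (A b * F b) + cmod (A b * F b - integral {a..b} (\<lambda>x. A x * e x))"
    by (metis norm_minus_commute norm_triangle_sub)
  ultimately show ?thesis by (simp add: algebra_simps)
qed

section \<open>Solutions decaying on a half line\<close>

lemma tendsto_exp_quarter: "((\<lambda>x::real. c * exp (- x / 4)) \<longlongrightarrow> 0) at_top"
proof -
  have "filterlim (\<lambda>x::real. - x / 4) at_bot at_top"
    unfolding filterlim_at_bot eventually_at_top_linorder
    by (intro allI, rule_tac x = "- 4 * Z" in exI) auto
  from filterlim_compose[OF exp_at_bot this]
  have "((\<lambda>x::real. c * exp (- x / 4)) \<longlongrightarrow> c * 0) at_top"
    by (intro tendsto_intros)
  then show ?thesis by simp
qed

lemma set_integrable_exp_decay:
  fixes f :: "real \<Rightarrow> 'a :: {banach, second_countable_topology}"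
  assumes cont: "continuous_on {a..} f"
    and bound: "\<And>x. x \<ge> a \<Longrightarrow> norm (f x) \<le> C * exp (- x / 4)"
  shows "set_integrable lborel {a..} f"
proof -
  note lim = tendsto_exp_quarter[of "- 4"]
  have "(\<integral>\<^sup>+x. ennreal (exp (- x / 4)) * indicator {a..} x \<partial>lborel) = ennreal (0 - (- 4 * exp (- a / 4)))"
    by (rule nn_integral_FTC_atLeast[OF _ _ _ lim]) (auto intro!: derivative_eq_intros)
  moreover have "(\<integral>\<^sup>+x. ennreal (indicator {a..} x *\<^sub>R exp (- x / 4)) \<partial>lborel) =
      (\<integral>\<^sup>+x. ennreal (exp (- x / 4)) * indicator {a..} x \<partial>lborel)"
    by (intro nn_integral_cong) (simp split: split_indicator)
  ultimately have "set_integrable lborel {a..} (\<lambda>x. exp (- x / 4))"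
    unfolding set_integrable_def
    by (intro integrableI_nn_integral_finite[where x="0 - (- 4 * exp (- a / 4))"]) auto
  then have "set_integrable lborel {a..} (\<lambda>x. C * exp (- x / 4))"
    by auto
  then show ?thesis
  proof (rule set_integrable_bound)
    show "set_borel_measurable lborel {a..} f"
      using cont borel_measurable_continuous_on_indicator[of "{a..}" f]
      unfolding set_borel_measurable_def by simp
    show "AE x in lborel. x \<in> {a..} \<longrightarrow> norm (f x) \<le> norm (C * exp (- x / 4))"
      using bound by (auto intro!: AE_I2 intro: order_trans[OF _ abs_ge_self])
  qed
qed

text \<open>Half of the exponential pays for the power, by (1 + t/n)^n \<le> e^t with t = x/4. For
  \<open>n = 0\<close> the constant is \<open>0 ^ 0 = 1\<close>.\<close>

lemma power_mult_exp_le: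
  fixes x :: real
  assumes "x \<ge> 0"
  shows "x ^ n * exp (- x / 2) \<le> (4 * real n) ^ n * exp (- x / 4)"
proof (cases "n = 0")
  case False
  have "x = 4 * real n * (x / 4 / real n)"
    using False by simp
  then have "x ^ n = (4 * real n) ^ n * (x / 4 / real n) ^ n"
    by (metis power_mult_distrib)
  also have "\<dots> \<le> (4 * real n) ^ n * (1 + x / 4 / real n) ^ n"
    using assms by (intro mult_left_mono power_mono) auto
  also have "\<dots> \<le> (4 * real n) ^ n * exp (x / 4)"
    using False assms by (intro mult_left_mono exp_ge_one_plus_x_over_n_power_n) auto
  finally have "x ^ n \<le> (4 * real n) ^ n * exp (x / 4)" .
  then have "x ^ n * exp (- x / 2) \<le> (4 * real n) ^ n * exp (x / 4) * exp (- x / 2)"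
    by (intro mult_right_mono) auto
  also have "\<dots> = (4 * real n) ^ n * (exp (x / 4) * exp (- x / 2))"
    by (simp only: mult.assoc)
  also have "exp (x / 4) * exp (- x / 2) = exp (- x / 4)"
    by (simp add: exp_add[symmetric])
  finally show ?thesis .
qed (use assms in auto)

lemma set_integral_FTC_at_top:
  fixes F f :: "real \<Rightarrow> real"
  assumes d: "\<And>x. (F has_real_derivative f x) (at x)"
    and cont: "continuous_on UNIV f"
    and int: "set_integrable lborel {a..} f"
    and lim: "(F \<longlongrightarrow> 0) at_top"
  shows "(LINT x:{a..}|lborel. f x) = - F a"
proof -
  have "(LINT x:{a..b}|lborel. f x) = F b - F a" if "a \<le> b" for b
  proof -
    have "set_integrable lborel {a..b} f"
      by (rule set_integrable_subset[OF int]) auto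
    moreover have "(f has_integral (F b - F a)) {a..b}"
      using d that by (intro fundamental_theorem_of_calculus)
        (auto simp: has_real_derivative_iff_has_vector_derivative[symmetric] intro: has_field_derivative_at_within)
    ultimately show ?thesis
      by (simp add: set_borel_integral_eq_integral integral_unique)
  qed
  moreover have "((\<lambda>b. F b - F a) \<longlongrightarrow> 0 - F a) at_top"
    by (intro tendsto_intros lim)
  ultimately have "((\<lambda>b. LINT x:{a..b}|lborel. f x) \<longlongrightarrow> - F a) at_top"
    by (subst tendsto_cong[where g="\<lambda>b. F b - F a"]) (auto simp: eventually_at_top_linorder)
  moreover have "((\<lambda>b. LINT x:{a..b}|lborel. f x) \<longlongrightarrow> (LINT x:{a..}|lborel. f x)) at_top"
    by (rule tendsto_set_lebesgue_integral_at_top[OF _ int]) auto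
  ultimately show ?thesis
    using tendsto_unique trivial_limit_at_top_linorder by blast
qed

lemma set_integral_subset_le:
  fixes f :: "real \<Rightarrow> real"
  assumes int: "set_integrable lborel A f" and "B \<in> sets lborel" "B \<subseteq> A"
    and nonneg: "\<And>x. x \<in> A \<Longrightarrow> f x \<ge> 0"
  shows "(LINT x:B|lborel. f x) \<le> (LINT x:A|lborel. f x)"
  unfolding set_lebesgue_integral_def
proof (rule integral_mono)
  show "integrable lborel (\<lambda>x. indicator B x *\<^sub>R f x)"
    using set_integrable_subset[OF int assms(2,3)] by (simp add: set_integrable_def)
  show "integrable lborel (\<lambda>x. indicator A x *\<^sub>R f x)"
    using int by (simp add: set_integrable_def)
  show "indicator B x *\<^sub>R f x \<le> indicator A x *\<^sub>R f x" for x
    using nonneg[of x] \<open>B \<subseteq> A\<close> by (auto split: split_indicator)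
qed

lemma integrable_has_small_values:
  fixes f :: "real \<Rightarrow> real"
  assumes int: "set_integrable lborel {0..} f" and nonneg: "\<And>x. f x \<ge> 0"
    and "c > 0" "b \<ge> 0"
  obtains x where "x \<ge> b" "f x < c"
proof (rule ccontr)
  assume "\<not> thesis"
  then have ge: "f x \<ge> c" if "x \<ge> b" for x
    using that \<open>\<And>x. b \<le> x \<Longrightarrow> f x < c \<Longrightarrow> thesis\<close> by force
  define I where "I = (LINT x:{0..}|lborel. f x)"
  have I: "I \<ge> 0"
    unfolding I_def set_lebesgue_integral_def using nonneg by (intro Bochner_Integration.integral_nonneg) auto
  \<comment> \<open>Chosen so that \<open>c * (R - b)\<close> exceeds the total integral
    \<open>I\<close> by 1.\<close>
  define R where "R = b + (I + 1) / c"
  have "R \<ge> b" using I \<open>c > 0\<close> by (simp add: R_def)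
  have i: "set_integrable lborel {b..R} f"
    by (rule set_integrable_subset[OF int]) (use \<open>b \<ge> 0\<close> in auto)
  have ic: "set_integrable lborel {b..R} (\<lambda>x. c)"
    by (rule borel_integrable_atLeastAtMost') (rule continuous_on_const)
  have "c * (R - b) = I + 1"
    using \<open>c > 0\<close> by (simp add: R_def)
  then have "I + 1 = (LINT x:{b..R}|lborel. c)"
    using \<open>R \<ge> b\<close> set_borel_integral_eq_integral(2)[OF ic] by (simp add: mult.commute)
  also have "\<dots> \<le> (LINT x:{b..R}|lborel. f x)"
    by (rule set_integral_mono[OF ic i]) (use ge in auto)
  also have "\<dots> \<le> I"
    unfolding I_def by (rule set_integral_subset_le[OF int]) (use nonneg \<open>b \<ge> 0\<close> in auto)
  finally show False by simp
qed

lemma nondecreasing_on_ray: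
  fixes f f' :: "real \<Rightarrow> real"
  assumes "\<And>x. (f has_real_derivative f' x) (at x)" "\<And>x. x \<ge> a \<Longrightarrow> f' x \<ge> 0" "a \<le> x" "x \<le> y"
  shows "f x \<le> f y"
proof (rule DERIV_nonneg_imp_nondecreasing[OF \<open>x \<le> y\<close>])
  show "\<exists>d. (f has_real_derivative d) (at z) \<and> 0 \<le> d" if "x \<le> z" for z
    using assms(1)[of z] assms(2)[of z] assms(3) that by (intro exI[of _ "f' z"]) auto
qed

text \<open>\<open>\<lambda>\<close> need not be an eigenvalue, since square integrability is required near \<open>+\<infinity>\<close> only.\<close>

locale oscillator_solution =
  fixes u u' :: "real \<Rightarrow> real" and lam :: real
  assumes du: "(u has_real_derivative u' x) (at x)"
    and du': "(u' has_real_derivative (x\<^sup>2 - lam) * u x) (at x)"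
    and square_integrable: "set_integrable lborel {0..} (\<lambda>x. (u x)\<^sup>2)"
    and norm_le: "(LINT x:{0..}|lborel. (u x)\<^sup>2) \<le> 1"
    and lam_ge: "lam \<ge> 1"
begin

lemma cont_u: "continuous_on S u" and cont_u': "continuous_on S u'"
  using du du' DERIV_isCont continuous_at_imp_continuous_on by blast+

text \<open>\<open>w\<close> is half the derivative of \<open>u\<^sup>2\<close>. All bounds come
  from monotone quantities to the right of \<open>x0\<close>: a violation at one point would persist
  or grow from there on and would keep \<open>u\<^sup>2\<close> away from zero or make
  \<open>w\<close> positive, both of which integrability excludes.\<close>

lemma eventually_exp_decay:
  "\<exists>K x0. K \<ge> 0 \<and> x0 \<ge> 0 \<and> (\<forall>x\<ge>x0. (u x)\<^sup>2 \<le> K * exp (- x / 2) \<and> (u' x)\<^sup>2 \<le> K * exp (- x / 2))"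
proof -
  define w where "w = (\<lambda>x. u x * u' x)"
  \<comment> \<open>Beyond this point \<open>x\<^sup>2 - lam\<close> is at least 1, so the
    derivative of \<open>w\<close> is at least
    \<open>(u' x)\<^sup>2 + (u x)\<^sup>2\<close>.\<close>
  define x0 where "x0 = sqrt (lam + 1)"
  have x0: "x0 \<ge> 0" "x\<^sup>2 - lam \<ge> 1" if "x \<ge> x0" for x
  proof -
    show "x0 \<ge> 0" using lam_ge by (simp add: x0_def)
    then have "x0\<^sup>2 \<le> x\<^sup>2" using that by (intro power_mono)
    then show "x\<^sup>2 - lam \<ge> 1" using lam_ge by (simp add: x0_def)
  qed
  have x0_nonneg: "x0 \<ge> 0" using lam_ge by (simp add: x0_def)
  have dw: "(w has_real_derivative ((u' x)\<^sup>2 + (x\<^sup>2 - lam) * (u x)\<^sup>2)) (at x)" for x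
    unfolding w_def by (auto intro!: derivative_eq_intros du du' simp: power2_eq_square algebra_simps)
  have dusq: "((\<lambda>x. (u x)\<^sup>2) has_real_derivative 2 * w x) (at x)" for x
    unfolding w_def by (auto intro!: derivative_eq_intros du simp: power2_eq_square algebra_simps)
  have w'_ge: "(u' x)\<^sup>2 + (x\<^sup>2 - lam) * (u x)\<^sup>2 \<ge> (u' x)\<^sup>2 + (u x)\<^sup>2" if "x \<ge> x0" for x
    using mult_right_mono[OF x0(2)[OF that], of "(u x)\<^sup>2"] by simp
  have w'_nonneg: "(u' x)\<^sup>2 + (x\<^sup>2 - lam) * (u x)\<^sup>2 \<ge> 0" if "x \<ge> x0" for x
    using w'_ge[OF that] by (smt (verit) zero_le_power2)
  have w_mono: "w x \<le> w y" if "x0 \<le> x" "x \<le> y" for x y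
    using nondecreasing_on_ray[OF dw w'_nonneg that] .
  \<comment> \<open>If \<open>w\<close> were positive somewhere, \<open>u\<^sup>2\<close> would grow
    at least linearly from there on.\<close>
  have w_le: "w x \<le> 0" if x: "x \<ge> x0" for x
  proof (rule ccontr)
    assume "\<not> w x \<le> 0"
    then have pos: "w x > 0" by simp
    obtain y where y: "y \<ge> x + 1" "(u y)\<^sup>2 < 2 * w x"
      using integrable_has_small_values[OF square_integrable, of "2 * w x" "x + 1"] pos x x0_nonneg by auto
    have d: "((\<lambda>y. (u y)\<^sup>2 - 2 * w x * y) has_real_derivative 2 * w y - 2 * w x) (at y)" for y
      using DERIV_diff[OF dusq[of y] DERIV_cmult[OF DERIV_ident, of "2 * w x"]] by simp
    have "(u x)\<^sup>2 - 2 * w x * x \<le> (u y)\<^sup>2 - 2 * w x * y"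
      by (rule nondecreasing_on_ray[OF d, of x]) (use w_mono x y in auto)
    then have "2 * w x * (y - x) \<le> (u y)\<^sup>2"
      by (smt (verit) right_diff_distrib zero_le_power2)
    moreover have "2 * w x * 1 \<le> 2 * w x * (y - x)"
      using pos y by (intro mult_left_mono) auto
    ultimately show False using y by simp
  qed
  define K where "K = - w x0 * exp x0"
  have K: "K \<ge> 0" using w_le[of x0] by (simp add: K_def mult_nonpos_nonneg)
  \<comment> \<open>The product of \<open>w\<close> with \<open>exp\<close> is nondecreasing,
    because the derivative of \<open>w\<close> plus \<open>w\<close> is at least u^2 + u'^2 + u u'
    \<ge> 0.\<close>
  have w_ge: "w x \<ge> - K * exp (- x)" if x: "x \<ge> x0" for x
  proof -
    have d: "((\<lambda>x. w x * exp x) has_real_derivative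
        (((u' x)\<^sup>2 + (x\<^sup>2 - lam) * (u x)\<^sup>2) + w x) * exp x) (at x)" for x
      by (auto intro!: derivative_eq_intros dw simp: algebra_simps)
    have "((u' x)\<^sup>2 + (x\<^sup>2 - lam) * (u x)\<^sup>2) + w x \<ge> 0" if "x \<ge> x0" for x
      using w'_ge[OF that] sum_squares_bound[of "u x" "- u' x"] sum_squares_bound[of "u x" "u' x"] w_le[OF that]
      unfolding w_def by simp
    then have "w x0 * exp x0 \<le> w x * exp x"
      by (intro nondecreasing_on_ray[OF d _ order_refl x]) auto
    then have "- K * exp (- x) \<le> w x * exp x * exp (- x)"
      unfolding K_def by (intro mult_right_mono) auto
    also have "w x * exp x * exp (- x) = w x"
      by (simp only: mult.assoc exp_add[symmetric]) simp
    finally show ?thesis .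
  qed
  have u_le: "(u x)\<^sup>2 \<le> 2 * K * exp (- x)" if x: "x \<ge> x0" for x
  proof (rule ccontr)
    define f where "f = (\<lambda>x. (u x)\<^sup>2 - 2 * K * exp (- x))"
    assume "\<not> ?thesis"
    then have pos: "f x > 0" by (simp add: f_def)
    have d: "(f has_real_derivative 2 * (w x + K * exp (- x))) (at x)" for x
    proof -
      have "((\<lambda>x. 2 * K * exp (- x)) has_real_derivative - (2 * K * exp (- x))) (at x)"
        by (auto intro!: derivative_eq_intros)
      from DERIV_diff[OF dusq[of x] this] show ?thesis by (simp add: f_def distrib_left mult.assoc)
    qed
    obtain y where y: "y \<ge> x" "(u y)\<^sup>2 < f x"
      using integrable_has_small_values[OF square_integrable, of "f x" x] pos x x0_nonneg by auto
    have "2 * (w z + K * exp (- z)) \<ge> 0" if "z \<ge> x" for z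
      using w_ge[of z] that x by simp
    then have "f x \<le> f y"
      using y(1) by (intro nondecreasing_on_ray[OF d _ order_refl]) auto
    moreover have "f y \<le> (u y)\<^sup>2" using K by (simp add: f_def)
    ultimately show False using y by simp
  qed
  \<comment> \<open>The derivative of u'^2 is \<open>2 * ((x\<^sup>2 - lam) * w x)\<close>, and half
    of the decay of \<open>w\<close> is spent on the factor x^2. The constant 256 is 2 * 2 * 64: the
    64 from absorbing x^2, one 2 from differentiating the square and one from differentiating
    \<open>exp (- x / 2)\<close>.\<close>
  have u'_le: "(u' x)\<^sup>2 \<le> 256 * K * exp (- x / 2)" if x: "x \<ge> x0" for x
  proof (rule ccontr)
    define f where "f = (\<lambda>x. (u' x)\<^sup>2 - 256 * K * exp (- x / 2))"
    assume "\<not> ?thesis"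
    then have pos: "f x > 0" by (simp add: f_def)
    have d: "(f has_real_derivative 2 * ((x\<^sup>2 - lam) * w x) + 128 * K * exp (- x / 2)) (at x)" for x
      unfolding f_def w_def by (auto intro!: derivative_eq_intros du' simp: power2_eq_square)
    have "2 * ((y\<^sup>2 - lam) * w y) + 128 * K * exp (- y / 2) \<ge> 0" if y: "y \<ge> x0" for y
    proof -
      have "y\<^sup>2 * exp (- y) \<le> 16 * exp (- y / 2)"
        using power_mult_exp_le[of "2 * y" 2] y x0_nonneg by (simp add: power_mult_distrib mult.commute)
      also have "\<dots> \<le> 64 * exp (- y / 2)" by simp
      finally have "y\<^sup>2 * exp (- y) \<le> 64 * exp (- y / 2)" .
      then have "K * (y\<^sup>2 * exp (- y)) \<le> K * (64 * exp (- y / 2))"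
        using K by (intro mult_left_mono) auto
      moreover have "(y\<^sup>2 - lam) * (- w y) \<le> y\<^sup>2 * (K * exp (- y))"
        using w_ge[OF y] w_le[OF y] lam_ge x0(2)[OF y] by (intro mult_mono) auto
      ultimately show ?thesis by (simp add: algebra_simps)
    qed
    then have f_mono: "f x \<le> f y" if "y \<ge> x" for y
      using that x by (intro nondecreasing_on_ray[OF d, of x]) auto
    \<comment> \<open>Growth of \<open>w\<close> at rate at least \<open>f x\<close> brings it up to
      1 at this \<open>y\<close>.\<close>
    define y where "y = x + (1 - w x) / f x"
    have "y \<ge> x" using pos w_le[OF x] by (simp add: y_def)
    have d: "((\<lambda>y. w y - f x * y) has_real_derivative ((u' y)\<^sup>2 + (y\<^sup>2 - lam) * (u y)\<^sup>2) - f x) (at y)" for y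
      by (auto intro!: derivative_eq_intros dw)
    have "((u' y)\<^sup>2 + (y\<^sup>2 - lam) * (u y)\<^sup>2) - f x \<ge> 0" if "y \<ge> x" for y
    proof -
      have "0 \<le> 256 * K * exp (- y / 2)" using K by simp
      then have "f x \<le> (u' y)\<^sup>2" using f_mono[OF that] unfolding f_def by linarith
      then show ?thesis using w'_ge[of y] that x by (smt (verit) zero_le_power2)
    qed
    then have "w x - f x * x \<le> w y - f x * y"
      using \<open>y \<ge> x\<close> by (intro nondecreasing_on_ray[OF d, of x]) auto
    moreover have "f x * y = f x * x + (1 - w x)"
      using pos by (simp add: y_def field_simps)
    ultimately have "w y \<ge> 1" by simp
    then show False using w_le[of y] \<open>y \<ge> x\<close> x by simp
  qed
  have "(u x)\<^sup>2 \<le> 256 * K * exp (- x / 2)" if x: "x \<ge> x0" for x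
  proof -
    have "2 * K * exp (- x) \<le> 256 * K * exp (- x / 2)"
      using K x x0_nonneg by (intro mult_mono) auto
    then show ?thesis using u_le[OF x] by simp
  qed
  then show ?thesis
    using u'_le K x0_nonneg by (intro exI[of _ "256 * K"] exI[of _ x0]) auto
qed

lemma exp_decay:
  "\<exists>K\<ge>0. \<forall>x\<ge>0. (u x)\<^sup>2 \<le> K * exp (- x / 2) \<and> (u' x)\<^sup>2 \<le> K * exp (- x / 2)"
proof -
  obtain K x0 where K: "K \<ge> 0" "x0 \<ge> 0"
    "\<And>x. x \<ge> x0 \<Longrightarrow> (u x)\<^sup>2 \<le> K * exp (- x / 2)" "\<And>x. x \<ge> x0 \<Longrightarrow> (u' x)\<^sup>2 \<le> K * exp (- x / 2)"
    using eventually_exp_decay by blast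
  have "compact ((\<lambda>x. ((u x)\<^sup>2 + (u' x)\<^sup>2) * exp (x / 2)) ` {0..x0})"
    by (intro compact_continuous_image continuous_intros cont_u cont_u') auto
  then obtain B where B: "\<And>x. 0 \<le> x \<Longrightarrow> x \<le> x0 \<Longrightarrow> ((u x)\<^sup>2 + (u' x)\<^sup>2) * exp (x / 2) \<le> B"
    using compact_imp_bounded[THEN bounded_imp_bdd_above] unfolding bdd_above_def by fastforce
  have low: "(u x)\<^sup>2 + (u' x)\<^sup>2 \<le> B * exp (- x / 2)" if "0 \<le> x" "x \<le> x0" for x
  proof -
    have "((u x)\<^sup>2 + (u' x)\<^sup>2) * exp (x / 2) * exp (- x / 2) \<le> B * exp (- x / 2)"
      using B[OF that] by (intro mult_right_mono) auto
    also have "((u x)\<^sup>2 + (u' x)\<^sup>2) * exp (x / 2) * exp (- x / 2) = (u x)\<^sup>2 + (u' x)\<^sup>2"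
      by (simp only: mult.assoc exp_add[symmetric]) simp
    finally show ?thesis .
  qed
  have "(u x)\<^sup>2 \<le> max K B * exp (- x / 2) \<and> (u' x)\<^sup>2 \<le> max K B * exp (- x / 2)" if "x \<ge> 0" for x
  proof (cases "x \<ge> x0")
    case True
    have "K * exp (- x / 2) \<le> max K B * exp (- x / 2)" by (intro mult_right_mono) auto
    then show ?thesis using K(3,4)[OF True] by linarith
  next
    case False
    have "B * exp (- x / 2) \<le> max K B * exp (- x / 2)" by (intro mult_right_mono) auto
    then show ?thesis using low[of x] False that zero_le_power2[of "u x"] zero_le_power2[of "u' x"] by linarith
  qed
  then show ?thesis using K(1) by (intro exI[of _ "max K B"]) auto
qed

end

section \<open>Virial identities\<close>

lemma tendsto_zero_exp_decay:
  fixes f :: "real \<Rightarrow> real"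
  assumes "\<And>x. x \<ge> 0 \<Longrightarrow> \<bar>f x\<bar> \<le> C * exp (- x / 4)"
  shows "(f \<longlongrightarrow> 0) at_top"
proof (rule Lim_null_comparison)
  show "((\<lambda>x::real. C * exp (- x / 4)) \<longlongrightarrow> 0) at_top" by (rule tendsto_exp_quarter)
  show "\<forall>\<^sub>F x in at_top. norm (f x) \<le> C * exp (- x / 4)"
    unfolding eventually_at_top_linorder using assms by (intro exI[of _ 0]) auto
qed

text \<open>The growth of the constants in \<open>tail_moment_le\<close>, where each step of the
  recursion through the odd moments costs at most the factor
  \<open>20 * (real j + 1) ^ 3\<close>.\<close>

primrec virial_const :: "nat \<Rightarrow> real" where
  "virial_const 0 = 1"
| "virial_const (Suc j) = 20 * (real j + 1) ^ 3 * virial_const j"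

lemma virial_const_ge_one: "virial_const j \<ge> 1"
proof (induction j)
  case (Suc j)
  have "(1::real) \<le> (real j + 1) ^ 3" by simp
  then have "(1::real) \<le> 20 * (real j + 1) ^ 3" by linarith
  then have "1 * 1 \<le> (20 * (real j + 1) ^ 3) * virial_const j"
    using Suc by (intro mult_mono) auto
  then show ?case by simp
qed simp

text \<open>\<open>P0\<close>, \<open>P1\<close>, \<open>P2\<close>, \<open>P3\<close>,
  \<open>P4\<close> stand for the powers of x with exponents q, q - 1, q - 2, q - 3, q + 1, and
  \<open>r\<close>, \<open>r1\<close>, \<open>r2\<close> for q, q - 1, q - 2. The first assumption
  carries the factor \<open>r\<close> because at q = 0 the truncated exponent makes
  \<open>x ^ (q - 1) * x\<^sup>2\<close> differ from \<open>x ^ (q + 1)\<close>.\<close>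

lemma virial_algebra:
  fixes r :: real
  assumes "r * P1 * x\<^sup>2 = r * P4" "x * P0 = P4"
  shows "r * P1 * (v\<^sup>2 + (lam - x\<^sup>2) * u\<^sup>2) + (- 2 * x * u\<^sup>2) * P0
       - r * (r1 * P2 * (u * v) + (v\<^sup>2 - (lam - x\<^sup>2) * u\<^sup>2) * P1)
       + r * r1 / 2 * (r2 * P3 * u\<^sup>2 + 2 * (u * v) * P2) =
    2 * r * lam * (P1 * u\<^sup>2) + r * r1 * r2 / 2 * (P3 * u\<^sup>2) - (2 * r + 2) * (P4 * u\<^sup>2)"
proof -
  have "r * P1 * (v\<^sup>2 + (lam - x\<^sup>2) * u\<^sup>2) + (- 2 * x * u\<^sup>2) * P0
       - r * (r1 * P2 * (u * v) + (v\<^sup>2 - (lam - x\<^sup>2) * u\<^sup>2) * P1)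
       + r * r1 / 2 * (r2 * P3 * u\<^sup>2 + 2 * (u * v) * P2)
     = 2 * r * lam * (P1 * u\<^sup>2) + r * r1 * r2 / 2 * (P3 * u\<^sup>2) - 2 * u\<^sup>2 * (r * P1 * x\<^sup>2) - 2 * u\<^sup>2 * (x * P0)"
    by (simp add: algebra_simps)
  then show ?thesis unfolding assms by (simp add: algebra_simps)
qed

context oscillator_solution
begin

text \<open>Only the explicit dependence of the potential on x contributes to its derivative, which
  is \<open>- 2 * x * (u x)\<^sup>2\<close>. Hence it decreases on the positive half line and equals
  twice the first tail moment.\<close>

definition energy :: "real \<Rightarrow> real" where
  "energy x = (u' x)\<^sup>2 + (lam - x\<^sup>2) * (u x)\<^sup>2"

definition tail_moment :: "nat \<Rightarrow> real \<Rightarrow> real" where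
  "tail_moment p X = (LINT s:{X..}|lborel. s ^ p * (u s)\<^sup>2)"

lemma power_mult_le_exp:
  "\<exists>C. \<forall>x\<ge>0. \<bar>x ^ p * (u x)\<^sup>2\<bar> \<le> C * exp (- x / 4) \<and> \<bar>x ^ p * (u' x)\<^sup>2\<bar> \<le> C * exp (- x / 4)
     \<and> \<bar>x ^ p * (u x * u' x)\<bar> \<le> C * exp (- x / 4)"
proof -
  obtain K where K: "K \<ge> 0" "\<And>x. x \<ge> 0 \<Longrightarrow> (u x)\<^sup>2 \<le> K * exp (- x / 2)"
    "\<And>x. x \<ge> 0 \<Longrightarrow> (u' x)\<^sup>2 \<le> K * exp (- x / 2)"
    using exp_decay by blast
  have key: "\<bar>x ^ p * a\<bar> \<le> K * (4 * real p) ^ p * exp (- x / 4)"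
    if "x \<ge> 0" "\<bar>a\<bar> \<le> K * exp (- x / 2)" for x a
  proof -
    have "\<bar>x ^ p * a\<bar> \<le> x ^ p * (K * exp (- x / 2))"
      using that by (simp add: abs_mult mult_left_mono)
    also have "\<dots> = K * (x ^ p * exp (- x / 2))" by simp
    also have "\<dots> \<le> K * ((4 * real p) ^ p * exp (- x / 4))"
      using power_mult_exp_le[OF \<open>x \<ge> 0\<close>] K(1) by (rule mult_left_mono)
    finally show ?thesis by (simp only: mult.assoc)
  qed
  have "\<bar>u x * u' x\<bar> \<le> K * exp (- x / 2)" if "x \<ge> 0" for x
    using sum_squares_bound[of "u x" "u' x"] sum_squares_bound[of "u x" "- u' x"] K(2,3)[OF that]
    by (simp add: abs_le_iff)
  then show ?thesis
    using K by (intro exI[of _ "K * (4 * real p) ^ p"] allI impI conjI; intro key) simp_all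
qed

lemma integrable_power:
  assumes "X \<ge> 0"
  shows "set_integrable lborel {X..} (\<lambda>s. s ^ p * (u s)\<^sup>2)"
proof -
  obtain C where C: "\<forall>x\<ge>0. \<bar>x ^ p * (u x)\<^sup>2\<bar> \<le> C * exp (- x / 4)"
    using power_mult_le_exp[of p] by blast
  show ?thesis
    by (rule set_integrable_exp_decay[where C=C])
      (use C assms in \<open>auto intro!: continuous_intros cont_u\<close>)
qed

lemma energy_deriv: "(energy has_real_derivative - 2 * x * (u x)\<^sup>2) (at x)"
  unfolding energy_def by (auto intro!: derivative_eq_intros du du' simp: power2_eq_square algebra_simps)

lemma uu'_deriv: "((\<lambda>x. u x * u' x) has_real_derivative (u' x)\<^sup>2 - (lam - x\<^sup>2) * (u x)\<^sup>2) (at x)"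
  by (auto intro!: derivative_eq_intros du du' simp: power2_eq_square algebra_simps)

lemma u2_deriv: "((\<lambda>x. (u x)\<^sup>2) has_real_derivative 2 * (u x * u' x)) (at x)"
  by (auto intro!: derivative_eq_intros du simp: power2_eq_square algebra_simps)

text \<open>The multipliers of u u' and u^2 in \<open>F\<close> are chosen so that its derivative
  contains neither u'^2 nor u u'. What remains links three moments of u^2 to boundary data at
  \<open>X\<close>. Wherever a natural subtraction truncates, the coefficient in front of it is
  zero.\<close>

lemma virial_identity:
  assumes "X \<ge> 0"
  shows "(2 * real q + 2) * tail_moment (q + 1) X =
    2 * real q * lam * tail_moment (q - 1) X
    + real q * real (q - 1) * real (q - 2) / 2 * tail_moment (q - 3) X
    + X ^ q * energy X - real q * X ^ (q - 1) * (u X * u' X)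
    + real q * real (q - 1) / 2 * X ^ (q - 2) * (u X)\<^sup>2"
proof -
  define F where "F = (\<lambda>x. x ^ q * energy x - real q * (x ^ (q - 1) * (u x * u' x))
    + real q * real (q - 1) / 2 * (x ^ (q - 2) * (u x)\<^sup>2))"
  define f where "f = (\<lambda>x. 2 * real q * lam * (x ^ (q - 1) * (u x)\<^sup>2)
    + real q * real (q - 1) * real (q - 2) / 2 * (x ^ (q - 3) * (u x)\<^sup>2)
    - (2 * real q + 2) * (x ^ (q + 1) * (u x)\<^sup>2))"
  have d: "(F has_real_derivative f x) (at x)" for x
  proof -
    have dp: "((\<lambda>x. x ^ n) has_real_derivative real n * x ^ (n - 1)) (at x)" for n :: nat
      using DERIV_pow[of n x] by simp
    have D: "(F has_real_derivative (real q * x ^ (q - 1) * energy x + (- 2 * x * (u x)\<^sup>2) * x ^ q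
       - real q * (real (q - 1) * x ^ (q - 1 - 1) * (u x * u' x) + ((u' x)\<^sup>2 - (lam - x\<^sup>2) * (u x)\<^sup>2) * x ^ (q - 1))
       + real q * real (q - 1) / 2 * (real (q - 2) * x ^ (q - 2 - 1) * (u x)\<^sup>2 + 2 * (u x * u' x) * x ^ (q - 2)))) (at x)"
      unfolding F_def
      by (rule DERIV_add[OF DERIV_diff[OF DERIV_mult[OF dp[of q] energy_deriv]
            DERIV_cmult[OF DERIV_mult[OF dp[of "q - 1"] uu'_deriv]]]
            DERIV_cmult[OF DERIV_mult[OF dp[of "q - 2"] u2_deriv]]])
    have "real q * x ^ (q - 1) * x\<^sup>2 = real q * x ^ (q + 1)"
      by (cases q) (auto simp: power2_eq_square)
    then have eq: "(real q * x ^ (q - 1) * energy x + (- 2 * x * (u x)\<^sup>2) * x ^ q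
       - real q * (real (q - 1) * x ^ (q - 2) * (u x * u' x) + ((u' x)\<^sup>2 - (lam - x\<^sup>2) * (u x)\<^sup>2) * x ^ (q - 1))
       + real q * real (q - 1) / 2 * (real (q - 2) * x ^ (q - 3) * (u x)\<^sup>2 + 2 * (u x * u' x) * x ^ (q - 2))) = f x"
      unfolding f_def energy_def by (rule virial_algebra) simp
    have e: "q - 1 - 1 = q - 2" "q - 2 - 1 = q - 3" by auto
    show ?thesis using D unfolding e eq .
  qed
  have i: "set_integrable lborel {X..} (\<lambda>x. c * (x ^ p * (u x)\<^sup>2))" for c p
    using integrable_power[OF assms] by auto
  have t: "((\<lambda>x. x ^ p * (u x)\<^sup>2) \<longlongrightarrow> 0) at_top" "((\<lambda>x. x ^ p * (u' x)\<^sup>2) \<longlongrightarrow> 0) at_top"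
    "((\<lambda>x. x ^ p * (u x * u' x)) \<longlongrightarrow> 0) at_top" for p
  proof -
    obtain C where C: "\<forall>x\<ge>0. \<bar>x ^ p * (u x)\<^sup>2\<bar> \<le> C * exp (- x / 4) \<and> \<bar>x ^ p * (u' x)\<^sup>2\<bar> \<le> C * exp (- x / 4)
       \<and> \<bar>x ^ p * (u x * u' x)\<bar> \<le> C * exp (- x / 4)"
      using power_mult_le_exp[of p] by blast
    show "((\<lambda>x. x ^ p * (u x)\<^sup>2) \<longlongrightarrow> 0) at_top"
      by (rule tendsto_zero_exp_decay[where C=C]) (use C in blast)
    show "((\<lambda>x. x ^ p * (u' x)\<^sup>2) \<longlongrightarrow> 0) at_top"
      by (rule tendsto_zero_exp_decay[where C=C]) (use C in blast)
    show "((\<lambda>x. x ^ p * (u x * u' x)) \<longlongrightarrow> 0) at_top"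
      by (rule tendsto_zero_exp_decay[where C=C]) (use C in blast)
  qed
  have "F = (\<lambda>x. x ^ q * (u' x)\<^sup>2 + lam * (x ^ q * (u x)\<^sup>2) - x ^ (q + 2) * (u x)\<^sup>2
     - real q * (x ^ (q - 1) * (u x * u' x)) + real q * real (q - 1) / 2 * (x ^ (q - 2) * (u x)\<^sup>2))"
  proof
    have "a * ((u' x)\<^sup>2 + (lam - x\<^sup>2) * (u x)\<^sup>2) = a * (u' x)\<^sup>2 + lam * (a * (u x)\<^sup>2) - a * x\<^sup>2 * (u x)\<^sup>2" for a x
      by algebra
    then show "F x = x ^ q * (u' x)\<^sup>2 + lam * (x ^ q * (u x)\<^sup>2) - x ^ (q + 2) * (u x)\<^sup>2
     - real q * (x ^ (q - 1) * (u x * u' x)) + real q * real (q - 1) / 2 * (x ^ (q - 2) * (u x)\<^sup>2)" for x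
      unfolding F_def energy_def power_add by (simp only:)
  qed
  moreover have "(\<dots> \<longlongrightarrow> 0 + lam * 0 - 0 - real q * 0 + real q * real (q - 1) / 2 * 0) at_top"
    by (intro tendsto_add tendsto_diff tendsto_mult tendsto_const t)
  ultimately have lim: "(F \<longlongrightarrow> 0) at_top" by simp
  have int: "set_integrable lborel {X..} f"
    unfolding f_def by (rule set_integral_diff(1)[OF set_integral_add(1)[OF i i] i])
  have cont: "continuous_on UNIV f"
    unfolding f_def by (intro continuous_intros cont_u)
  have "(LINT x:{X..}|lborel. f x) = - F X"
    by (rule set_integral_FTC_at_top[OF d cont int lim])
  moreover have "(LINT x:{X..}|lborel. f x) = 2 * real q * lam * tail_moment (q - 1) X
    + real q * real (q - 1) * real (q - 2) / 2 * tail_moment (q - 3) X - (2 * real q + 2) * tail_moment (q + 1) X"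
    unfolding f_def tail_moment_def set_integral_diff(2)[OF set_integral_add(1)[OF i i] i]
      set_integral_add(2)[OF i i] set_integral_mult_right ..
  ultimately show ?thesis unfolding F_def by (simp only: mult.assoc)
qed

lemma energy_eq: "X \<ge> 0 \<Longrightarrow> energy X = 2 * tail_moment 1 X"
  using virial_identity[of X 0] by simp

lemma tail_moment_nonneg: "X \<ge> 0 \<Longrightarrow> tail_moment p X \<ge> 0"
  unfolding tail_moment_def set_lebesgue_integral_def
  by (intro Bochner_Integration.integral_nonneg) (auto split: split_indicator)

lemma energy_nonneg: "X \<ge> 0 \<Longrightarrow> energy X \<ge> 0"
  using energy_eq tail_moment_nonneg[of X 1] by simp

lemma energy_antimono: "0 \<le> x \<Longrightarrow> x \<le> y \<Longrightarrow> energy y \<le> energy x"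
  using nondecreasing_on_ray[of "\<lambda>x. - energy x" "\<lambda>x. 2 * x * (u x)\<^sup>2" 0 x y] DERIV_minus[OF energy_deriv] by simp

lemma mass_le: "tail_moment 0 0 \<le> 1"
  using norm_le by (simp add: tail_moment_def)

lemma uu'_le_energy:
  assumes "x\<^sup>2 \<le> lam"
  shows "2 * sqrt (lam - x\<^sup>2) * \<bar>u x * u' x\<bar> \<le> energy x"
proof -
  have "2 * \<bar>sqrt (lam - x\<^sup>2) * u x\<bar> * \<bar>u' x\<bar> \<le> (sqrt (lam - x\<^sup>2) * u x)\<^sup>2 + (u' x)\<^sup>2"
    using sum_squares_bound[of "\<bar>sqrt (lam - x\<^sup>2) * u x\<bar>" "\<bar>u' x\<bar>"] by simp
  then show ?thesis
    using assms by (simp add: energy_def power_mult_distrib abs_mult mult.assoc)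
qed

text \<open>The energy is twice the first moment, which is interpolated between moments 0 and 2. The
  virial identity with q = 1 trades moment 2 for moment 0 and the term \<open>u 0 * u' 0\<close>,
  and this term is absorbed into the energy itself.\<close>

lemma energy_zero_le: "energy 0 \<le> 2 * sqrt lam"
proof -
  have s: "sqrt lam > 0" "sqrt lam * sqrt lam = lam" "sqrt lam \<ge> 1" using lam_ge by auto
  have w: "2 * sqrt lam * \<bar>u 0 * u' 0\<bar> \<le> energy 0"
    using uu'_le_energy[of 0] lam_ge by simp
  \<comment> \<open>The term with \<open>u 0 * u' 0\<close> survives at \<open>X = 0\<close>, since
    \<open>0 ^ 0 = 1\<close>.\<close>
  have N2: "4 * tail_moment 2 0 = 2 * lam * tail_moment 0 0 - u 0 * u' 0"
    using virial_identity[of 0 1] by (simp add: numeral_2_eq_2)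
  have i: "set_integrable lborel {0..} (\<lambda>x. c * (x ^ p * (u x)\<^sup>2))" for c p
    using integrable_power[of 0] by auto
  have "tail_moment 1 0 \<le> (LINT s:{0..}|lborel. (1 / (2 * sqrt lam)) * (s ^ 2 * (u s)\<^sup>2) + (sqrt lam / 2) * (s ^ 0 * (u s)\<^sup>2))"
    unfolding tail_moment_def
  proof (rule set_integral_mono)
    show "set_integrable lborel {0..} (\<lambda>s. s ^ 1 * (u s)\<^sup>2)" by (rule integrable_power) simp
    show "set_integrable lborel {0..} (\<lambda>s. (1 / (2 * sqrt lam)) * (s ^ 2 * (u s)\<^sup>2) + (sqrt lam / 2) * (s ^ 0 * (u s)\<^sup>2))"
      by (intro set_integral_add set_integrable_mult_right integrable_power) auto
    fix x :: real
    have "x \<le> (1 / (2 * sqrt lam)) * x\<^sup>2 + sqrt lam / 2"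
    proof -
      have "0 \<le> (x - sqrt lam)\<^sup>2 / (2 * sqrt lam)" using s by auto
      also have "\<dots> = (1 / (2 * sqrt lam)) * x\<^sup>2 + sqrt lam / 2 - x"
        using s by (simp add: power2_eq_square field_simps)
      finally show ?thesis by simp
    qed
    then have "x * (u x)\<^sup>2 \<le> ((1 / (2 * sqrt lam)) * x\<^sup>2 + sqrt lam / 2) * (u x)\<^sup>2"
      by (rule mult_right_mono) simp
    then show "x ^ 1 * (u x)\<^sup>2 \<le> (1 / (2 * sqrt lam)) * (x ^ 2 * (u x)\<^sup>2) + (sqrt lam / 2) * (x ^ 0 * (u x)\<^sup>2)"
      by (simp add: algebra_simps)
  qed
  also have "\<dots> = (1 / (2 * sqrt lam)) * tail_moment 2 0 + (sqrt lam / 2) * tail_moment 0 0"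
    unfolding tail_moment_def
    by (simp only: i set_integral_add(2) set_integral_mult_right)
  finally have 1: "energy 0 \<le> (1 / sqrt lam) * tail_moment 2 0 + sqrt lam * tail_moment 0 0"
    using energy_eq[of 0] by simp
  have "sqrt lam * energy 0 \<le> sqrt lam * ((1 / sqrt lam) * tail_moment 2 0 + sqrt lam * tail_moment 0 0)"
    using 1 s by (intro mult_left_mono) auto
  also have "\<dots> = tail_moment 2 0 + lam * tail_moment 0 0"
    using s by (simp add: algebra_simps)
  also have "\<dots> = 3 / 2 * lam * tail_moment 0 0 - u 0 * u' 0 / 4"
    using N2 by simp
  also have "\<dots> \<le> 3 / 2 * lam + \<bar>u 0 * u' 0\<bar> / 4"
  proof -
    have "3 / 2 * lam * tail_moment 0 0 \<le> 3 / 2 * lam * 1"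
      using lam_ge by (intro mult_left_mono mass_le) auto
    then show ?thesis using abs_ge_minus_self[of "u 0 * u' 0"] by linarith
  qed
  finally have "sqrt lam * energy 0 \<le> 3 / 2 * lam + \<bar>u 0 * u' 0\<bar> / 4" .
  moreover have "\<bar>u 0 * u' 0\<bar> \<le> sqrt lam * \<bar>u 0 * u' 0\<bar>"
    using mult_right_mono[OF s(3), of "\<bar>u 0 * u' 0\<bar>"] by simp
  moreover have "energy 0 \<le> sqrt lam * energy 0"
    using mult_right_mono[OF s(3), of "energy 0"] energy_nonneg[of 0] by simp
  ultimately have "sqrt lam * energy 0 \<le> 3 / 2 * lam + sqrt lam * energy 0 / 8"
    using w by linarith
  then have "sqrt lam * energy 0 \<le> 2 * lam" using lam_ge by linarith
  also have "2 * lam = sqrt lam * (2 * sqrt lam)" using s(2) by (simp add: mult.left_commute)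
  finally show ?thesis using s(1) by (simp only: mult_le_cancel_left_pos)
qed

text \<open>A recursion through the odd moments that starts from the energy. \<open>D\<close>
  controls all boundary data at the right powers of \<surd>\<open>lam\<close>, so that every
  boundary term of the identity with exponent 2i is a multiple of \<open>lam ^ i * D\<close>. The
  induction carries all smaller indices, because the recursion reaches back two steps.\<close>

lemma tail_moment_le:
  assumes X: "0 \<le> X" "X\<^sup>2 \<le> lam"
    and D: "energy X \<le> D" "\<bar>u X * u' X\<bar> \<le> sqrt lam * D" "(u X)\<^sup>2 \<le> lam * D"
  shows "tail_moment (2 * j + 1) X \<le> virial_const j * lam ^ j * D"
proof -
  have D0: "D \<ge> 0" using D(1) energy_nonneg[OF X(1)] by simp
  have s: "sqrt lam * sqrt lam = lam" "sqrt lam \<ge> 1" "sqrt lam \<ge> 0" using lam_ge by auto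
  have Xs: "X \<le> sqrt lam" using X by (simp add: real_le_rsqrt)
  have Xp: "X ^ (2 * j) \<le> lam ^ j" for j
    using X power_mono[of "X\<^sup>2" lam j] by (simp add: power_mult)
  have "\<forall>i\<le>j. tail_moment (2 * i + 1) X \<le> virial_const j * lam ^ i * D"
  proof (induction j)
    case 0
    then show ?case using energy_eq[OF X(1)] D D0 by simp
  next
    case (Suc j)
    define V where "V = virial_const j"
    define J where "J = real j + 1"
    have J: "J \<ge> 1" "J \<le> J ^ 3" "J\<^sup>2 \<le> J ^ 3" "1 \<le> J ^ 3"
      using power_increasing[of 1 3 J] power_increasing[of 2 3 J] by (auto simp: J_def)
    have V: "V \<ge> 1" unfolding V_def by (rule virial_const_ge_one)
    have step: "virial_const (Suc j) = 20 * J ^ 3 * V" by (simp add: J_def V_def)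
    have "tail_moment (2 * i + 1) X \<le> virial_const (Suc j) * lam ^ i * D" if "i \<le> Suc j" for i
    proof (cases "i \<le> j")
      case True
      have "V * 1 \<le> V * (20 * J ^ 3)" using V J by (intro mult_left_mono) auto
      then have "V * (lam ^ i * D) \<le> (20 * J ^ 3 * V) * (lam ^ i * D)"
        using D0 lam_ge by (intro mult_right_mono) (auto simp: mult.commute)
      then show ?thesis
        using Suc True unfolding step V_def by (fastforce simp: mult.assoc)
    next
      case False
      then have i: "i = Suc j" using that by simp
      define T where "T = lam ^ i * D"
      have T: "T \<ge> 0" "lam * (lam ^ j * D) = T" using D0 lam_ge by (auto simp: T_def i)
      have a1: "lam * tail_moment (2 * j + 1) X \<le> V * T"
      proof -
        have "lam * tail_moment (2 * j + 1) X \<le> lam * (V * lam ^ j * D)"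
          using Suc lam_ge unfolding V_def by (intro mult_left_mono) auto
        then show ?thesis using T(2) by (simp add: mult.left_commute mult.assoc)
      qed
      \<comment> \<open>The factor \<open>real j\<close> takes care of \<open>j = 0\<close>, where
        \<open>2 * j - 1\<close> truncates to the even index 0.\<close>
      have a2: "real j * tail_moment (2 * j - 1) X \<le> real j * (V * T)"
      proof (cases j)
        case (Suc l)
        have "tail_moment (2 * l + 1) X \<le> V * lam ^ l * D"
          using Suc.IH Suc unfolding V_def by simp
        also have "\<dots> \<le> V * lam ^ i * D"
          using V D0 lam_ge Suc i power_increasing[of l i lam] by (intro mult_right_mono mult_left_mono) auto
        finally show ?thesis using Suc by (intro mult_left_mono) (auto simp: T_def mult.assoc)
      qed simp
      have b1: "X ^ (2 * i) * energy X \<le> T"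
        unfolding T_def using Xp[of i] D energy_nonneg[OF X(1)] lam_ge by (intro mult_mono) auto
      have b2: "X ^ (2 * j + 1) * \<bar>u X * u' X\<bar> \<le> T"
      proof -
        have "X ^ (2 * j + 1) * \<bar>u X * u' X\<bar> \<le> (lam ^ j * sqrt lam) * (sqrt lam * D)"
          unfolding power_add power_one_right
          using Xp[of j] Xs D(2) X(1) lam_ge D0 by (intro mult_mono) auto
        also have "\<dots> = T" unfolding T(2)[symmetric] using s by (simp add: algebra_simps)
        finally show ?thesis .
      qed
      have b3: "X ^ (2 * j) * (u X)\<^sup>2 \<le> T"
      proof -
        have "X ^ (2 * j) * (u X)\<^sup>2 \<le> lam ^ j * (lam * D)"
          using Xp[of j] D(3) lam_ge by (intro mult_mono) auto
        then show ?thesis using T(2) by (simp add: algebra_simps)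
      qed
      \<comment> \<open>The virial identity with exponent \<open>2 * i\<close>, which is
        \<open>2 * J\<close> as a real number.\<close>
      have "(4 * J + 2) * tail_moment (2 * i + 1) X =
          4 * J * (lam * tail_moment (2 * j + 1) X)
          + J * (2 * real j + 1) * 2 * (real j * tail_moment (2 * j - 1) X)
          + X ^ (2 * i) * energy X - 2 * J * (X ^ (2 * j + 1) * (u X * u' X))
          + J * (2 * real j + 1) * (X ^ (2 * j) * (u X)\<^sup>2)"
      proof -
        have n: "2 * i - 1 = 2 * j + 1" "2 * i - 2 = 2 * j" "2 * i - 3 = 2 * j - 1"
          and r: "real (2 * i) = 2 * J" "real (2 * j + 1) = 2 * real j + 1" "real (2 * j) = 2 * real j"
          by (auto simp: i J_def)
        have c: "2 * J * (2 * real j + 1) * (2 * real j) / 2 = J * (2 * real j + 1) * 2 * real j"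
          "2 * J * (2 * real j + 1) / 2 = J * (2 * real j + 1)" "2 * (2 * J) = 4 * J"
          by simp_all
        show ?thesis
          using virial_identity[OF X(1), of "2 * i"] unfolding n r c by (simp only: mult.assoc)
      qed
      also have "\<dots> \<le> 4 * J * (V * T) + J * (2 * real j + 1) * 2 * (real j * (V * T)) + T + 2 * J * T
          + J * (2 * real j + 1) * T"
      proof -
        have "- (X ^ (2 * j + 1) * (u X * u' X)) \<le> T"
        proof -
          have "- (X ^ (2 * j + 1) * (u X * u' X)) \<le> X ^ (2 * j + 1) * \<bar>u X * u' X\<bar>"
            using X(1) abs_ge_minus_self[of "X ^ (2 * j + 1) * (u X * u' X)"] by (simp add: abs_mult)
          then show ?thesis using b2 by simp
        qed
        then have "2 * J * (- (X ^ (2 * j + 1) * (u X * u' X))) \<le> 2 * J * T"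
          using J(1) by (intro mult_left_mono) auto
        moreover have "4 * J * (lam * tail_moment (2 * j + 1) X) \<le> 4 * J * (V * T)"
          using a1 J(1) by (intro mult_left_mono) auto
        moreover have "J * (2 * real j + 1) * 2 * (real j * tail_moment (2 * j - 1) X) \<le> J * (2 * real j + 1) * 2 * (real j * (V * T))"
          using mult_left_mono[OF a2, of "J * (2 * real j + 1) * 2"] J(1) by simp
        moreover have "J * (2 * real j + 1) * (X ^ (2 * j) * (u X)\<^sup>2) \<le> J * (2 * real j + 1) * T"
          using b3 J(1) by (intro mult_left_mono) auto
        ultimately show ?thesis using b1 by linarith
      qed
      also have "\<dots> \<le> 20 * J ^ 3 * V * T"
      proof -
        have "T \<le> V * T" using V T(1) mult_right_mono[of 1 V T] by simp
        moreover have "2 * J * T \<le> 2 * J * (V * T)" "J * (2 * real j + 1) * T \<le> J * (2 * real j + 1) * (V * T)"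
          using calculation J(1) by (auto intro!: mult_left_mono)
        \<comment> \<open>Origin of the 20: the coefficients add up to a cubic in \<open>J\<close>
          whose positive coefficients sum to 12.\<close>
        moreover have "4 * J + J * (2 * real j + 1) * 2 * real j + 1 + 2 * J + J * (2 * real j + 1) \<le> 20 * J ^ 3"
        proof -
          have rj: "real j = J - 1" by (simp add: J_def)
          have "4 * J + J * (2 * real j + 1) * 2 * real j + 1 + 2 * J + J * (2 * real j + 1)
              = 4 * J^3 - 4 * J\<^sup>2 + 7 * J + 1"
            unfolding rj by (simp add: power2_eq_square power3_eq_cube algebra_simps)
          then show ?thesis using J zero_le_power2[of J] by linarith
        qed
        then have "(4 * J + J * (2 * real j + 1) * 2 * real j + 1 + 2 * J + J * (2 * real j + 1)) * (V * T) \<le> 20 * J ^ 3 * (V * T)"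
          using V T by (intro mult_right_mono) auto
        ultimately show ?thesis by (simp add: algebra_simps)
      qed
      finally have "(4 * J + 2) * tail_moment (2 * i + 1) X \<le> 20 * J ^ 3 * V * T" .
      moreover have "1 * tail_moment (2 * i + 1) X \<le> (4 * J + 2) * tail_moment (2 * i + 1) X"
        using J(1) tail_moment_nonneg[OF X(1)] by (intro mult_right_mono) auto
      ultimately show ?thesis unfolding step T_def by (simp add: mult.assoc)
    qed
    then show ?case by blast
  qed
  then show ?thesis by blast
qed

end

section \<open>WKB bounds for a single solution\<close>

definition wkb_freq :: "real \<Rightarrow> real \<Rightarrow> real" where
  "wkb_freq lam x = sqrt (lam - x\<^sup>2)"

lemma wkb_freq_pos: "x\<^sup>2 < lam \<Longrightarrow> wkb_freq lam x > 0"
  by (simp add: wkb_freq_def)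

lemma wkb_freq_sq: "x\<^sup>2 \<le> lam \<Longrightarrow> (wkb_freq lam x)\<^sup>2 = lam - x\<^sup>2"
  by (simp add: wkb_freq_def)

lemma wkb_freq_deriv:
  assumes "x\<^sup>2 < lam"
  shows "(wkb_freq lam has_real_derivative - x / wkb_freq lam x) (at x within S)"
  unfolding wkb_freq_def using assms
  by (auto intro!: derivative_eq_intros simp: field_simps)

lemma wkb_freq_antimono:
  assumes "0 \<le> x" "x \<le> y"
  shows "wkb_freq lam y \<le> wkb_freq lam x"
  unfolding wkb_freq_def using assms by (simp add: power_mono)

section \<open>The weight and the constant of its tail\<close>

definition weight :: "real \<Rightarrow> real \<Rightarrow> real" where
  "weight \<mu> x = japanese x powr \<mu>"

lemma weight_eq: "weight \<mu> x = (1 + x\<^sup>2) powr (\<mu> / 2)"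
proof -
  have "japanese x = (1 + x\<^sup>2) powr (1 / 2)"
    unfolding japanese_def by (simp add: powr_half_sqrt)
  then show ?thesis unfolding weight_def by (simp add: powr_powr)
qed

lemma weight_pos: "weight \<mu> x > 0"
  unfolding weight_eq by (smt (verit) powr_gt_zero zero_le_power2)

lemma weight_sq: "(weight \<mu> x)\<^sup>2 = weight (2 * \<mu>) x"
  unfolding weight_eq by (simp add: power2_eq_square powr_add[symmetric])

lemma cont_weight: "continuous_on S (weight \<mu>)"
  unfolding weight_eq[abs_def]
  by (intro continuous_intros) (smt (verit) zero_le_power2)

lemma weight_mono:
  assumes "\<mu> \<ge> 0" "0 \<le> x" "x \<le> y"
  shows "weight \<mu> x \<le> weight \<mu> y"
  unfolding weight_eq using assms by (intro powr_mono2) (auto intro: power_mono)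

lemma weight_le_power:
  assumes "\<mu> \<le> 2 * real n"
  shows "weight \<mu> x \<le> (1 + x\<^sup>2) ^ n"
proof -
  have "weight \<mu> x \<le> (1 + x\<^sup>2) powr real n"
    unfolding weight_eq using assms by (intro powr_mono) auto
  also have "\<dots> = (1 + x\<^sup>2) ^ n"
    by (rule powr_realpow) (smt (verit) zero_le_power2)
  finally show ?thesis .
qed

lemma weight_le_lam:
  assumes "\<mu> \<ge> 0" "x\<^sup>2 \<le> lam" "lam \<ge> 1"
  shows "weight \<mu> x \<le> 2 powr (\<mu> / 2) * lam powr (\<mu> / 2)"
proof -
  have "weight \<mu> x \<le> (2 * lam) powr (\<mu> / 2)"
    unfolding weight_eq using assms by (intro powr_mono2) auto
  then show ?thesis using assms by (simp add: powr_mult)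
qed

text \<open>The product of \<open>weight (2 * \<mu>) s\<close> and
  \<open>1 + s\<^sup>2 / lam\<close> grows like s^(2\<mu> + 2), and \<open>j\<close> makes
  \<open>2 * j + 1\<close> an odd exponent at least that large. The power of 5 comes from 1 + s^2
  \<le> 5 s^2 on the tail; the power of 2 comes from s \<ge> \<surd>\<open>lam\<close> / 2, which
  trades the excess 2j - 1 - 2\<mu> of the exponent for a power of \<open>lam\<close>.\<close>

definition tail_const :: "real \<Rightarrow> real" where
  "tail_const \<mu> = (let j = nat \<lceil>\<mu>\<rceil> + 1 in
     5 powr (\<mu> + 1) * 2 powr (2 * real j - 1 - 2 * \<mu>) * virial_const j)"

lemma tail_const_pos: "tail_const \<mu> > 0"
  unfolding tail_const_def Let_def using virial_const_ge_one by (smt (verit) mult_pos_pos powr_gt_zero)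

context oscillator_solution
begin

text \<open>\<open>J\<close> is the adiabatic invariant. Its derivative is \<tau> times the
  derivative of u u', so subtracting \<tau> u u' leaves only the derivative of \<tau>. The Airy
  condition gives \<tau> \<le> 1, hence \<open>K\<close> is at least half of \<open>J\<close>, and
  Gronwall's inequality costs only exp \<tau> \<le> 3: from K 0 \<le> 2 one gets K \<le> 6 and J
  \<le> 12.\<close>

lemma wkb_amplitude_le:
  assumes x: "0 \<le> x" "x\<^sup>2 < lam" and airy: "x \<le> wkb_freq lam x ^ 3"
  shows "wkb_freq lam x * (u x)\<^sup>2 + (u' x)\<^sup>2 / wkb_freq lam x \<le> 12"
proof -
  define q where "q = wkb_freq lam"
  define \<tau> where "\<tau> = (\<lambda>y. y / q y ^ 3)"
  define \<tau>' where "\<tau>' = (\<lambda>y. 1 / q y ^ 3 + 3 * y\<^sup>2 / q y ^ 5)"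
  define J where "J = (\<lambda>y. q y * (u y)\<^sup>2 + (u' y)\<^sup>2 / q y)"
  define K where "K = (\<lambda>y. J y - \<tau> y * (u y * u' y))"
  have y2: "y\<^sup>2 < lam" if "0 \<le> y" "y \<le> x" for y
    using power_mono[OF that(2,1), of 2] x by linarith
  have q0: "q y > 0" if "0 \<le> y" "y \<le> x" for y
    unfolding q_def using y2[OF that] by (rule wkb_freq_pos)
  have qq: "(q y)\<^sup>2 = lam - y\<^sup>2" if "0 \<le> y" "y \<le> x" for y
    unfolding q_def using y2[OF that] by (simp add: wkb_freq_sq)
  have dq: "(q has_real_derivative - y / q y) (at y)" if "0 \<le> y" "y \<le> x" for y
    unfolding q_def using y2[OF that] by (rule wkb_freq_deriv)
  have d\<tau>: "(\<tau> has_real_derivative \<tau>' y) (at y)" if "0 \<le> y" "y \<le> x" for y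
    unfolding \<tau>_def \<tau>'_def using q0[OF that]
    by (auto intro!: derivative_eq_intros dq[OF that] simp: field_simps power_numeral_reduce)
  have dK: "(K has_real_derivative - \<tau>' y * (u y * u' y)) (at y)" if y: "0 \<le> y" "y \<le> x" for y
  proof -
    have "(J has_real_derivative \<tau> y * ((u' y)\<^sup>2 - (lam - y\<^sup>2) * (u y)\<^sup>2)) (at y)"
    proof -
      have "(J has_real_derivative
        (- y / q y) * (u y)\<^sup>2 + (2 * (u y * u' y)) * q y
        + ((2 * u' y * ((y\<^sup>2 - lam) * u y)) * q y - (u' y)\<^sup>2 * (- y / q y)) / (q y * q y)) (at y)"
      proof -
        have "((\<lambda>y. (u' y)\<^sup>2) has_real_derivative 2 * u' y * ((y\<^sup>2 - lam) * u y)) (at y)"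
          using DERIV_power[OF du'[of y], of 2] by (simp add: mult_ac)
        from DERIV_add[OF DERIV_mult[OF dq[OF y] u2_deriv] DERIV_divide[OF this dq[OF y]]]
        show ?thesis using q0[OF y] unfolding J_def by simp
      qed
      moreover have "(- y / q y) * (u y)\<^sup>2 + (2 * (u y * u' y)) * q y
        + ((2 * u' y * ((y\<^sup>2 - lam) * u y)) * q y - (u' y)\<^sup>2 * (- y / q y)) / (q y * q y)
        = \<tau> y * ((u' y)\<^sup>2 - (lam - y\<^sup>2) * (u y)\<^sup>2)"
      proof -
        have "y\<^sup>2 - lam = - (q y)\<^sup>2" "lam - y\<^sup>2 = (q y)\<^sup>2" using qq[OF y] by auto
        then show ?thesis
          using q0[OF y] unfolding \<tau>_def
          by (simp add: divide_simps) (simp add: algebra_simps power2_eq_square power3_eq_cube)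
      qed
      ultimately show ?thesis by simp
    qed
    from DERIV_diff[OF this DERIV_mult[OF d\<tau>[OF y] uu'_deriv[of y]]]
    show ?thesis unfolding K_def by (simp add: algebra_simps)
  qed
  have \<tau>1: "0 \<le> \<tau> y" "\<tau> y \<le> 1" if y: "0 \<le> y" "y \<le> x" for y
  proof -
    show "0 \<le> \<tau> y" unfolding \<tau>_def using q0[OF y] y by simp
    have "q x ^ 3 \<le> q y ^ 3"
      using q0[of x] x(1) y by (intro power_mono) (auto simp: q_def wkb_freq_antimono)
    then have "y \<le> q y ^ 3" using airy y by (simp add: q_def)
    then show "\<tau> y \<le> 1" unfolding \<tau>_def using q0[OF y] by simp
  qed
  have J2: "2 * \<bar>u y * u' y\<bar> \<le> J y" if y: "0 \<le> y" "y \<le> x" for y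
  proof -
    have "2 * q y * \<bar>u y * u' y\<bar> \<le> energy y"
      using uu'_le_energy[of y] y2[OF y] unfolding q_def wkb_freq_def by simp
    moreover have "energy y = q y * J y"
      using q0[OF y] unfolding energy_def J_def qq[OF y, symmetric] by (simp add: field_simps power2_eq_square)
    ultimately show ?thesis using q0[OF y] by simp
  qed
  have JK: "K y \<ge> J y - \<bar>u y * u' y\<bar>" if y: "0 \<le> y" "y \<le> x" for y
  proof -
    have "\<tau> y * (u y * u' y) \<le> \<bar>\<tau> y * (u y * u' y)\<bar>" by simp
    also have "\<dots> \<le> 1 * \<bar>u y * u' y\<bar>"
      unfolding abs_mult[of "\<tau> y"] using \<tau>1[OF y] by (intro mult_right_mono) auto
    finally show ?thesis unfolding K_def by simp
  qed
  \<comment> \<open>Gronwall: the derivative -\<tau>' u u' of \<open>K\<close> is at most \<tau>' K,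
    because \<bar>u u'\<bar> \<le> J / 2 and hence \<bar>u u'\<bar> \<le> K.\<close>
  have "K x * exp (- \<tau> x) \<le> K 0 * exp (- \<tau> 0)"
  proof (rule DERIV_nonpos_imp_nonincreasing[OF x(1)])
    fix y assume y: "0 \<le> y" "y \<le> x"
    have "((\<lambda>y. K y * exp (- \<tau> y)) has_real_derivative
       (- \<tau>' y * (u y * u' y)) * exp (- \<tau> y) + (exp (- \<tau> y) * (- \<tau>' y)) * K y) (at y)"
      by (intro DERIV_mult dK DERIV_fun_exp DERIV_minus d\<tau> y)
    moreover have "(- \<tau>' y * (u y * u' y)) * exp (- \<tau> y) + (exp (- \<tau> y) * (- \<tau>' y)) * K y
       = - (\<tau>' y * exp (- \<tau> y) * (u y * u' y + K y))" by (simp add: algebra_simps)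
    moreover have "\<tau>' y \<ge> 0" unfolding \<tau>'_def using q0[OF y] by simp
    moreover have "u y * u' y + K y \<ge> 0"
      using J2[OF y] JK[OF y] by linarith
    ultimately show "\<exists>d. ((\<lambda>y. K y * exp (- \<tau> y)) has_real_derivative d) (at y) \<and> d \<le> 0"
      by (intro exI[of _ "- (\<tau>' y * exp (- \<tau> y) * (u y * u' y + K y))"]) auto
  qed
  moreover have "K 0 \<le> 2"
  proof -
    have "sqrt lam > 0" "sqrt lam * sqrt lam = lam" using lam_ge by auto
    moreover have "energy 0 = sqrt lam * K 0"
      using calculation by (simp add: energy_def K_def J_def \<tau>_def q_def wkb_freq_def field_simps)
    ultimately show ?thesis using energy_zero_le by simp
  qed
  ultimately have "K x * exp (- \<tau> x) \<le> 2" by (simp add: \<tau>_def)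
  then have "K x * exp (- \<tau> x) * exp (\<tau> x) \<le> 2 * exp (\<tau> x)" by (intro mult_right_mono) auto
  also have "K x * exp (- \<tau> x) * exp (\<tau> x) = K x" by (simp only: mult.assoc exp_add[symmetric]) simp
  also have "2 * exp (\<tau> x) \<le> 2 * 3"
    using \<tau>1[of x] x(1) exp_le by (intro mult_left_mono) (auto intro: order_trans[of _ "exp 1"])
  finally have "K x \<le> 6" by simp
  then show ?thesis using J2[of x] JK[of x] x(1) unfolding J_def q_def by auto
qed

lemma interior_bounds:
  assumes x: "0 \<le> x" "x\<^sup>2 < lam" and airy: "x \<le> wkb_freq lam x ^ 3"
  shows "wkb_freq lam x * (u x)\<^sup>2 \<le> 12" "(u' x)\<^sup>2 \<le> 12 * wkb_freq lam x"
    "\<bar>u x * u' x\<bar> \<le> 6" "energy x \<le> 12 * wkb_freq lam x"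
proof -
  define q where "q = wkb_freq lam x"
  have q: "q > 0" "q\<^sup>2 = lam - x\<^sup>2"
    unfolding q_def using x by (auto simp: wkb_freq_pos wkb_freq_sq)
  have J: "q * (u x)\<^sup>2 + (u' x)\<^sup>2 / q \<le> 12"
    using wkb_amplitude_le[OF assms] by (simp add: q_def)
  have nn: "(u' x)\<^sup>2 / q \<ge> 0" "q * (u x)\<^sup>2 \<ge> 0" using q by auto
  show "wkb_freq lam x * (u x)\<^sup>2 \<le> 12" using J nn unfolding q_def by linarith
  have "(u' x)\<^sup>2 / q \<le> 12" using J nn by linarith
  then show "(u' x)\<^sup>2 \<le> 12 * wkb_freq lam x"
    using q unfolding q_def[symmetric] by (simp add: pos_divide_le_eq)
  have "energy x = q * (q * (u x)\<^sup>2 + (u' x)\<^sup>2 / q)"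
    using q(1) unfolding energy_def q(2)[symmetric] by (simp add: field_simps power2_eq_square)
  also have "\<dots> \<le> q * 12" using J q by (intro mult_left_mono) auto
  finally show e: "energy x \<le> 12 * wkb_freq lam x" by (simp add: q_def)
  have "2 * q * \<bar>u x * u' x\<bar> \<le> energy x"
    using uu'_le_energy[of x] x unfolding q_def wkb_freq_def by simp
  then have "q * (2 * \<bar>u x * u' x\<bar>) \<le> q * 12" using e by (simp add: q_def)
  then show "\<bar>u x * u' x\<bar> \<le> 6" using q by simp
qed

text \<open>In the inner region \<open>lam - x\<^sup>2\<close> is comparable with
  \<open>lam\<close>, so the decreasing energy bounds u^2 directly.\<close>

lemma bulk_bound:
  assumes "0 \<le> x" "x\<^sup>2 \<le> lam / 2"
  shows "(u x)\<^sup>2 \<le> 4 / sqrt lam"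
proof -
  have s: "sqrt lam > 0" "sqrt lam * sqrt lam = lam" using lam_ge by auto
  have "lam / 2 * (u x)\<^sup>2 \<le> (lam - x\<^sup>2) * (u x)\<^sup>2"
    using assms by (intro mult_right_mono) auto
  also have "\<dots> \<le> energy x" by (simp add: energy_def)
  also have "\<dots> \<le> 2 * sqrt lam"
    using energy_antimono[of 0 x] assms energy_zero_le by simp
  finally have "sqrt lam * (sqrt lam * (u x)\<^sup>2) \<le> sqrt lam * 4"
    using s by (simp add: mult.assoc[symmetric])
  then have "sqrt lam * (u x)\<^sup>2 \<le> 4" using s(1) by (simp only: mult_le_cancel_left_pos)
  then show ?thesis using s(1) by (simp add: pos_le_divide_eq mult.commute)
qed

text \<open>Integer powers suffice for integrability, since \<open>weight_le_power\<close> rounds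
  the exponent of the weight up.\<close>

lemma polynomial_weight_le_exp:
  "\<exists>C. \<forall>x\<ge>0. (1 + x\<^sup>2) ^ n * (u x)\<^sup>2 \<le> C * exp (- x / 4)"
proof -
  obtain C1 where C1: "\<forall>x\<ge>0. \<bar>x ^ 0 * (u x)\<^sup>2\<bar> \<le> C1 * exp (- x / 4)"
    using power_mult_le_exp[of 0] by blast
  obtain C2 where C2: "\<forall>x\<ge>0. \<bar>x ^ (2 * n) * (u x)\<^sup>2\<bar> \<le> C2 * exp (- x / 4)"
    using power_mult_le_exp[of "2 * n"] by blast
  have "(1 + x\<^sup>2) ^ n * (u x)\<^sup>2 \<le> 2 ^ n * (C1 + C2) * exp (- x / 4)" if x: "x \<ge> 0" for x
  proof -
    have "(1 + x\<^sup>2) ^ n \<le> (2 * max 1 (x\<^sup>2)) ^ n" by (intro power_mono) auto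
    also have "\<dots> = 2 ^ n * max 1 (x\<^sup>2) ^ n" by (rule power_mult_distrib)
    also have "max 1 (x\<^sup>2) ^ n \<le> 1 + x ^ (2 * n)"
      by (cases "x\<^sup>2 \<ge> 1") (auto simp: max_def power_mult)
    finally have "(1 + x\<^sup>2) ^ n \<le> 2 ^ n * (1 + x ^ (2 * n))" by simp
    then have "(1 + x\<^sup>2) ^ n * (u x)\<^sup>2 \<le> 2 ^ n * (1 + x ^ (2 * n)) * (u x)\<^sup>2"
      by (rule mult_right_mono) simp
    also have "\<dots> = 2 ^ n * (x ^ 0 * (u x)\<^sup>2 + x ^ (2 * n) * (u x)\<^sup>2)" by (simp add: algebra_simps)
    also have "\<dots> \<le> 2 ^ n * (C1 * exp (- x / 4) + C2 * exp (- x / 4))"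
      using C1 C2 x by (intro mult_left_mono add_mono) (auto simp: abs_le_iff)
    finally show ?thesis by (simp add: algebra_simps)
  qed
  then show ?thesis by blast
qed

lemma integrable_weight:
  assumes "X \<ge> 0"
  shows "set_integrable lborel {X..} (\<lambda>s. weight \<mu> s * (1 + s\<^sup>2 / lam) * (u s)\<^sup>2)"
proof -
  define n where "n = nat \<lceil>\<mu>\<rceil>"
  have n: "\<mu> \<le> 2 * real n" unfolding n_def by linarith
  obtain C where C: "\<forall>x\<ge>0. (1 + x\<^sup>2) ^ (n + 1) * (u x)\<^sup>2 \<le> C * exp (- x / 4)"
    using polynomial_weight_le_exp[of "n + 1"] by blast
  show ?thesis
  proof (rule set_integrable_exp_decay[where C = C])
    show "continuous_on {X..} (\<lambda>s. weight \<mu> s * (1 + s\<^sup>2 / lam) * (u s)\<^sup>2)"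
      using lam_ge by (intro continuous_intros cont_weight cont_u) auto
    fix x assume x: "x \<ge> X"
    have p: "0 \<le> 1 + x\<^sup>2 / lam" using lam_ge by simp
    have "x\<^sup>2 / lam \<le> x\<^sup>2 / 1" using lam_ge by (intro divide_left_mono) auto
    then have "weight \<mu> x * (1 + x\<^sup>2 / lam) \<le> (1 + x\<^sup>2) ^ n * (1 + x\<^sup>2)"
      using p by (intro mult_mono weight_le_power[OF n]) auto
    then have "weight \<mu> x * (1 + x\<^sup>2 / lam) * (u x)\<^sup>2 \<le> (1 + x\<^sup>2) ^ (n + 1) * (u x)\<^sup>2"
      by (intro mult_right_mono) (auto simp: mult.commute)
    moreover have "norm (weight \<mu> x * (1 + x\<^sup>2 / lam) * (u x)\<^sup>2) = weight \<mu> x * (1 + x\<^sup>2 / lam) * (u x)\<^sup>2"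
      using p less_imp_le[OF weight_pos[of \<mu> x]] by (simp add: abs_mult)
    moreover have "(1 + x\<^sup>2) ^ (n + 1) * (u x)\<^sup>2 \<le> C * exp (- x / 4)" using C x assms by auto
    ultimately show "norm (weight \<mu> x * (1 + x\<^sup>2 / lam) * (u x)\<^sup>2) \<le> C * exp (- x / 4)" by linarith
  qed
qed

text \<open>The factor \<open>1 + s\<^sup>2 / lam\<close> is the price that \<open>u\<close> pays so
  that its inverse can confine the other solution to s of order \<surd>\<open>lam\<close> in
  \<open>product_tail_le\<close>.\<close>

definition weighted_tail :: "real \<Rightarrow> real \<Rightarrow> real" where
  "weighted_tail \<mu> X = (LINT s:{X..}|lborel. weight \<mu> s * (1 + s\<^sup>2 / lam) * (u s)\<^sup>2)"

text \<open>For s \<ge> X \<ge> \<surd>\<open>lam\<close> / 2 the integrand is dominated pointwise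
  by a constant times s^(2j + 1) u^2, and that odd tail moment is controlled by
  \<open>tail_moment_le\<close>.\<close>

lemma weighted_tail_le:
  assumes \<mu>: "\<mu> \<ge> 0" and X: "0 \<le> X" "X\<^sup>2 \<le> lam" "lam \<le> 4 * X\<^sup>2"
    and D: "energy X \<le> D" "\<bar>u X * u' X\<bar> \<le> sqrt lam * D" "(u X)\<^sup>2 \<le> lam * D"
  shows "weighted_tail (2 * \<mu>) X \<le> tail_const \<mu> * lam powr (\<mu> - 1/2) * D"
proof -
  define j where "j = nat \<lceil>\<mu>\<rceil> + 1"
  have j: "real j \<ge> \<mu> + 1" unfolding j_def by linarith
  define e where "e = 2 * real j - 1 - 2 * \<mu>"
  have e: "e \<ge> 0" using j by (simp add: e_def)
  define c where "c = 5 powr (\<mu> + 1) * 2 powr e * lam powr (\<mu> - 1/2 - real j)"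
  have X0: "X > 0"
  proof (rule ccontr)
    assume "\<not> X > 0"
    then have "X = 0" using X by simp
    then show False using X lam_ge by simp
  qed
  have pw: "weight (2 * \<mu>) s * (1 + s\<^sup>2 / lam) \<le> c * s ^ (2 * j + 1)" if s: "s \<ge> X" for s
  proof -
    have "X\<^sup>2 \<le> s\<^sup>2" using s X by (intro power_mono) auto
    then have s2: "lam \<le> 4 * s\<^sup>2" "1 \<le> 4 * s\<^sup>2" using X lam_ge by auto
    have s0: "s > 0" using s X0 by simp
    have "weight (2 * \<mu>) s \<le> (5 * s\<^sup>2) powr \<mu>"
      unfolding weight_eq using s2 \<mu> by simp (intro powr_mono2; simp)
    also have "\<dots> = 5 powr \<mu> * s powr (2 * \<mu>)"
      using s0 by (simp add: powr_mult powr_powr flip: powr_numeral)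
    finally have w: "weight (2 * \<mu>) s \<le> 5 powr \<mu> * s powr (2 * \<mu>)" .
    have "1 + s\<^sup>2 / lam \<le> 5 * s\<^sup>2 / lam"
      using s2 lam_ge by (simp add: field_simps)
    also have "\<dots> = 5 * s powr 2 / lam" using s0 by simp
    finally have "weight (2 * \<mu>) s * (1 + s\<^sup>2 / lam) \<le> (5 powr \<mu> * s powr (2 * \<mu>)) * (5 * s powr 2 / lam)"
      using w lam_ge by (intro mult_mono) auto
    also have "\<dots> = 5 powr (\<mu> + 1) * lam powr (-1) * s powr (2 * \<mu> + 2)"
      using lam_ge by (simp add: powr_add powr_minus_divide)
    also have "s powr (2 * \<mu> + 2) = s powr real (2 * j + 1) * s powr (- e)"
      by (simp add: powr_add[symmetric] e_def algebra_simps)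
    also have "s powr real (2 * j + 1) = s ^ (2 * j + 1)"
      by (rule powr_realpow[OF s0])
    finally have le: "weight (2 * \<mu>) s * (1 + s\<^sup>2 / lam) \<le>
       5 powr (\<mu> + 1) * lam powr (-1) * (s ^ (2 * j + 1) * s powr (- e))" .
    have "s powr (- e) \<le> (sqrt lam / 2) powr (- e)"
    proof -
      have "sqrt lam \<le> sqrt (4 * s\<^sup>2)" using s2 by (intro real_sqrt_le_mono)
      then have "sqrt lam / 2 \<le> s" using s0 by (simp add: real_sqrt_mult)
      then show ?thesis using e lam_ge by (intro powr_mono2') auto
    qed
    also have "(sqrt lam / 2) powr (- e) = 2 powr e * lam powr (- e / 2)"
    proof -
      have "sqrt lam = lam powr (1 / 2)" using lam_ge by (simp add: powr_half_sqrt)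
      then have "(sqrt lam / 2) powr (- e) = lam powr (- e / 2) / 2 powr (- e)"
        using lam_ge by (simp add: powr_divide powr_powr)
      then show ?thesis by (simp add: powr_minus_divide)
    qed
    finally have "5 powr (\<mu> + 1) * lam powr (-1) * (s ^ (2 * j + 1) * s powr (- e)) \<le>
       5 powr (\<mu> + 1) * lam powr (-1) * (s ^ (2 * j + 1) * (2 powr e * lam powr (- e / 2)))"
      using s0 by (intro mult_left_mono) auto
    note order_trans[OF le this]
    also have "\<dots> = 5 powr (\<mu> + 1) * 2 powr e * (lam powr (-1) * lam powr (- e / 2)) * s ^ (2 * j + 1)"
      by (simp only: mult_ac)
    also have "lam powr (-1) * lam powr (- e / 2) = lam powr (\<mu> - 1/2 - real j)"
      unfolding powr_add[symmetric] by (simp add: e_def field_simps)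
    finally show ?thesis unfolding c_def .
  qed
  have "weighted_tail (2 * \<mu>) X \<le> (LINT s:{X..}|lborel. c * (s ^ (2 * j + 1) * (u s)\<^sup>2))"
    unfolding weighted_tail_def
  proof (rule set_integral_mono)
    show "set_integrable lborel {X..} (\<lambda>s. weight (2 * \<mu>) s * (1 + s\<^sup>2 / lam) * (u s)\<^sup>2)"
      using X by (intro integrable_weight)
    show "set_integrable lborel {X..} (\<lambda>s. c * (s ^ (2 * j + 1) * (u s)\<^sup>2))"
      by (intro set_integrable_mult_right integrable_power X(1))
    show "weight (2 * \<mu>) s * (1 + s\<^sup>2 / lam) * (u s)\<^sup>2 \<le> c * (s ^ (2 * j + 1) * (u s)\<^sup>2)" if "s \<in> {X..}" for s
      using mult_right_mono[OF pw[of s], of "(u s)\<^sup>2"] that by (simp add: mult.assoc)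
  qed
  also have "\<dots> = c * tail_moment (2 * j + 1) X"
    unfolding tail_moment_def by (rule set_integral_mult_right)
  also have "\<dots> \<le> c * (virial_const j * lam ^ j * D)"
    using tail_moment_le[OF X(1,2) D] by (intro mult_left_mono) (auto simp: c_def)
  also have "lam ^ j = lam powr real j" using lam_ge by (simp add: powr_realpow)
  also have "c * (virial_const j * lam powr real j * D)
      = 5 powr (\<mu> + 1) * 2 powr e * virial_const j * (lam powr (\<mu> - 1/2 - real j) * lam powr real j) * D"
    unfolding c_def by (simp only: mult_ac)
  also have "lam powr (\<mu> - 1/2 - real j) * lam powr real j = lam powr (\<mu> - 1/2)"
    by (simp add: powr_add[symmetric])
  also have "5 powr (\<mu> + 1) * 2 powr e * virial_const j = tail_const \<mu>"
    unfolding tail_const_def e_def j_def Let_def ..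
  finally show ?thesis .
qed

end

section \<open>Products of two solutions: trivial, edge and center bounds\<close>

lemma arctan_weight_integral:
  assumes "c > (0::real)"
  shows "set_integrable lborel {0..} (\<lambda>x. 1 / (1 + x\<^sup>2 / c))"
    and "(LINT x:{0..}|lborel. 1 / (1 + x\<^sup>2 / c)) \<le> 2 * sqrt c"
proof -
  define F where "F = (\<lambda>x. sqrt c * arctan (x / sqrt c))"
  have pos: "1 + x\<^sup>2 / c > 0" for x
    using assms by (smt (verit) divide_nonneg_pos zero_le_power2)
  have d: "(F has_real_derivative 1 / (1 + x\<^sup>2 / c)) (at x)" for x
    unfolding F_def using assms
    by (auto intro!: derivative_eq_intros simp: power_divide inverse_eq_divide)
  have lim: "(F \<longlongrightarrow> sqrt c * (pi / 2)) at_top"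
  proof -
    have "filterlim (\<lambda>x. x / sqrt c) at_top at_top"
      using assms unfolding filterlim_at_top eventually_at_top_linorder
      by (intro allI, rule_tac x = "Z * sqrt c" in exI) (auto simp: pos_le_divide_eq)
    from filterlim_compose[OF tendsto_arctan_at_top this]
    show ?thesis unfolding F_def by (intro tendsto_intros)
  qed
  have meas: "(\<lambda>x. 1 / (1 + x\<^sup>2 / c)) \<in> borel_measurable borel" by measurable
  have nn: "(\<integral>\<^sup>+x. ennreal (indicator {0..} x *\<^sub>R (1 / (1 + x\<^sup>2 / c))) \<partial>lborel) = ennreal (sqrt c * (pi / 2))"
  proof -
    have "(\<integral>\<^sup>+x. ennreal (1 / (1 + x\<^sup>2 / c)) * indicator {0..} x \<partial>lborel) = ennreal (sqrt c * (pi / 2) - F 0)"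
      by (rule nn_integral_FTC_atLeast[OF meas d _ lim]) (use pos in \<open>auto simp: less_imp_le\<close>)
    moreover have "(\<integral>\<^sup>+x. ennreal (indicator {0..} x *\<^sub>R (1 / (1 + x\<^sup>2 / c))) \<partial>lborel) =
        (\<integral>\<^sup>+x. ennreal (1 / (1 + x\<^sup>2 / c)) * indicator {0..} x \<partial>lborel)"
      by (intro nn_integral_cong) (simp split: split_indicator)
    ultimately show ?thesis by (simp add: F_def)
  qed
  have nonneg: "0 \<le> indicator {0..} x *\<^sub>R (1 / (1 + x\<^sup>2 / c))" for x :: real
    using less_imp_le[OF pos[of x]] by (simp split: split_indicator)
  show "set_integrable lborel {0..} (\<lambda>x. 1 / (1 + x\<^sup>2 / c))"
    unfolding set_integrable_def
    by (rule integrableI_nn_integral_finite[OF _ _ nn]) (use nonneg assms in auto)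
  have "(LINT x:{0..}|lborel. 1 / (1 + x\<^sup>2 / c)) = sqrt c * (pi / 2)"
    unfolding set_lebesgue_integral_def
    using nonneg assms by (subst integral_eq_nn_integral) (auto simp: nn[simplified])
  also have "\<dots> \<le> sqrt c * 2"
    using pi_less_4 assms by (intro mult_left_mono) auto
  finally show "(LINT x:{0..}|lborel. 1 / (1 + x\<^sup>2 / c)) \<le> 2 * sqrt c" by simp
qed

text \<open>\<open>\<delta>\<close> measures the relative distance to the turning point \<open>\<surd>\<lambda>\<close>.\<close>

definition edge :: "real \<Rightarrow> real \<Rightarrow> real" where
  "edge lam \<delta> = sqrt (lam * (1 - \<delta>))"

lemma edge_sq: "lam \<ge> 0 \<Longrightarrow> \<delta> \<le> 1 \<Longrightarrow> (edge lam \<delta>)\<^sup>2 = lam * (1 - \<delta>)"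
  by (simp add: edge_def)

locale oscillator_pair = u: oscillator_solution u u' lam + v: oscillator_solution v v' Lam
  for u u' v v' :: "real \<Rightarrow> real" and lam Lam :: real +
  assumes lam_le_Lam: "lam \<le> Lam"
begin

text \<open>The ratio of the WKB amplitudes of \<open>v\<close> and \<open>u\<close> in the
  bulk.\<close>

definition \<rho> :: real where "\<rho> = (lam / Lam) powr (1 / 4)"

lemma \<rho>_pos: "\<rho> > 0" and \<rho>_sq: "\<rho>\<^sup>2 = sqrt (lam / Lam)"
proof -
  have p: "lam / Lam > 0" using u.lam_ge v.lam_ge by simp
  then show "\<rho> > 0" unfolding \<rho>_def using u.lam_ge v.lam_ge by simp
  show "\<rho>\<^sup>2 = sqrt (lam / Lam)"
    unfolding \<rho>_def power2_eq_square powr_add[symmetric] using p u.lam_ge v.lam_ge by (simp add: powr_half_sqrt)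
qed

text \<open>Only a fraction of order \<rho>^2 of the mass of \<open>v\<close> lies at s of order
  \<surd>\<open>lam\<close>. In the bulk of \<open>v\<close> its square is at most
  \<open>4 / sqrt Lam\<close>, over an effective length \<open>2 * sqrt lam\<close>; this gives 8.
  Beyond the bulk the damping factor is at most \<open>2 * lam / Lam\<close>; this gives 2.\<close>

lemma lower_mass:
  "set_integrable lborel {0..} (\<lambda>s. (v s)\<^sup>2 / (1 + s\<^sup>2 / lam))"
  "(LINT s:{0..}|lborel. (v s)\<^sup>2 / (1 + s\<^sup>2 / lam)) \<le> 10 * \<rho>\<^sup>2"
proof -
  have l: "lam > 0" "Lam > 0" using u.lam_ge v.lam_ge by auto
  have pos: "1 + s\<^sup>2 / lam \<ge> 1" for s using l by simp
  have v2: "set_integrable lborel {0..} (\<lambda>s. (v s)\<^sup>2)" by (rule v.square_integrable)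
  show int: "set_integrable lborel {0..} (\<lambda>s. (v s)\<^sup>2 / (1 + s\<^sup>2 / lam))"
  proof (rule set_integrable_bound[OF v2])
    have "continuous_on {0..} (\<lambda>s. (v s)\<^sup>2 / (1 + s\<^sup>2 / lam))"
      using pos by (intro continuous_intros v.cont_u) (smt (verit) l)+
    from borel_measurable_continuous_on_indicator[OF _ this]
    show "set_borel_measurable lborel {0..} (\<lambda>s. (v s)\<^sup>2 / (1 + s\<^sup>2 / lam))"
      unfolding set_borel_measurable_def by simp
    have "(v s)\<^sup>2 / (1 + s\<^sup>2 / lam) \<le> (v s)\<^sup>2 / 1" for s
      using pos[of s] by (intro divide_left_mono) auto
    then show "AE x in lborel. x \<in> {0..} \<longrightarrow> norm ((v x)\<^sup>2 / (1 + x\<^sup>2 / lam)) \<le> norm ((v x)\<^sup>2)"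
      using pos by (auto simp: abs_of_nonneg order_trans[OF zero_le_one])
  qed
  note i1 = arctan_weight_integral[OF l(1)]
  have "(LINT s:{0..}|lborel. (v s)\<^sup>2 / (1 + s\<^sup>2 / lam)) \<le>
      (LINT s:{0..}|lborel. 4 / sqrt Lam * (1 / (1 + s\<^sup>2 / lam)) + 2 * lam / Lam * (v s)\<^sup>2)"
  proof (rule set_integral_mono[OF int])
    show "set_integrable lborel {0..} (\<lambda>s. 4 / sqrt Lam * (1 / (1 + s\<^sup>2 / lam)) + 2 * lam / Lam * (v s)\<^sup>2)"
      by (intro set_integral_add(1) set_integrable_mult_right i1(1) v2)
    fix s :: real assume "s \<in> {0..}"
    then have s: "s \<ge> 0" by simp
    show "(v s)\<^sup>2 / (1 + s\<^sup>2 / lam) \<le> 4 / sqrt Lam * (1 / (1 + s\<^sup>2 / lam)) + 2 * lam / Lam * (v s)\<^sup>2"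
    proof (cases "s\<^sup>2 \<le> Lam / 2")
      case True
      have "(v s)\<^sup>2 / (1 + s\<^sup>2 / lam) \<le> 4 / sqrt Lam / (1 + s\<^sup>2 / lam)"
        using v.bulk_bound[OF s True] pos[of s] by (intro divide_right_mono) auto
      moreover have "2 * lam / Lam * (v s)\<^sup>2 \<ge> 0" using l by simp
      ultimately show ?thesis by simp
    next
      case False
      have "Lam / (2 * lam) \<le> 1 + s\<^sup>2 / lam"
        using False l by (simp add: field_simps)
      then have "(v s)\<^sup>2 / (1 + s\<^sup>2 / lam) \<le> (v s)\<^sup>2 / (Lam / (2 * lam))"
        using l order.strict_trans2[OF zero_less_one pos[of s]]
        by (intro divide_left_mono mult_pos_pos) auto
      moreover have "4 / sqrt Lam * (1 / (1 + s\<^sup>2 / lam)) \<ge> 0" using pos[of s] l by simp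
      moreover have "(v s)\<^sup>2 / (Lam / (2 * lam)) = 2 * lam / Lam * (v s)\<^sup>2" by simp
      ultimately show ?thesis by linarith
    qed
  qed
  also have "\<dots> = 4 / sqrt Lam * (LINT s:{0..}|lborel. 1 / (1 + s\<^sup>2 / lam)) + 2 * lam / Lam * (LINT s:{0..}|lborel. (v s)\<^sup>2)"
    using set_integral_add(2)[OF set_integrable_mult_right[OF i1(1)] set_integrable_mult_right[OF v2]]
    by (simp only: set_integral_mult_right)
  also have "\<dots> \<le> 4 / sqrt Lam * (2 * sqrt lam) + 2 * lam / Lam * 1"
    using l by (intro add_mono mult_left_mono i1(2) v.norm_le) auto
  also have "4 / sqrt Lam * (2 * sqrt lam) = 8 * \<rho>\<^sup>2"
    unfolding \<rho>_sq by (simp add: real_sqrt_divide)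
  also have "2 * lam / Lam * 1 \<le> 2 * \<rho>\<^sup>2"
  proof -
    have "(lam / Lam)\<^sup>2 \<le> 1 * (lam / Lam)"
      unfolding power2_eq_square using l lam_le_Lam by (intro mult_right_mono) auto
    then have "lam / Lam \<le> sqrt (lam / Lam)" using l by (intro real_le_rsqrt) auto
    then show ?thesis unfolding \<rho>_sq by simp
  qed
  finally show "(LINT s:{0..}|lborel. (v s)\<^sup>2 / (1 + s\<^sup>2 / lam)) \<le> 10 * \<rho>\<^sup>2" by simp
qed

lemma integrable_product:
  fixes e :: "real \<Rightarrow> complex"
  assumes "continuous_on UNIV e" "\<And>x. cmod (e x) \<le> 1" "X \<ge> 0"
  shows "set_integrable lborel {X..} (\<lambda>s. complex_of_real (weight \<mu> s) * e s * complex_of_real (u s) * complex_of_real (v s))"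
    and "set_integrable lborel {X..} (\<lambda>s. weight \<mu> s * \<bar>u s\<bar> * \<bar>v s\<bar>)"
proof -
  define n where "n = nat \<lceil>\<mu>\<rceil>"
  have n: "\<mu> \<le> 2 * real n" unfolding n_def by linarith
  obtain C1 where C1: "\<forall>x\<ge>0. (1 + x\<^sup>2) ^ n * (u x)\<^sup>2 \<le> C1 * exp (- x / 4)"
    using u.polynomial_weight_le_exp[of n] by blast
  obtain C2 where C2: "\<forall>x\<ge>0. (1 + x\<^sup>2) ^ n * (v x)\<^sup>2 \<le> C2 * exp (- x / 4)"
    using v.polynomial_weight_le_exp[of n] by blast
  have key: "weight \<mu> x * \<bar>u x\<bar> * \<bar>v x\<bar> \<le> (C1 + C2) * exp (- x / 4)" if x: "x \<ge> 0" for x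
  proof -
    have "\<bar>u x\<bar> * \<bar>v x\<bar> \<le> (u x)\<^sup>2 + (v x)\<^sup>2"
    proof -
      have "0 \<le> \<bar>u x\<bar> * \<bar>v x\<bar>" by simp
      then show ?thesis using sum_squares_bound[of "\<bar>u x\<bar>" "\<bar>v x\<bar>"] unfolding power2_abs by linarith
    qed
    then have "weight \<mu> x * (\<bar>u x\<bar> * \<bar>v x\<bar>) \<le> (1 + x\<^sup>2) ^ n * ((u x)\<^sup>2 + (v x)\<^sup>2)"
      using less_imp_le[OF weight_pos] by (intro mult_mono weight_le_power[OF n]) auto
    also have "\<dots> \<le> C1 * exp (- x / 4) + C2 * exp (- x / 4)"
      unfolding distrib_left using C1 C2 x by (intro add_mono) auto
    finally show ?thesis by (simp add: algebra_simps)
  qed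
  have w0: "\<bar>weight \<mu> x\<bar> = weight \<mu> x" for x using weight_pos[of \<mu> x] by simp
  show "set_integrable lborel {X..} (\<lambda>s. weight \<mu> s * \<bar>u s\<bar> * \<bar>v s\<bar>)"
  proof (rule set_integrable_exp_decay)
    show "continuous_on {X..} (\<lambda>s. weight \<mu> s * \<bar>u s\<bar> * \<bar>v s\<bar>)"
      by (intro continuous_intros cont_weight u.cont_u v.cont_u)
    show "norm (weight \<mu> x * \<bar>u x\<bar> * \<bar>v x\<bar>) \<le> (C1 + C2) * exp (- x / 4)" if "x \<ge> X" for x
      using key[of x] that \<open>X \<ge> 0\<close> by (simp add: abs_mult w0)
  qed
  show "set_integrable lborel {X..} (\<lambda>s. complex_of_real (weight \<mu> s) * e s * complex_of_real (u s) * complex_of_real (v s))"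
  proof (rule set_integrable_exp_decay)
    show "continuous_on {X..} (\<lambda>s. complex_of_real (weight \<mu> s) * e s * complex_of_real (u s) * complex_of_real (v s))"
      by (intro continuous_intros cont_weight u.cont_u v.cont_u continuous_on_subset[OF assms(1)]) auto
    fix x assume x: "x \<ge> X"
    have "norm (complex_of_real (weight \<mu> x) * e x * complex_of_real (u x) * complex_of_real (v x))
       = cmod (e x) * (weight \<mu> x * \<bar>u x\<bar> * \<bar>v x\<bar>)" by (simp add: norm_mult w0)
    also have "\<dots> \<le> 1 * (weight \<mu> x * \<bar>u x\<bar> * \<bar>v x\<bar>)"
      using assms(2)[of x] less_imp_le[OF weight_pos[of \<mu> x]] by (intro mult_right_mono) auto
    also have "\<dots> \<le> (C1 + C2) * exp (- x / 4)" using key[of x] x \<open>X \<ge> 0\<close> by simp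
    finally show "norm (complex_of_real (weight \<mu> x) * e x * complex_of_real (u x) * complex_of_real (v x))
       \<le> (C1 + C2) * exp (- x / 4)" .
  qed
qed

text \<open>Cauchy-Schwarz with the factor \<open>1 + s\<^sup>2 / lam\<close> moved from
  \<open>v\<close> to \<open>u\<close>; \<open>lower_mass\<close> then supplies the gain
  \<rho>.\<close>

lemma product_tail_le:
  assumes X: "X \<ge> 0" and P: "P > 0" "u.weighted_tail (2 * \<mu>) X \<le> P"
  shows "(LINT s:{X..}|lborel. weight \<mu> s * \<bar>u s\<bar> * \<bar>v s\<bar>) \<le> 4 * sqrt P * \<rho>"
proof -
  \<comment> \<open>The parameter of the inequality a b \<le> t a^2 / 2 + b^2 / (2 t). A value of
    order \<rho> / \<surd>P balances t P / 2 against 5 \<rho>^2 / t.\<close>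
  define t where "t = 4 * \<rho> / sqrt P"
  have t: "t > 0" using P \<rho>_pos by (simp add: t_def)
  have l: "lam > 0" using u.lam_ge by simp
  have vi: "set_integrable lborel {X..} (\<lambda>s. (v s)\<^sup>2 / (1 + s\<^sup>2 / lam))"
    by (rule set_integrable_subset[OF lower_mass(1)]) (use X in auto)
  have vX: "(LINT s:{X..}|lborel. (v s)\<^sup>2 / (1 + s\<^sup>2 / lam)) \<le> 10 * \<rho>\<^sup>2"
  proof -
    have "(LINT s:{X..}|lborel. (v s)\<^sup>2 / (1 + s\<^sup>2 / lam)) \<le> (LINT s:{0..}|lborel. (v s)\<^sup>2 / (1 + s\<^sup>2 / lam))"
      by (rule set_integral_subset_le[OF lower_mass(1)]) (use X l in \<open>auto simp: add_nonneg_nonneg\<close>)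
    then show ?thesis using lower_mass(2) by simp
  qed
  have "(LINT s:{X..}|lborel. weight \<mu> s * \<bar>u s\<bar> * \<bar>v s\<bar>) \<le>
     (LINT s:{X..}|lborel. t / 2 * (weight (2 * \<mu>) s * (1 + s\<^sup>2 / lam) * (u s)\<^sup>2) + 1 / (2 * t) * ((v s)\<^sup>2 / (1 + s\<^sup>2 / lam)))"
  proof (rule set_integral_mono)
    \<comment> \<open>The zero function is a placeholder for the phase \<open>e\<close> of
      \<open>integrable_product\<close>.\<close>
    show "set_integrable lborel {X..} (\<lambda>s. weight \<mu> s * \<bar>u s\<bar> * \<bar>v s\<bar>)"
      by (rule integrable_product(2)[of "\<lambda>_. 0"]) (use X in auto)
    show "set_integrable lborel {X..} (\<lambda>s. t / 2 * (weight (2 * \<mu>) s * (1 + s\<^sup>2 / lam) * (u s)\<^sup>2)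
        + 1 / (2 * t) * ((v s)\<^sup>2 / (1 + s\<^sup>2 / lam)))"
      by (intro set_integral_add(1) set_integrable_mult_right vi u.integrable_weight X)
    fix s
    define \<kappa> where "\<kappa> = 1 + s\<^sup>2 / lam"
    have \<kappa>: "\<kappa> > 0" unfolding \<kappa>_def using l by (simp add: add_pos_nonneg)
    define a where "a = sqrt t * (weight \<mu> s * sqrt \<kappa> * \<bar>u s\<bar>)"
    define b where "b = \<bar>v s\<bar> / sqrt \<kappa> / sqrt t"
    have "weight \<mu> s * \<bar>u s\<bar> * \<bar>v s\<bar> = a * b" using \<kappa> t by (simp add: a_def b_def)
    also have "\<dots> \<le> a\<^sup>2 / 2 + b\<^sup>2 / 2" using sum_squares_bound[of a b] by simp
    also have "a\<^sup>2 = t * (weight (2 * \<mu>) s * \<kappa> * (u s)\<^sup>2)"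
      using \<kappa> t by (simp add: a_def power_mult_distrib weight_sq)
    also have "b\<^sup>2 = (v s)\<^sup>2 / \<kappa> / t"
      using \<kappa> t by (simp add: b_def power_divide power_mult_distrib)
    finally show "weight \<mu> s * \<bar>u s\<bar> * \<bar>v s\<bar> \<le> t / 2 * (weight (2 * \<mu>) s * (1 + s\<^sup>2 / lam) * (u s)\<^sup>2)
        + 1 / (2 * t) * ((v s)\<^sup>2 / (1 + s\<^sup>2 / lam))"
      unfolding \<kappa>_def[symmetric] by (simp add: mult.commute)
  qed
  also have "\<dots> = t / 2 * u.weighted_tail (2 * \<mu>) X + 1 / (2 * t) * (LINT s:{X..}|lborel. (v s)\<^sup>2 / (1 + s\<^sup>2 / lam))"
    unfolding u.weighted_tail_def
    using set_integral_add(2)[OF set_integrable_mult_right[OF u.integrable_weight[OF X]] set_integrable_mult_right[OF vi]]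
    by (simp only: set_integral_mult_right)
  also have "\<dots> \<le> t / 2 * P + 1 / (2 * t) * (10 * \<rho>\<^sup>2)"
    using t P(2) vX by (intro add_mono mult_left_mono) auto
  also have "\<dots> = 2 * sqrt P * \<rho> + 5 / 4 * sqrt P * \<rho>"
  proof -
    have "t / 2 * P = 2 * sqrt P * \<rho>"
      unfolding t_def using P(1) real_sqrt_pow2[of P] by (simp add: field_simps power2_eq_square)
    moreover have "1 / (2 * t) * (10 * \<rho>\<^sup>2) = 5 / 4 * sqrt P * \<rho>"
      unfolding t_def using P(1) \<rho>_pos by (simp add: field_simps power2_eq_square)
    ultimately show ?thesis by simp
  qed
  also have "\<dots> \<le> 4 * sqrt P * \<rho>"
    using P(1) \<rho>_pos by (simp add: algebra_simps)
  finally show ?thesis .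
qed

text \<open>The bound without oscillation, which settles all parameters for which the claimed decay
  factor is not small. Below \<surd>\<open>lam\<close> / 2 the normalized mass is used, above it the
  virial bound.\<close>

lemma product_total_le:
  assumes \<mu>: "\<mu> \<ge> 0"
  shows "(LINT s:{0..}|lborel. weight \<mu> s * \<bar>u s\<bar> * \<bar>v s\<bar>)
     \<le> 4 * sqrt (2 * 2 powr \<mu> + 4 * tail_const \<mu>) * lam powr (\<mu> / 2) * \<rho>"
proof -
  define X where "X = sqrt lam / 2"
  have l: "lam \<ge> 1" "sqrt lam > 0" "sqrt lam \<ge> 1" "sqrt lam * sqrt lam = lam" using u.lam_ge by auto
  have X: "X \<ge> 0" "X\<^sup>2 = lam / 4" using l by (auto simp: X_def power_divide)
  \<comment> \<open>The factor 4 is dictated by \<open>d3\<close>: at \<open>lam = 1\<close> the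
    available bound for \<open>(u X)\<^sup>2\<close> is 4.\<close>
  define D where "D = 4 * sqrt lam"
  have E: "u.energy X \<le> 2 * sqrt lam"
    using u.energy_antimono[of 0 X] X u.energy_zero_le by simp
  have ux: "(u X)\<^sup>2 \<le> 4 / sqrt lam" using u.bulk_bound[of X] X l by simp
  have d2: "\<bar>u X * u' X\<bar> \<le> sqrt lam * D"
  proof -
    have "sqrt (lam - X\<^sup>2) \<ge> 1 / 2"
      using l X by (intro real_le_rsqrt) (simp add: power2_eq_square)
    then have "2 * (1 / 2) * \<bar>u X * u' X\<bar> \<le> 2 * sqrt (lam - X\<^sup>2) * \<bar>u X * u' X\<bar>"
      by (intro mult_right_mono) auto
    also have "\<dots> \<le> u.energy X" using X(2) l(1) by (intro u.uu'_le_energy) simp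
    also have "\<dots> \<le> 2 * lam" using E l mult_right_mono[of 1 "sqrt lam" "sqrt lam"] by simp
    also have "2 * lam \<le> 4 * (sqrt lam * sqrt lam)" using l by simp
    finally show ?thesis unfolding D_def by (simp only: mult.left_commute)
  qed
  have d3: "(u X)\<^sup>2 \<le> lam * D"
  proof -
    have "4 / sqrt lam \<le> 4 / 1" using l by (intro divide_left_mono) auto
    also have "(4::real) \<le> 4 * (lam * sqrt lam)"
      using l mult_mono[of 1 lam 1 "sqrt lam"] by simp
    finally show ?thesis using ux unfolding D_def by (simp add: mult.left_commute)
  qed
  have d1: "u.energy X \<le> D" unfolding D_def using E l(3) by linarith
  have "X\<^sup>2 \<le> lam" "lam \<le> 4 * X\<^sup>2" using X l(1) by auto
  then have far: "u.weighted_tail (2 * \<mu>) X \<le> tail_const \<mu> * lam powr (\<mu> - 1/2) * D"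
    using X(1) by (intro u.weighted_tail_le \<mu> d1 d2 d3)
  also have "\<dots> = 4 * tail_const \<mu> * (lam powr (\<mu> - 1/2) * lam powr (1/2))"
    using l by (simp add: D_def powr_half_sqrt)
  also have "lam powr (\<mu> - 1/2) * lam powr (1/2) = lam powr \<mu>"
    by (simp add: powr_add[symmetric])
  finally have far: "u.weighted_tail (2 * \<mu>) X \<le> 4 * tail_const \<mu> * lam powr \<mu>" .
  define W where "W = (\<lambda>s. weight (2 * \<mu>) s * (1 + s\<^sup>2 / lam) * (u s)\<^sup>2)"
  have Wi: "set_integrable lborel {0..} W" unfolding W_def by (rule u.integrable_weight) simp
  have Wi1: "set_integrable lborel {0..<X} W" by (rule set_integrable_subset[OF Wi]) auto
  have Wi2: "set_integrable lborel {X..} W" by (rule set_integrable_subset[OF Wi]) (use X in auto)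
  have "u.weighted_tail (2 * \<mu>) 0 = (LINT s:{0..<X} \<union> {X..}|lborel. W s)"
    unfolding u.weighted_tail_def W_def using X(1) by (simp add: ivl_disj_un)
  also have "\<dots> = (LINT s:{0..<X}|lborel. W s) + u.weighted_tail (2 * \<mu>) X"
    unfolding u.weighted_tail_def W_def[symmetric] by (rule set_integral_Un[OF _ Wi1 Wi2]) auto
  also have "(LINT s:{0..<X}|lborel. W s) \<le> (LINT s:{0..<X}|lborel. 2 * 2 powr \<mu> * lam powr \<mu> * (u s)\<^sup>2)"
  proof (rule set_integral_mono[OF Wi1])
    show "set_integrable lborel {0..<X} (\<lambda>s. 2 * 2 powr \<mu> * lam powr \<mu> * (u s)\<^sup>2)"
      by (rule set_integrable_subset[OF set_integrable_mult_right[OF u.square_integrable]]) auto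
    fix s assume s: "s \<in> {0..<X}"
    then have "s\<^sup>2 \<le> X\<^sup>2" by (intro power_mono) auto
    then have s2: "s\<^sup>2 \<le> lam" using X l by simp
    have "weight (2 * \<mu>) s * (1 + s\<^sup>2 / lam) \<le> (2 powr \<mu> * lam powr \<mu>) * 2"
      using weight_le_lam[of "2 * \<mu>" s lam] \<mu> s2 l by (intro mult_mono) (auto simp: field_simps)
    from mult_right_mono[OF this, of "(u s)\<^sup>2"]
    show "W s \<le> 2 * 2 powr \<mu> * lam powr \<mu> * (u s)\<^sup>2" by (simp add: W_def mult_ac)
  qed
  also have "\<dots> = 2 * 2 powr \<mu> * lam powr \<mu> * (LINT s:{0..<X}|lborel. (u s)\<^sup>2)" by (rule set_integral_mult_right)
  also have "\<dots> \<le> 2 * 2 powr \<mu> * lam powr \<mu> * 1"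
  proof (intro mult_left_mono)
    have "(LINT s:{0..<X}|lborel. (u s)\<^sup>2) \<le> (LINT s:{0..}|lborel. (u s)\<^sup>2)"
      by (rule set_integral_subset_le[OF u.square_integrable]) auto
    then show "(LINT s:{0..<X}|lborel. (u s)\<^sup>2) \<le> 1" using u.norm_le by simp
  qed auto
  finally have tot: "u.weighted_tail (2 * \<mu>) 0 \<le> (2 * 2 powr \<mu> + 4 * tail_const \<mu>) * lam powr \<mu>"
    using far by (simp add: algebra_simps)
  have c: "2 * 2 powr \<mu> + 4 * tail_const \<mu> > 0"
    using tail_const_pos[of \<mu>] by (simp add: add_pos_pos)
  have "(LINT s:{0..}|lborel. weight \<mu> s * \<bar>u s\<bar> * \<bar>v s\<bar>) \<le> 4 * sqrt ((2 * 2 powr \<mu> + 4 * tail_const \<mu>) * lam powr \<mu>) * \<rho>"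
    using c l by (intro product_tail_le tot) auto
  also have "sqrt ((2 * 2 powr \<mu> + 4 * tail_const \<mu>) * lam powr \<mu>) = sqrt (2 * 2 powr \<mu> + 4 * tail_const \<mu>) * lam powr (\<mu> / 2)"
    using l by (simp add: real_sqrt_mult powr_half_sqrt[symmetric] powr_powr)
  finally show ?thesis by (simp add: mult.assoc)
qed

text \<open>The condition \<delta>^3 \<open>lam\<close>^2 \<ge> 1 keeps the cut on the inner side of
  the Airy zone: at the edge q^2 = \<delta> \<open>lam\<close>, so x \<le> q^3 follows from
  \<open>lam\<close> \<le> (\<delta> \<open>lam\<close>)^3. The bound 3/4 keeps the edge at or above
  \<surd>\<open>lam\<close> / 2.\<close>

lemma edge_properties:
  assumes \<delta>: "0 < \<delta>" "\<delta> \<le> 3/4" "\<delta> ^ 3 * lam\<^sup>2 \<ge> 1"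
  shows "0 \<le> edge lam \<delta>" "(edge lam \<delta>)\<^sup>2 < lam" "lam \<le> 4 * (edge lam \<delta>)\<^sup>2"
    "(wkb_freq lam (edge lam \<delta>))\<^sup>2 = \<delta> * lam" "wkb_freq lam (edge lam \<delta>) > 0"
    "edge lam \<delta> \<le> wkb_freq lam (edge lam \<delta>) ^ 3"
proof -
  have l: "lam \<ge> 1" using u.lam_ge .
  show e0: "0 \<le> edge lam \<delta>" unfolding edge_def using \<delta> l by simp
  have e2: "(edge lam \<delta>)\<^sup>2 = lam * (1 - \<delta>)" using \<delta> l by (intro edge_sq) auto
  show lt: "(edge lam \<delta>)\<^sup>2 < lam" unfolding e2 using \<delta> l by simp
  show "lam \<le> 4 * (edge lam \<delta>)\<^sup>2" unfolding e2 using \<delta> l by (simp add: algebra_simps)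
  show q2: "(wkb_freq lam (edge lam \<delta>))\<^sup>2 = \<delta> * lam"
    using wkb_freq_sq[of "edge lam \<delta>" lam] lt unfolding e2 by (simp add: algebra_simps)
  show q0: "wkb_freq lam (edge lam \<delta>) > 0" using lt by (rule wkb_freq_pos)
  show "edge lam \<delta> \<le> wkb_freq lam (edge lam \<delta>) ^ 3"
  proof (rule power2_le_imp_le)
    have "lam * 1 \<le> lam * (\<delta> ^ 3 * lam\<^sup>2)" using \<delta> l by (intro mult_left_mono) auto
    also have "\<dots> = ((wkb_freq lam (edge lam \<delta>))\<^sup>2) ^ 3"
      unfolding q2 by (simp add: power_mult_distrib power2_eq_square power3_eq_cube)
    also have "\<dots> = (wkb_freq lam (edge lam \<delta>) ^ 3)\<^sup>2" by (simp add: power_mult[symmetric] mult.commute)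
    finally show "(edge lam \<delta>)\<^sup>2 \<le> (wkb_freq lam (edge lam \<delta>) ^ 3)\<^sup>2" using lt by simp
    show "0 \<le> wkb_freq lam (edge lam \<delta>) ^ 3" using q0 by simp
  qed
qed

text \<open>At the edge the energy is at most 12 \<surd>(\<delta> \<open>lam\<close>), so the
  weighted tail of \<open>u\<close> carries a factor \<surd>\<delta>, of which Cauchy-Schwarz keeps
  the square root.\<close>

lemma product_edge_le:
  assumes \<mu>: "\<mu> \<ge> 0" and \<delta>: "0 < \<delta>" "\<delta> \<le> 3/4" "\<delta> ^ 3 * lam\<^sup>2 \<ge> 1"
  shows "(LINT s:{edge lam \<delta>..}|lborel. weight \<mu> s * \<bar>u s\<bar> * \<bar>v s\<bar>)
     \<le> 4 * sqrt (24 * tail_const \<mu>) * lam powr (\<mu> / 2) * \<rho> * \<delta> powr (1/4)"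
proof -
  define X where "X = edge lam \<delta>"
  define q where "q = wkb_freq lam X"
  have l: "lam \<ge> 1" using u.lam_ge .
  note e = edge_properties[OF \<delta>, folded X_def, folded q_def]
  have q: "q = sqrt \<delta> * sqrt lam"
    using e(4,5) real_sqrt_unique[of q "\<delta> * lam"] by (simp add: real_sqrt_mult)
  note b = u.interior_bounds[OF e(1,2), folded q_def, OF e(6)]
  define D where "D = 24 * q"
  have "\<delta> ^ 3 \<le> \<delta>" using \<delta> power_decreasing[of 1 3 \<delta>] by simp
  \<comment> \<open>This lets \<open>D\<close> dominate the other boundary data as well: 6 for u u'
    and 12 / q for u^2.\<close>
  then have lq: "lam * q\<^sup>2 \<ge> 1"
    using \<delta>(3) mult_right_mono[of "\<delta> ^ 3" \<delta> "lam\<^sup>2"] unfolding e(4) by (simp add: power2_eq_square mult_ac)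
  have "u.weighted_tail (2 * \<mu>) X \<le> tail_const \<mu> * lam powr (\<mu> - 1/2) * D"
  proof (intro u.weighted_tail_le \<mu> e(1,3))
    show "X\<^sup>2 \<le> lam" using e(2) by simp
    show "u.energy X \<le> D" using b(4) e(5) unfolding D_def by simp
    have "1 \<le> sqrt lam * q" using lq l e(5) real_sqrt_le_mono[OF lq] by (simp add: real_sqrt_mult)
    then show "\<bar>u X * u' X\<bar> \<le> sqrt lam * D" using b(3) unfolding D_def by simp
    have "q * (u X)\<^sup>2 \<le> q * (lam * D)"
      using b(1) lq unfolding D_def by (simp add: power2_eq_square mult_ac)
    then show "(u X)\<^sup>2 \<le> lam * D" using e(5) by simp
  qed
  also have "\<dots> = 24 * tail_const \<mu> * (lam powr (\<mu> - 1/2) * lam powr (1/2)) * sqrt \<delta>"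
    using l by (simp add: D_def q powr_half_sqrt)
  also have "lam powr (\<mu> - 1/2) * lam powr (1/2) = lam powr \<mu>"
    by (simp add: powr_add[symmetric])
  finally have P: "u.weighted_tail (2 * \<mu>) X \<le> 24 * tail_const \<mu> * lam powr \<mu> * sqrt \<delta>" .
  have "(LINT s:{X..}|lborel. weight \<mu> s * \<bar>u s\<bar> * \<bar>v s\<bar>) \<le> 4 * sqrt (24 * tail_const \<mu> * lam powr \<mu> * sqrt \<delta>) * \<rho>"
    using tail_const_pos[of \<mu>] l \<delta> by (intro product_tail_le P e(1)) auto
  also have "sqrt (24 * tail_const \<mu> * lam powr \<mu> * sqrt \<delta>) = sqrt (24 * tail_const \<mu>) * lam powr (\<mu> / 2) * \<delta> powr (1/4)"
    using l \<delta> tail_const_pos[of \<mu>] by (simp add: real_sqrt_mult powr_half_sqrt[symmetric] powr_powr)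
  finally show ?thesis by (simp add: X_def mult_ac)
qed

text \<open>The unit interval is kept out of the oscillatory analysis, because the derivatives of
  x^\<beta> used there may blow up or vanish at 0. For \<open>lam \<ge> 2\<close> it lies in the
  bulk of both solutions, so it costs only the product of their amplitudes.\<close>

lemma product_center_le:
  assumes \<mu>: "\<mu> \<ge> 0" and lam2: "lam \<ge> 2"
  shows "(LINT s:{0..1}|lborel. weight \<mu> s * \<bar>u s\<bar> * \<bar>v s\<bar>) \<le> 4 * 2 powr (\<mu> / 2) * \<rho> * lam powr (- 1/2)"
proof -
  have l: "lam > 0" "Lam > 0" using u.lam_ge v.lam_ge by auto
  have int: "set_integrable lborel {0..1} (\<lambda>s. weight \<mu> s * \<bar>u s\<bar> * \<bar>v s\<bar>)"
    by (rule set_integrable_subset[OF integrable_product(2)[of "\<lambda>_. 0" 0]]) auto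
  have sq: "\<bar>x\<bar> \<le> 2 * y powr (- 1/4)" if "x\<^sup>2 \<le> 4 / sqrt y" "y > 0" for x y :: real
  proof -
    have "(2 * y powr (- 1/4))\<^sup>2 = 4 * y powr (- 1/2)"
      by (simp add: power_mult_distrib power2_eq_square powr_add[symmetric])
    also have "\<dots> = 4 / sqrt y" using that by (simp add: powr_minus_divide powr_half_sqrt)
    finally have "x\<^sup>2 \<le> (2 * y powr (- 1/4))\<^sup>2" using that by simp
    then have "\<bar>x\<bar> \<le> \<bar>2 * y powr (- 1/4)\<bar>" by (simp only: abs_le_square_iff)
    then show ?thesis by simp
  qed
  define c where "c = 2 powr (\<mu> / 2) * (2 * lam powr (- 1/4)) * (2 * Lam powr (- 1/4))"
  have ci: "set_integrable lborel {0..1::real} (\<lambda>s. c)"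
    by (rule borel_integrable_atLeastAtMost') (rule continuous_on_const)
  have "(LINT s:{0..1}|lborel. weight \<mu> s * \<bar>u s\<bar> * \<bar>v s\<bar>) \<le> (LINT s:{0..1::real}|lborel. c)"
  proof (rule set_integral_mono[OF int ci])
    fix s :: real assume "s \<in> {0..1}"
    then have s: "0 \<le> s" "s\<^sup>2 \<le> 1" "s\<^sup>2 \<le> lam / 2" "s\<^sup>2 \<le> Lam / 2"
      using lam2 lam_le_Lam power_mono[of s 1 2] by auto
    have "\<bar>u s\<bar> \<le> 2 * lam powr (- 1/4)" by (rule sq[OF u.bulk_bound[OF s(1,3)] l(1)])
    moreover have "\<bar>v s\<bar> \<le> 2 * Lam powr (- 1/4)" by (rule sq[OF v.bulk_bound[OF s(1,4)] l(2)])
    moreover have "weight \<mu> s \<le> 2 powr (\<mu> / 2)"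
      using weight_le_lam[of \<mu> s 1] \<mu> s by simp
    ultimately show "weight \<mu> s * \<bar>u s\<bar> * \<bar>v s\<bar> \<le> c"
      unfolding c_def using less_imp_le[OF weight_pos] by (intro mult_mono) auto
  qed
  also have "\<dots> = c" using set_borel_integral_eq_integral(2)[OF ci] by simp
  also have "c = 4 * 2 powr (\<mu> / 2) * (lam powr (- 1/4) * Lam powr (- 1/4))" by (simp add: c_def)
  also have "lam powr (- 1/4) * Lam powr (- 1/4) = \<rho> * lam powr (- 1/2)"
  proof -
    have "\<rho> = lam powr (1/4) * Lam powr (- 1/4)"
      unfolding \<rho>_def using l by (simp add: powr_divide powr_minus_divide)
    moreover have "lam powr (1/4) * lam powr (- 1/2) = lam powr (- 1/4)"
      by (simp add: powr_add[symmetric])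
    ultimately show ?thesis by (simp add: mult_ac)
  qed
  finally show ?thesis by (simp add: mult_ac)
qed

end

section \<open>The oscillatory interior\<close>

lemma weight_deriv:
  "(weight \<mu> has_real_derivative \<mu> * x * (1 + x\<^sup>2) powr (\<mu> / 2 - 1)) (at x within S)"
proof -
  have p: "1 + x\<^sup>2 > 0" by (smt (verit) zero_le_power2)
  have "((\<lambda>x. 1 + x\<^sup>2) has_real_derivative 2 * x) (at x)"
    by (auto intro!: derivative_eq_intros)
  from DERIV_chain2[OF has_real_derivative_powr[OF p, of "\<mu> / 2"] this]
  have "(weight \<mu> has_real_derivative \<mu> / 2 * (1 + x\<^sup>2) powr (\<mu> / 2 - 1) * (2 * x)) (at x)"
    unfolding weight_eq[abs_def] .
  then have "(weight \<mu> has_real_derivative \<mu> * x * (1 + x\<^sup>2) powr (\<mu> / 2 - 1)) (at x)"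
    by (simp add: mult_ac)
  then show ?thesis by (rule has_field_derivative_at_within)
qed

text \<open>Used with \<sigma> = 1 and \<sigma> = -1: together with the exponential of \<sigma> S it
  lists the two summands of a real part.\<close>

definition conj_if_minus :: "real \<Rightarrow> complex \<Rightarrow> complex" where
  "conj_if_minus \<sigma> z = (if \<sigma> = 1 then z else cnj z)"

lemma cmod_conj_if_minus [simp]: "cmod (conj_if_minus \<sigma> z) = cmod z"
  by (simp add: conj_if_minus_def)

lemma has_vector_derivative_conj_if_minus:
  assumes "(c has_vector_derivative c') (at x within S)"
  shows "((\<lambda>x. conj_if_minus \<sigma> (c x)) has_vector_derivative conj_if_minus \<sigma> c') (at x within S)"
  using assms has_vector_derivative_cnj[OF assms] by (simp add: conj_if_minus_def)

lemma product_of_real_parts: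
  "complex_of_real (Re (c * exp (\<i> * complex_of_real s)) * Re (d * exp (\<i> * complex_of_real t))) =
    1/4 * (\<Sum>\<sigma>\<in>{1, -1::real}. \<Sum>\<tau>\<in>{1, -1::real}.
      conj_if_minus \<sigma> c * conj_if_minus \<tau> d * exp (\<i> * complex_of_real (\<sigma> * s + \<tau> * t)))"
proof -
  have re: "complex_of_real (Re z) = 1/2 * (z + cnj z)" for z
    by (simp add: complex_add_cnj)
  define E F where "E = exp (\<i> * complex_of_real s)" and "F = exp (\<i> * complex_of_real t)"
  define E' F' where "E' = exp (- (\<i> * complex_of_real s))" and "F' = exp (- (\<i> * complex_of_real t))"
  have ex: "exp (\<i> * complex_of_real (1 * s + 1 * t)) = E * F" "exp (\<i> * complex_of_real (1 * s + - 1 * t)) = E * F'"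
    "exp (\<i> * complex_of_real (- 1 * s + 1 * t)) = E' * F" "exp (\<i> * complex_of_real (- 1 * s + - 1 * t)) = E' * F'"
    unfolding E_def F_def E'_def F'_def exp_add[symmetric] by (simp_all add: algebra_simps)
  have sum2: "(\<Sum>\<sigma>\<in>{1, -1::real}. f \<sigma>) = f 1 + f (- 1)" for f :: "real \<Rightarrow> complex"
    by simp
  have cj: "conj_if_minus 1 z = z" "conj_if_minus (- 1) z = cnj z" for z
    by (simp_all add: conj_if_minus_def)
  have "cnj E = E'" "cnj F = F'"
    by (simp_all add: E_def E'_def F_def F'_def exp_cnj)
  then show ?thesis
    unfolding sum2 ex cj unfolding of_real_mult re E_def[symmetric] F_def[symmetric]
    by (simp add: algebra_simps)
qed

text \<open>\<open>S\<close> is some antiderivative of the frequency, fixed only up to a constant;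
  accordingly the oscillatory bounds below are demanded for every antiderivative. The estimates of
  \<open>c\<close> and \<open>c'\<close> rest on q u^2 + u'^2 / q \<le> 12, rounded up to 16 so that
  the root is 4.\<close>

lemma (in oscillator_solution) wkb_coefficient:
  assumes ab: "0 \<le> a" "a \<le> b" "b\<^sup>2 < lam" "b \<le> wkb_freq lam b ^ 3"
  obtains S c c' where
    "\<And>x. x \<in> {a..b} \<Longrightarrow> (S has_real_derivative wkb_freq lam x) (at x within {a..b})"
    "\<And>x. x \<in> {a..b} \<Longrightarrow> (c has_vector_derivative c' x) (at x within {a..b})"
    "\<And>x. x \<in> {a..b} \<Longrightarrow> u x = Re (c x * exp (\<i> * complex_of_real (S x)))"
    "\<And>x. x \<in> {a..b} \<Longrightarrow> cmod (c x) \<le> 4 / sqrt (wkb_freq lam x)"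
    "\<And>x. x \<in> {a..b} \<Longrightarrow> cmod (c' x) \<le> 4 * x / (wkb_freq lam x ^ 2 * sqrt (wkb_freq lam x))"
proof -
  define q where "q = wkb_freq lam"
  have x2: "x\<^sup>2 < lam" if "x \<in> {a..b}" for x
  proof -
    have "x\<^sup>2 \<le> b\<^sup>2" using that ab by (intro power_mono) auto
    then show ?thesis using ab by simp
  qed
  have q0: "q x > 0" if "x \<in> {a..b}" for x
    unfolding q_def using x2[OF that] by (rule wkb_freq_pos)
  have qq: "x\<^sup>2 - lam = - (q x)\<^sup>2" if "x \<in> {a..b}" for x
    unfolding q_def using x2[OF that] by (simp add: wkb_freq_sq)
  have dq: "(q has_real_derivative - x / q x) (at x within {a..b})" if "x \<in> {a..b}" for x
    unfolding q_def using x2[OF that] by (rule wkb_freq_deriv)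
  have bounds: "q x * (u x)\<^sup>2 + (u' x)\<^sup>2 / q x \<le> 12" if x: "x \<in> {a..b}" for x
  proof -
    have "q b ^ 3 \<le> q x ^ 3"
      using q0[of b] ab x by (intro power_mono) (auto simp: q_def wkb_freq_antimono)
    then have "x \<le> q x ^ 3" using ab x by (simp add: q_def)
    then show ?thesis unfolding q_def using wkb_amplitude_le[of x] x2[OF x] ab x by simp
  qed
  have "continuous_on {a..b} q"
    by (rule DERIV_continuous_on) (rule dq)
  from antiderivative_continuous[OF this] obtain S where
    S: "\<And>x. x \<in> {a..b} \<Longrightarrow> (S has_vector_derivative q x) (at x within {a..b})" by blast
  then have S': "(S has_real_derivative q x) (at x within {a..b})" if "x \<in> {a..b}" for x
    using that by (simp add: has_real_derivative_iff_has_vector_derivative)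
  define e where "e = (\<lambda>x. exp (- \<i> * complex_of_real (S x)))"
  define z where "z = (\<lambda>x. complex_of_real (u x) - \<i> * complex_of_real (u' x / q x))"
  define c where "c = (\<lambda>x. z x * e x)"
  define c' where "c' = (\<lambda>x. - \<i> * complex_of_real (x * u' x / q x ^ 3) * e x)"
  have ne: "cmod (e x) = 1" for x by (simp add: e_def)
  show thesis
  proof (rule that[of S c c'])
    fix x assume x: "x \<in> {a..b}"
    show "(S has_real_derivative wkb_freq lam x) (at x within {a..b})"
      using S'[OF x] by (simp add: q_def)
    have "((\<lambda>x. - \<i> * complex_of_real (S x)) has_vector_derivative - \<i> * complex_of_real (q x)) (at x within {a..b})"
      by (intro has_vector_derivative_mult_right has_vector_derivative_of_real S'[OF x])
    from field_vector_diff_chain_within[OF this DERIV_exp[THEN DERIV_subset, OF subset_UNIV]]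
    have de: "(e has_vector_derivative - \<i> * complex_of_real (q x) * e x) (at x within {a..b})"
      by (simp add: e_def o_def)
    have d1: "((\<lambda>x. u' x / q x) has_real_derivative (- q x * u x + x * u' x / q x ^ 3)) (at x within {a..b})"
    proof -
      have "((\<lambda>x. u' x / q x) has_real_derivative
         ((x\<^sup>2 - lam) * u x * q x - u' x * (- x / q x)) / (q x * q x)) (at x within {a..b})"
        using q0[OF x] by (intro DERIV_divide has_field_derivative_at_within[OF du'] dq x) auto
      moreover have "((x\<^sup>2 - lam) * u x * q x - u' x * (- x / q x)) / (q x * q x) = - q x * u x + x * u' x / q x ^ 3"
        unfolding qq[OF x] using q0[OF x] by (simp add: field_simps power2_eq_square power3_eq_cube)
      ultimately show ?thesis by simp
    qed
    have dz: "(z has_vector_derivative (complex_of_real (u' x) - \<i> * complex_of_real (- q x * u x + x * u' x / q x ^ 3)))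
        (at x within {a..b})"
      unfolding z_def
      by (intro has_vector_derivative_diff has_vector_derivative_mult_right has_vector_derivative_of_real
          d1 has_field_derivative_at_within[OF du])
    have "z x * (- \<i> * complex_of_real (q x) * e x) + (complex_of_real (u' x) - \<i> * complex_of_real (- q x * u x + x * u' x / q x ^ 3)) * e x
        = c' x"
    proof -
      have "complex_of_real (u' x / q x) * complex_of_real (q x) = complex_of_real (u' x)"
        using q0[OF x] by simp
      then have "z x * (- \<i> * complex_of_real (q x)) = - \<i> * complex_of_real (q x) * complex_of_real (u x) - complex_of_real (u' x)"
        unfolding z_def by (simp add: algebra_simps)
      then have "z x * (- \<i> * complex_of_real (q x) * e x) = (- \<i> * complex_of_real (q x) * complex_of_real (u x) - complex_of_real (u' x)) * e x"
        by (simp only: mult.assoc[symmetric])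
      then show ?thesis unfolding c'_def by (simp add: algebra_simps)
    qed
    then show "(c has_vector_derivative c' x) (at x within {a..b})"
      using has_vector_derivative_mult[OF dz de] unfolding c_def by simp
    have "c x * exp (\<i> * complex_of_real (S x)) = z x"
      unfolding c_def e_def by (simp add: exp_minus mult.assoc)
    then show "u x = Re (c x * exp (\<i> * complex_of_real (S x)))"
      by (simp add: z_def)
    have Q: "q x > 0" by (rule q0[OF x])
    have sq: "sqrt (q x) > 0" "sqrt (q x) * sqrt (q x) = q x" "(sqrt (q x))\<^sup>2 = q x" using Q by auto
    have "(cmod (c x))\<^sup>2 = (u x)\<^sup>2 + (u' x / q x)\<^sup>2"
      unfolding c_def norm_mult ne z_def by (simp add: cmod_power2)
    also have "\<dots> = (q x * (u x)\<^sup>2 + (u' x)\<^sup>2 / q x) / q x"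
      using Q by (simp add: field_simps power2_eq_square)
    also have "\<dots> \<le> 16 / q x" using bounds[OF x] Q by (intro divide_right_mono) auto
    also have "\<dots> = (4 / sqrt (q x))\<^sup>2" using sq by (simp add: power_divide)
    finally have "(cmod (c x))\<^sup>2 \<le> (4 / sqrt (q x))\<^sup>2" .
    from power2_le_imp_le[OF this] sq show "cmod (c x) \<le> 4 / sqrt (wkb_freq lam x)"
      unfolding q_def[symmetric] by simp
    have "(u' x)\<^sup>2 \<le> 16 * q x"
    proof -
      have "0 \<le> q x * (u x)\<^sup>2" using Q by simp
      then have "(u' x)\<^sup>2 / q x \<le> 16" using bounds[OF x] by linarith
      then show ?thesis using Q by (simp add: pos_divide_le_eq)
    qed
    then have "\<bar>u' x\<bar>\<^sup>2 \<le> (4 * sqrt (q x))\<^sup>2"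
      using sq(3) by (simp add: power_mult_distrib)
    then have "\<bar>u' x\<bar> \<le> 4 * sqrt (q x)"
      by (rule power2_le_imp_le) (use sq in simp)
    then have "x * \<bar>u' x\<bar> / q x ^ 3 \<le> x * (4 * sqrt (q x)) / q x ^ 3"
      using Q x ab by (intro divide_right_mono mult_left_mono) auto
    also have "\<dots> = 4 * x / ((q x)\<^sup>2 * sqrt (q x))"
      using sq Q by (simp add: field_simps power2_eq_square power3_eq_cube)
    finally show "cmod (c' x) \<le> 4 * x / ((wkb_freq lam x)\<^sup>2 * sqrt (wkb_freq lam x))"
      using Q x ab unfolding c'_def q_def[symmetric] by (simp add: norm_mult ne norm_divide norm_power abs_mult)
  qed
qed

context oscillator_pair
begin

text \<open>The second claim compares amplitudes: \<open>lam - x\<^sup>2\<close> is at most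
  \<open>lam / Lam\<close> times \<open>Lam - x\<^sup>2\<close>, and the fourth root of this ratio
  is \<rho>.\<close>

lemma wkb_freq_le:
  assumes "x\<^sup>2 < lam"
  shows "wkb_freq lam x \<le> wkb_freq Lam x"
    and "1 / sqrt (wkb_freq Lam x) \<le> \<rho> / sqrt (wkb_freq lam x)"
proof -
  have l: "lam > 0" "Lam > 0" using u.lam_ge v.lam_ge by auto
  define q where "q = wkb_freq lam x"
  define p where "p = wkb_freq Lam x"
  have q: "q > 0" "q\<^sup>2 = lam - x\<^sup>2" unfolding q_def using assms by (auto simp: wkb_freq_pos wkb_freq_sq)
  have p: "p > 0" "p\<^sup>2 = Lam - x\<^sup>2"
    unfolding p_def using assms lam_le_Lam by (auto simp: wkb_freq_pos wkb_freq_sq)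
  have "q\<^sup>2 \<le> p\<^sup>2" using q p lam_le_Lam by simp
  then show "wkb_freq lam x \<le> wkb_freq Lam x"
    using power2_le_imp_le[of q p] p(1) unfolding p_def[symmetric] q_def[symmetric] by simp
  have "q\<^sup>2 \<le> (lam / Lam) * p\<^sup>2"
  proof -
    have "lam / Lam \<le> 1" using l lam_le_Lam by simp
    then have "(lam / Lam) * x\<^sup>2 \<le> 1 * x\<^sup>2" by (intro mult_right_mono) auto
    moreover have "(lam / Lam) * Lam = lam" using l by simp
    ultimately show ?thesis unfolding q(2) p(2) right_diff_distrib by linarith
  qed
  also have "\<dots> = (\<rho>\<^sup>2 * p)\<^sup>2" unfolding \<rho>_sq using l by (simp add: power_mult_distrib)
  finally have "q \<le> \<rho>\<^sup>2 * p"
    by (rule power2_le_imp_le) (use p(1) in simp)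
  then have "sqrt q \<le> sqrt (\<rho>\<^sup>2 * p)" by simp
  also have "\<dots> = \<rho> * sqrt p" using \<rho>_pos by (simp add: real_sqrt_mult)
  finally have "sqrt q \<le> \<rho> * sqrt p" .
  then have "sqrt q / sqrt p / sqrt q \<le> \<rho> / sqrt q"
    using p(1) q(1) by (intro divide_right_mono) (auto simp: pos_divide_le_eq)
  also have "sqrt q / sqrt p / sqrt q = 1 / sqrt p" using q(1) by simp
  finally show "1 / sqrt (wkb_freq Lam x) \<le> \<rho> / sqrt (wkb_freq lam x)"
    unfolding p_def q_def .
qed

text \<open>\<open>V\<close> has to serve all four sign pairs, whatever antiderivatives
  \<open>wkb_coefficient\<close> returns, and all end points \<open>t\<close>, because integration
  by parts uses the primitive of the oscillating factor. The four terms are compensated by the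
  factor 1/4 of \<open>product_of_real_parts\<close>.\<close>

lemma interior_piece_le:
  fixes \<psi> :: "real \<Rightarrow> real"
  assumes \<mu>: "\<mu> \<ge> 0" and ab: "0 \<le> a" "a \<le> b" "b\<^sup>2 < lam" "b \<le> wkb_freq lam b ^ 3"
    and \<psi>: "continuous_on {a..b} \<psi>"
    and V: "\<And>S T \<sigma> \<tau> t. (\<And>x. x \<in> {a..b} \<Longrightarrow> (S has_real_derivative wkb_freq lam x) (at x within {a..b})) \<Longrightarrow>
       (\<And>x. x \<in> {a..b} \<Longrightarrow> (T has_real_derivative wkb_freq Lam x) (at x within {a..b})) \<Longrightarrow>
       \<sigma> \<in> {1, -1} \<Longrightarrow> \<tau> \<in> {1, -1} \<Longrightarrow> t \<in> {a..b} \<Longrightarrow>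
       cmod (osc_integral a t (\<lambda>x. \<psi> x + \<sigma> * S x + \<tau> * T x)) \<le> V"
  shows "cmod (integral {a..b} (\<lambda>x. complex_of_real (weight \<mu> x) * exp (\<i> * complex_of_real (\<psi> x))
      * complex_of_real (u x) * complex_of_real (v x))) \<le> 64 * V * \<rho> * weight \<mu> b / wkb_freq lam b"
proof -
  define q where "q = wkb_freq lam"
  define W where "W = weight \<mu> b"
  have x2: "x\<^sup>2 < lam" if "x \<in> {a..b}" for x
  proof -
    have "x\<^sup>2 \<le> b\<^sup>2" using that ab by (intro power_mono) auto
    then show ?thesis using ab by simp
  qed
  have q0: "q x > 0" if "x \<in> {a..b}" for x
    unfolding q_def using x2[OF that] by (rule wkb_freq_pos)
  have qb: "q x \<ge> q b" if "x \<in> {a..b}" for x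
    unfolding q_def using that ab by (intro wkb_freq_antimono) auto
  have bb: "b \<in> {a..b}" using ab by simp
  have bL: "b\<^sup>2 < Lam" "b \<le> wkb_freq Lam b ^ 3"
  proof -
    show "b\<^sup>2 < Lam" using ab lam_le_Lam by simp
    have "wkb_freq lam b ^ 3 \<le> wkb_freq Lam b ^ 3"
      using wkb_freq_le(1)[OF ab(3)] q0[OF bb] by (intro power_mono) (auto simp: q_def)
    then show "b \<le> wkb_freq Lam b ^ 3" using ab by simp
  qed
  obtain S c c' where
    S: "\<And>x. x \<in> {a..b} \<Longrightarrow> (S has_real_derivative wkb_freq lam x) (at x within {a..b})"
    and dc: "\<And>x. x \<in> {a..b} \<Longrightarrow> (c has_vector_derivative c' x) (at x within {a..b})"
    and ux: "\<And>x. x \<in> {a..b} \<Longrightarrow> u x = Re (c x * exp (\<i> * complex_of_real (S x)))"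
    and c: "\<And>x. x \<in> {a..b} \<Longrightarrow> cmod (c x) \<le> 4 / sqrt (wkb_freq lam x)"
    and c': "\<And>x. x \<in> {a..b} \<Longrightarrow> cmod (c' x) \<le> 4 * x / (wkb_freq lam x ^ 2 * sqrt (wkb_freq lam x))"
    using u.wkb_coefficient[OF ab] by metis
  obtain T d d' where
    T: "\<And>x. x \<in> {a..b} \<Longrightarrow> (T has_real_derivative wkb_freq Lam x) (at x within {a..b})"
    and dd: "\<And>x. x \<in> {a..b} \<Longrightarrow> (d has_vector_derivative d' x) (at x within {a..b})"
    and vx: "\<And>x. x \<in> {a..b} \<Longrightarrow> v x = Re (d x * exp (\<i> * complex_of_real (T x)))"
    and d0: "\<And>x. x \<in> {a..b} \<Longrightarrow> cmod (d x) \<le> 4 / sqrt (wkb_freq Lam x)"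
    and d0': "\<And>x. x \<in> {a..b} \<Longrightarrow> cmod (d' x) \<le> 4 * x / (wkb_freq Lam x ^ 2 * sqrt (wkb_freq Lam x))"
    using v.wkb_coefficient[OF ab(1,2) bL] by metis
  have d: "cmod (d x) \<le> 4 * \<rho> / sqrt (q x)" if x: "x \<in> {a..b}" for x
    using d0[OF x] wkb_freq_le(2)[OF x2[OF x]] by (simp add: q_def)
  have d': "cmod (d' x) \<le> 4 * \<rho> * x / ((q x)\<^sup>2 * sqrt (q x))" if x: "x \<in> {a..b}" for x
  proof -
    have le: "q x \<le> wkb_freq Lam x" unfolding q_def by (rule wkb_freq_le(1)[OF x2[OF x]])
    have "4 * x / (wkb_freq Lam x ^ 2 * sqrt (wkb_freq Lam x)) = 4 * x / wkb_freq Lam x ^ 2 * (1 / sqrt (wkb_freq Lam x))"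
      by simp
    also have "\<dots> \<le> 4 * x / (q x)\<^sup>2 * (\<rho> / sqrt (q x))"
    proof (intro mult_mono)
      show "4 * x / wkb_freq Lam x ^ 2 \<le> 4 * x / (q x)\<^sup>2"
        using le q0[OF x] x ab by (intro divide_left_mono power_mono mult_pos_pos) auto
      show "1 / sqrt (wkb_freq Lam x) \<le> \<rho> / sqrt (q x)"
        unfolding q_def by (rule wkb_freq_le(2)[OF x2[OF x]])
    qed (use le q0[OF x] x ab in auto)
    finally show ?thesis using d0'[OF x] by (simp add: mult_ac)
  qed
  have w0: "weight \<mu> x > 0" "weight \<mu> x \<le> W" if "x \<in> {a..b}" for x
    using weight_pos weight_mono[OF \<mu>, of x b] that ab by (auto simp: W_def)
  define w' where "w' = (\<lambda>x. \<mu> * x * (1 + x\<^sup>2) powr (\<mu> / 2 - 1))"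
  have w'0: "w' x \<ge> 0" if "x \<in> {a..b}" for x unfolding w'_def using \<mu> that ab by simp
  \<comment> \<open>A majorant for the variation of the amplitude. The product of \<open>c\<close>
    and \<open>d\<close> has size at most 16 \<rho> / q, which for the derivative of the weight is
    replaced by its value at \<open>b\<close>. The derivative x / q^3 of 1 / q matches the bounds
    for c' d and c d', which explains the 2.\<close>
  define M where "M = (\<lambda>x. 16 * \<rho> * (weight \<mu> x / q b + 2 * W * (1 / q x)))"
  define M' where "M' = (\<lambda>x. 16 * \<rho> * (w' x / q b + 2 * W * (x / q x ^ 3)))"
  have dM: "(M has_real_derivative M' x) (at x within {a..b})" if x: "x \<in> {a..b}" for x
  proof -
    have "((\<lambda>x. 1 / q x) has_real_derivative (0 * q x - 1 * (- x / q x)) / (q x * q x)) (at x within {a..b})"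
      using q0[OF x] unfolding q_def by (intro DERIV_divide DERIV_const wkb_freq_deriv x2[OF x]) auto
    also have "(0 * q x - 1 * (- x / q x)) / (q x * q x) = x / q x ^ 3"
      using q0[OF x] by (simp add: power3_eq_cube)
    finally have 1: "((\<lambda>x. 1 / q x) has_real_derivative x / q x ^ 3) (at x within {a..b})" .
    show ?thesis unfolding M_def M'_def w'_def
      by (intro DERIV_cmult DERIV_add DERIV_cdivide weight_deriv 1)
  qed
  have single: "cmod (integral {a..b} (\<lambda>x. complex_of_real (weight \<mu> x) * (conj_if_minus \<sigma> (c x) * conj_if_minus \<tau> (d x))
      * exp (\<i> * complex_of_real (\<psi> x + \<sigma> * S x + \<tau> * T x)))) \<le> 64 * V * \<rho> * W / q b"
    if st: "\<sigma> \<in> {1, -1}" "\<tau> \<in> {1, -1}" for \<sigma> \<tau>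
  proof -
    define A where "A = (\<lambda>x. complex_of_real (weight \<mu> x) * (conj_if_minus \<sigma> (c x) * conj_if_minus \<tau> (d x)))"
    define A' where "A' = (\<lambda>x. complex_of_real (weight \<mu> x) *
        (conj_if_minus \<sigma> (c x) * conj_if_minus \<tau> (d' x) + conj_if_minus \<sigma> (c' x) * conj_if_minus \<tau> (d x))
        + complex_of_real (w' x) * (conj_if_minus \<sigma> (c x) * conj_if_minus \<tau> (d x)))"
    have cS: "continuous_on {a..b} S" "continuous_on {a..b} T"
      by (rule DERIV_continuous_on, erule S, rule DERIV_continuous_on, erule T)
    have V0: "V \<ge> 0" using order_trans[OF norm_ge_zero V[OF S T st bb]] .
    have cd: "cmod (c x) * cmod (d x) \<le> 16 * \<rho> / q x" if x: "x \<in> {a..b}" for x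
    proof -
      have "cmod (c x) * cmod (d x) \<le> (4 / sqrt (q x)) * (4 * \<rho> / sqrt (q x))"
        using c[OF x] d[OF x] q0[OF x] \<rho>_pos by (intro mult_mono) (auto simp: q_def)
      also have "\<dots> = 16 * \<rho> / q x" using q0[OF x] by simp
      finally show ?thesis .
    qed
    have c'd: "cmod (c' x) * cmod (d x) \<le> 16 * \<rho> * (x / q x ^ 3)" if x: "x \<in> {a..b}" for x
    proof -
      have "cmod (c' x) * cmod (d x) \<le> (4 * x / ((q x)\<^sup>2 * sqrt (q x))) * (4 * \<rho> / sqrt (q x))"
        using c'[OF x] d[OF x] q0[OF x] \<rho>_pos x ab by (intro mult_mono) (auto simp: q_def)
      also have "\<dots> = 16 * \<rho> * (x / q x ^ 3)" using q0[OF x] by (simp add: power2_eq_square power3_eq_cube mult.assoc)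
      finally show ?thesis .
    qed
    have cd': "cmod (c x) * cmod (d' x) \<le> 16 * \<rho> * (x / q x ^ 3)" if x: "x \<in> {a..b}" for x
    proof -
      have "cmod (d' x) * cmod (c x) \<le> (4 * \<rho> * x / ((q x)\<^sup>2 * sqrt (q x))) * (4 / sqrt (q x))"
        using c[OF x] d'[OF x] q0[OF x] \<rho>_pos x ab by (intro mult_mono) (auto simp: q_def)
      also have "\<dots> = 16 * \<rho> * (x / q x ^ 3)" using q0[OF x] by (simp add: power2_eq_square power3_eq_cube mult.assoc)
      finally show ?thesis by (simp only: mult.commute[of "cmod (c x)"])
    qed
    have "cmod (integral {a..b} (\<lambda>x. A x * exp (\<i> * complex_of_real (\<psi> x + \<sigma> * S x + \<tau> * T x))))
       \<le> V * (cmod (A b) + (M b - M a))"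
    proof (rule oscillatory_integral_with_amplitude[OF ab(2)])
      show "continuous_on {a..b} (\<lambda>x. exp (\<i> * complex_of_real (\<psi> x + \<sigma> * S x + \<tau> * T x)))"
        by (intro continuous_intros \<psi> cS)
      show "cmod (osc_integral a t (\<lambda>x. \<psi> x + \<sigma> * S x + \<tau> * T x)) \<le> V" if "t \<in> {a..b}" for t
        by (rule V[OF S T st that])
      fix x assume x: "x \<in> {a..b}"
      have "((\<lambda>x. complex_of_real (weight \<mu> x)) has_vector_derivative complex_of_real (w' x)) (at x within {a..b})"
        unfolding w'_def by (intro has_vector_derivative_of_real weight_deriv)
      from has_vector_derivative_mult[OF this has_vector_derivative_mult[OF has_vector_derivative_conj_if_minus[OF dc[OF x]]
            has_vector_derivative_conj_if_minus[OF dd[OF x]]]]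
      show "(A has_vector_derivative A' x) (at x within {a..b})" unfolding A_def A'_def .
      show "(M has_real_derivative M' x) (at x within {a..b})" by (rule dM[OF x])
      have "cmod (A' x) \<le> weight \<mu> x * (cmod (c x) * cmod (d' x) + cmod (c' x) * cmod (d x)) + w' x * (cmod (c x) * cmod (d x))"
      proof -
        have "cmod (A' x) \<le> cmod (complex_of_real (weight \<mu> x) *
          (conj_if_minus \<sigma> (c x) * conj_if_minus \<tau> (d' x) + conj_if_minus \<sigma> (c' x) * conj_if_minus \<tau> (d x)))
          + cmod (complex_of_real (w' x) * (conj_if_minus \<sigma> (c x) * conj_if_minus \<tau> (d x)))"
          unfolding A'_def by (rule norm_triangle_ineq)
        also have "cmod (complex_of_real (w' x) * (conj_if_minus \<sigma> (c x) * conj_if_minus \<tau> (d x))) = w' x * (cmod (c x) * cmod (d x))"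
          using w'0[OF x] by (simp add: norm_mult)
        also have "cmod (complex_of_real (weight \<mu> x) *
          (conj_if_minus \<sigma> (c x) * conj_if_minus \<tau> (d' x) + conj_if_minus \<sigma> (c' x) * conj_if_minus \<tau> (d x)))
          = weight \<mu> x * cmod (conj_if_minus \<sigma> (c x) * conj_if_minus \<tau> (d' x) + conj_if_minus \<sigma> (c' x) * conj_if_minus \<tau> (d x))"
          using w0(1)[OF x] by (simp add: norm_mult)
        also have "\<dots> \<le> weight \<mu> x * (cmod (c x) * cmod (d' x) + cmod (c' x) * cmod (d x))"
          using w0(1)[OF x] by (intro mult_left_mono order_trans[OF norm_triangle_ineq]) (auto simp: norm_mult)
        finally show ?thesis by simp
      qed
      also have "\<dots> \<le> W * (16 * \<rho> * (x / q x ^ 3) + 16 * \<rho> * (x / q x ^ 3)) + w' x * (16 * \<rho> / q b)"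
      proof (rule add_mono)
        show "weight \<mu> x * (cmod (c x) * cmod (d' x) + cmod (c' x) * cmod (d x))
            \<le> W * (16 * \<rho> * (x / q x ^ 3) + 16 * \<rho> * (x / q x ^ 3))"
          using w0[OF x] by (intro mult_mono[OF w0(2)[OF x] add_mono[OF cd'[OF x] c'd[OF x]]]) auto
        have "16 * \<rho> / q x \<le> 16 * \<rho> / q b"
          using qb[OF x] q0[OF x] q0[OF bb] \<rho>_pos by (intro divide_left_mono) auto
        then have "cmod (c x) * cmod (d x) \<le> 16 * \<rho> / q b" using cd[OF x] by linarith
        then show "w' x * (cmod (c x) * cmod (d x)) \<le> w' x * (16 * \<rho> / q b)"
          using w'0[OF x] by (rule mult_left_mono)
      qed
      also have "\<dots> = M' x" unfolding M'_def by (simp add: algebra_simps)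
      finally show "cmod (A' x) \<le> M' x" .
    qed
    \<comment> \<open>16 from the amplitude at \<open>b\<close>, and 16 * (1 + 2) from the growth of
      \<open>M\<close>.\<close>
    also have "\<dots> \<le> V * (16 * \<rho> * W / q b + 48 * \<rho> * W / q b)"
    proof (intro mult_left_mono add_mono V0)
      have "cmod (A b) = W * (cmod (c b) * cmod (d b))"
        unfolding A_def W_def using w0(1)[OF bb] by (simp add: norm_mult)
      also have "\<dots> \<le> W * (16 * \<rho> / q b)"
        using cd[OF bb] w0[OF bb] by (intro mult_left_mono) auto
      finally show "cmod (A b) \<le> 16 * \<rho> * W / q b" by (simp add: mult_ac)
      have "M a \<ge> 0" unfolding M_def
        using \<rho>_pos q0[of a] q0[OF bb] w0[of a] ab by (intro mult_nonneg_nonneg add_nonneg_nonneg divide_nonneg_nonneg) auto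
      moreover have "M b = 48 * \<rho> * W / q b" unfolding M_def W_def by simp
      ultimately show "M b - M a \<le> 48 * \<rho> * W / q b" by simp
    qed
    also have "\<dots> = 64 * V * \<rho> * W / q b" by (simp add: algebra_simps)
    finally show ?thesis unfolding A_def .
  qed
  define G where "G = (\<lambda>\<sigma> \<tau> x. complex_of_real (weight \<mu> x) * (conj_if_minus \<sigma> (c x) * conj_if_minus \<tau> (d x))
      * exp (\<i> * complex_of_real (\<psi> x + \<sigma> * S x + \<tau> * T x)))"
  have Gi: "G \<sigma> \<tau> integrable_on {a..b}" for \<sigma> \<tau>
  proof -
    have "continuous_on {a..b} S" "continuous_on {a..b} T"
      by (rule DERIV_continuous_on, erule S, rule DERIV_continuous_on, erule T)
    moreover have "continuous_on {a..b} (\<lambda>x. conj_if_minus \<sigma> (c x))" "continuous_on {a..b} (\<lambda>x. conj_if_minus \<tau> (d x))"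
      using has_vector_derivative_conj_if_minus[OF dc] has_vector_derivative_conj_if_minus[OF dd]
      by (meson continuous_on_vector_derivative)+
    ultimately show ?thesis unfolding G_def
      by (intro integrable_continuous_interval continuous_intros \<psi> cont_weight)
  qed
  have "integral {a..b} (\<lambda>x. complex_of_real (weight \<mu> x) * exp (\<i> * complex_of_real (\<psi> x))
      * complex_of_real (u x) * complex_of_real (v x)) =
    integral {a..b} (\<lambda>x. 1/4 * (\<Sum>\<sigma>\<in>{1, -1}. \<Sum>\<tau>\<in>{1, -1}. G \<sigma> \<tau> x))"
  proof (rule Henstock_Kurzweil_Integration.integral_cong)
    fix x assume x: "x \<in> {a..b}"
    define w where "w = complex_of_real (weight \<mu> x) * exp (\<i> * complex_of_real (\<psi> x))"
    have g: "G \<sigma> \<tau> x = w * (conj_if_minus \<sigma> (c x) * conj_if_minus \<tau> (d x)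
         * exp (\<i> * complex_of_real (\<sigma> * S x + \<tau> * T x)))" for \<sigma> \<tau>
    proof -
      have "exp (\<i> * complex_of_real (\<psi> x + \<sigma> * S x + \<tau> * T x)) = exp (\<i> * complex_of_real (\<psi> x)) * exp (\<i> * complex_of_real (\<sigma> * S x + \<tau> * T x))"
        unfolding exp_add[symmetric] by (simp add: algebra_simps)
      then show ?thesis unfolding G_def w_def by (simp only: mult_ac)
    qed
    have "complex_of_real (weight \<mu> x) * exp (\<i> * complex_of_real (\<psi> x)) * complex_of_real (u x) * complex_of_real (v x)
       = w * complex_of_real (u x * v x)" by (simp add: w_def)
    also have "\<dots> = 1/4 * (w * (\<Sum>\<sigma>\<in>{1, -1::real}. \<Sum>\<tau>\<in>{1, -1::real}. conj_if_minus \<sigma> (c x) * conj_if_minus \<tau> (d x)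
         * exp (\<i> * complex_of_real (\<sigma> * S x + \<tau> * T x))))"
      unfolding ux[OF x] vx[OF x] product_of_real_parts by (simp only: mult.left_commute)
    also have "\<dots> = 1/4 * (\<Sum>\<sigma>\<in>{1, -1}. \<Sum>\<tau>\<in>{1, -1}. G \<sigma> \<tau> x)"
      by (simp only: g sum_distrib_left)
    finally show "complex_of_real (weight \<mu> x) * exp (\<i> * complex_of_real (\<psi> x)) * complex_of_real (u x) * complex_of_real (v x)
       = 1/4 * (\<Sum>\<sigma>\<in>{1, -1}. \<Sum>\<tau>\<in>{1, -1}. G \<sigma> \<tau> x)" .
  qed
  also have "\<dots> = 1/4 * (\<Sum>\<sigma>\<in>{1, -1}. \<Sum>\<tau>\<in>{1, -1}. integral {a..b} (G \<sigma> \<tau>))"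
    by (subst Henstock_Kurzweil_Integration.integral_mult_right)
      (simp add: Henstock_Kurzweil_Integration.integral_add Gi integrable_add)
  finally have eq: "integral {a..b} (\<lambda>x. complex_of_real (weight \<mu> x) * exp (\<i> * complex_of_real (\<psi> x))
      * complex_of_real (u x) * complex_of_real (v x))
    = 1/4 * (\<Sum>\<sigma>\<in>{1, -1}. \<Sum>\<tau>\<in>{1, -1}. integral {a..b} (G \<sigma> \<tau>))" .
  have "cmod (\<Sum>\<sigma>\<in>{1, -1::real}. \<Sum>\<tau>\<in>{1, -1::real}. integral {a..b} (G \<sigma> \<tau>))
      \<le> (\<Sum>\<sigma>\<in>{1, -1::real}. \<Sum>\<tau>\<in>{1, -1::real}. 64 * V * \<rho> * W / q b)"
    using single unfolding G_def by (intro sum_norm_le) auto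
  also have "\<dots> = 4 * (64 * V * \<rho> * W / q b)" by simp
  finally show ?thesis
    unfolding eq norm_mult W_def[symmetric] q_def[symmetric] by simp
qed

end

section \<open>The phases\<close>

text \<open>If \<open>g\<close> keeps one sign, \<open>c\<close> is an end point and one of the two
  sides degenerates.\<close>

lemma sign_change_point:
  fixes g g' :: "real \<Rightarrow> real"
  assumes "a \<le> b"
    and d: "\<And>x. x \<in> {a..b} \<Longrightarrow> (g has_real_derivative g' x) (at x within {a..b})"
    and nn: "\<And>x. x \<in> {a..b} \<Longrightarrow> g' x \<ge> 0"
  obtains c where "a \<le> c" "c \<le> b" "c = a \<or> (\<forall>x\<in>{a..c}. g x \<le> 0)" "c = b \<or> (\<forall>x\<in>{c..b}. g x \<ge> 0)"
proof -
  have mono: "g x \<le> g y" if "a \<le> x" "x \<le> y" "y \<le> b" for x y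
    using increment_ge[OF d nn that] by simp
  have cont: "continuous_on {a..b} g" using d by (rule DERIV_continuous_on)
  consider "g b \<le> 0" | "g a \<ge> 0" | "g a \<le> 0" "g b \<ge> 0" by linarith
  then show thesis
  proof cases
    case 1
    have "g x \<le> 0" if "x \<in> {a..b}" for x using mono[of x b] 1 that by auto
    then show thesis using that[of b] \<open>a \<le> b\<close> by blast
  next
    case 2
    have "g x \<ge> 0" if "x \<in> {a..b}" for x using mono[of a x] 2 that by auto
    then show thesis using that[of a] \<open>a \<le> b\<close> by blast
  next
    case 3
    then obtain c where c: "a \<le> c" "c \<le> b" "g c = 0"
      using IVT'[of g a 0 b] \<open>a \<le> b\<close> cont by auto
    have "g x \<le> 0" if "x \<in> {a..c}" for x using mono[of x c] c that by auto
    moreover have "g x \<ge> 0" if "x \<in> {c..b}" for x using mono[of c x] c that by auto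
    ultimately show thesis using that[of c] c by blast
  qed
qed

lemma wkb_freq_ratio_deriv:
  assumes "x\<^sup>2 < lam"
  shows "((\<lambda>x. x / wkb_freq lam x) has_real_derivative lam / wkb_freq lam x ^ 3) (at x within S)"
proof -
  have q: "wkb_freq lam x > 0" "lam = (wkb_freq lam x)\<^sup>2 + x\<^sup>2"
    using assms by (auto simp: wkb_freq_pos wkb_freq_sq)
  have "((\<lambda>x. x / wkb_freq lam x) has_real_derivative
      (1 * wkb_freq lam x - x * (- x / wkb_freq lam x)) / (wkb_freq lam x * wkb_freq lam x)) (at x within S)"
    using q(1) by (intro DERIV_divide DERIV_ident wkb_freq_deriv[OF assms]) auto
  moreover have "(1 * wkb_freq lam x - x * (- x / wkb_freq lam x)) / (wkb_freq lam x * wkb_freq lam x)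
      = ((wkb_freq lam x)\<^sup>2 + x\<^sup>2) / wkb_freq lam x ^ 3"
    using q(1) by (simp add: field_simps power2_eq_square power3_eq_cube)
  ultimately show ?thesis using q(2) by simp
qed

abbreviation phase :: "real \<Rightarrow> real \<Rightarrow> real \<Rightarrow> real \<Rightarrow> (real \<Rightarrow> real) \<Rightarrow> (real \<Rightarrow> real) \<Rightarrow> real \<Rightarrow> real" where
  "phase k \<beta> \<sigma> \<tau> S T \<equiv> \<lambda>x. k * x powr \<beta> + \<sigma> * S x + \<tau> * T x"

text \<open>
  \<open>phase2\<close> and \<open>phase3\<close> are minus the second and third derivatives of \<open>\<sigma> S + \<tau> T\<close>, where
  \<open>S' = \<surd>(\<lambda> - x\<^sup>2)\<close> and \<open>T' = \<surd>(\<Lambda> - x\<^sup>2)\<close>.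
\<close>

definition phase2 :: "real \<Rightarrow> real \<Rightarrow> real \<Rightarrow> real \<Rightarrow> real \<Rightarrow> real" where
  "phase2 lam Lam \<sigma> \<tau> x = \<sigma> * (x / wkb_freq lam x) + \<tau> * (x / wkb_freq Lam x)"

definition phase3 :: "real \<Rightarrow> real \<Rightarrow> real \<Rightarrow> real \<Rightarrow> real \<Rightarrow> real" where
  "phase3 lam Lam \<sigma> \<tau> x = \<sigma> * (lam / wkb_freq lam x ^ 3) + \<tau> * (Lam / wkb_freq Lam x ^ 3)"

lemma phase_derivs:
  assumes "lam \<le> Lam" and x: "x \<in> {a..b}" "x > 0" "x\<^sup>2 < lam"
    and S: "(S has_real_derivative wkb_freq lam x) (at x within {a..b})"
    and T: "(T has_real_derivative wkb_freq Lam x) (at x within {a..b})"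
  shows "((phase k \<beta> \<sigma> \<tau> S T) has_real_derivative
      (k * \<beta> * x powr (\<beta> - 1) + \<sigma> * wkb_freq lam x + \<tau> * wkb_freq Lam x)) (at x within {a..b})"
    and "((\<lambda>x. k * \<beta> * x powr (\<beta> - 1) + \<sigma> * wkb_freq lam x + \<tau> * wkb_freq Lam x) has_real_derivative
      (k * \<beta> * (\<beta> - 1) * x powr (\<beta> - 2) - phase2 lam Lam \<sigma> \<tau> x)) (at x within {a..b})"
    and "((\<lambda>x. k * \<beta> * (\<beta> - 1) * x powr (\<beta> - 2) - phase2 lam Lam \<sigma> \<tau> x) has_real_derivative
      (k * \<beta> * (\<beta> - 1) * (\<beta> - 2) * x powr (\<beta> - 3) - phase3 lam Lam \<sigma> \<tau> x)) (at x within {a..b})"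
    and "(phase2 lam Lam \<sigma> \<tau> has_real_derivative phase3 lam Lam \<sigma> \<tau> x) (at x within {a..b})"
    and "((\<lambda>x. k * \<beta> * (\<beta> - 1) * x powr (\<beta> - 2)) has_real_derivative
      k * \<beta> * (\<beta> - 1) * (\<beta> - 2) * x powr (\<beta> - 3)) (at x within {a..b})"
proof -
  have xL: "x\<^sup>2 < Lam" using x assms(1) by simp
  have pw: "((\<lambda>x. c * x powr r) has_real_derivative c * (r * x powr (r - 1))) (at x within {a..b})" for c r
    by (intro DERIV_cmult has_field_derivative_at_within[OF has_real_derivative_powr[OF x(2)]])
  show "((phase k \<beta> \<sigma> \<tau> S T) has_real_derivative
      (k * \<beta> * x powr (\<beta> - 1) + \<sigma> * wkb_freq lam x + \<tau> * wkb_freq Lam x)) (at x within {a..b})"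
    using DERIV_add[OF DERIV_add[OF pw[of k \<beta>] DERIV_cmult[OF S, of \<sigma>]] DERIV_cmult[OF T, of \<tau>]] by (simp add: mult.assoc)
  show "((\<lambda>x. k * \<beta> * x powr (\<beta> - 1) + \<sigma> * wkb_freq lam x + \<tau> * wkb_freq Lam x) has_real_derivative
      (k * \<beta> * (\<beta> - 1) * x powr (\<beta> - 2) - phase2 lam Lam \<sigma> \<tau> x)) (at x within {a..b})"
    using DERIV_add[OF DERIV_add[OF pw[of "k * \<beta>" "\<beta> - 1"] DERIV_cmult[OF wkb_freq_deriv[OF x(3)], of \<sigma>]]
        DERIV_cmult[OF wkb_freq_deriv[OF xL], of \<tau>]] by (simp add: phase2_def mult.assoc diff_diff_eq)
  show p: "(phase2 lam Lam \<sigma> \<tau> has_real_derivative phase3 lam Lam \<sigma> \<tau> x) (at x within {a..b})"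
    unfolding phase2_def[abs_def] phase3_def
    by (rule DERIV_add[OF DERIV_cmult[OF wkb_freq_ratio_deriv[OF x(3)]] DERIV_cmult[OF wkb_freq_ratio_deriv[OF xL]]])
  show k: "((\<lambda>x. k * \<beta> * (\<beta> - 1) * x powr (\<beta> - 2)) has_real_derivative
      k * \<beta> * (\<beta> - 1) * (\<beta> - 2) * x powr (\<beta> - 3)) (at x within {a..b})"
    using pw[of "k * \<beta> * (\<beta> - 1)" "\<beta> - 2"] by (simp add: mult.assoc)
  show "((\<lambda>x. k * \<beta> * (\<beta> - 1) * x powr (\<beta> - 2) - phase2 lam Lam \<sigma> \<tau> x) has_real_derivative
      (k * \<beta> * (\<beta> - 1) * (\<beta> - 2) * x powr (\<beta> - 3) - phase3 lam Lam \<sigma> \<tau> x)) (at x within {a..b})"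
    by (rule DERIV_diff[OF k p])
qed

text \<open>The summand of the smaller eigenvalue dominates, so \<sigma> alone decides the
  sign.\<close>

lemma abs_phase2_le:
  assumes "lam \<le> Lam" "x \<ge> 0" "x\<^sup>2 < lam" "\<sigma> \<in> {1, -1}" "\<tau> \<in> {1, -1}"
  shows "\<bar>phase2 lam Lam \<sigma> \<tau> x\<bar> \<le> 2 * (x / wkb_freq lam x)"
    and "\<sigma> = 1 \<Longrightarrow> phase2 lam Lam \<sigma> \<tau> x \<ge> 0" and "\<sigma> = -1 \<Longrightarrow> phase2 lam Lam \<sigma> \<tau> x \<le> 0"
proof -
  have q: "wkb_freq lam x > 0" using assms(3) by (rule wkb_freq_pos)
  moreover have "wkb_freq lam x \<le> wkb_freq Lam x"
    unfolding wkb_freq_def using assms(1) by simp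
  ultimately have le: "x / wkb_freq Lam x \<le> x / wkb_freq lam x" "0 \<le> x / wkb_freq Lam x"
    using assms(2) by (auto intro!: divide_left_mono mult_pos_pos)
  show "\<bar>phase2 lam Lam \<sigma> \<tau> x\<bar> \<le> 2 * (x / wkb_freq lam x)"
    and "\<sigma> = 1 \<Longrightarrow> phase2 lam Lam \<sigma> \<tau> x \<ge> 0" and "\<sigma> = -1 \<Longrightarrow> phase2 lam Lam \<sigma> \<tau> x \<le> 0"
    using le assms(4,5) unfolding phase2_def by (auto simp: abs_le_iff)
qed

text \<open>
  Where the two eigenphases nearly cancel, their second derivative still grows at the rate of a single
  one, because \<open>\<Lambda> / (\<Lambda> - x\<^sup>2)\<close> decreases in \<open>\<Lambda>\<close>.
\<close>

lemma phase3_ge: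
  assumes "1 \<le> lam" "lam \<le> Lam" "x > 0" "x\<^sup>2 < lam" "\<tau> \<in> {1, -1}"
  shows "phase3 lam Lam 1 \<tau> x \<ge> phase2 lam Lam 1 \<tau> x * (lam / (2 * x * (wkb_freq lam x)\<^sup>2))"
    and "phase3 lam Lam 1 \<tau> x \<ge> 0"
proof -
  define q where "q = wkb_freq lam x"
  define p where "p = wkb_freq Lam x"
  have q: "q > 0" "q\<^sup>2 = lam - x\<^sup>2" unfolding q_def using assms by (auto simp: wkb_freq_pos wkb_freq_sq)
  have p: "p > 0" "p\<^sup>2 = Lam - x\<^sup>2" unfolding p_def using assms by (auto simp: wkb_freq_pos wkb_freq_sq)
  have qp: "q \<le> p" unfolding q_def p_def wkb_freq_def using assms by simp
  have h0: "phase2 lam Lam 1 \<tau> x \<ge> 0"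
    using abs_phase2_le(2)[of lam Lam x 1 \<tau>] assms by simp
  have h: "phase2 lam Lam 1 \<tau> x * (lam / (2 * x * q\<^sup>2)) = 1/2 * (lam / q^3 + \<tau> * (lam / (q\<^sup>2 * p)))"
    unfolding phase2_def q_def[symmetric] p_def[symmetric] using q(1) p(1) assms(3)
    by (simp add: field_simps power2_eq_square power3_eq_cube)
  have l3: "lam / q ^ 3 > 0" "Lam / p ^ 3 > 0" "lam / (q\<^sup>2 * p) > 0" using assms q p by auto
  have pq: "lam / (q\<^sup>2 * p) \<le> lam / q ^ 3"
    using assms q(1) p(1) qp by (intro divide_left_mono) (auto simp: power2_eq_square power3_eq_cube)
  have key: "Lam / p ^ 3 \<le> lam / (q\<^sup>2 * p)"
  proof -
    have "Lam * q\<^sup>2 \<le> lam * p\<^sup>2"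
      unfolding q(2) p(2) right_diff_distrib using assms mult_right_mono[of lam Lam "x\<^sup>2"] by simp
    moreover have "A / P \<le> B / Q" if "A * Q \<le> B * P" "P > 0" "Q > 0" for A B P Q :: real
      using that by (simp add: field_simps)
    ultimately have "Lam / p\<^sup>2 \<le> lam / q\<^sup>2" using q(1) p(1) by simp
    then have "Lam / p\<^sup>2 / p \<le> lam / q\<^sup>2 / p" using p by (intro divide_right_mono) auto
    then show ?thesis by (simp add: power2_eq_square power3_eq_cube mult.assoc)
  qed
  show ge: "phase3 lam Lam 1 \<tau> x \<ge> phase2 lam Lam 1 \<tau> x * (lam / (2 * x * (wkb_freq lam x)\<^sup>2))"
    unfolding q_def[symmetric] h unfolding phase3_def q_def[symmetric] p_def[symmetric]
  proof -
    consider "\<tau> = 1" | "\<tau> = -1" using assms(5) by auto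
    then show "1/2 * (lam / q^3 + \<tau> * (lam / (q\<^sup>2 * p))) \<le> 1 * (lam / q ^ 3) + \<tau> * (Lam / p ^ 3)"
    proof cases
      case 1
      have "1/2 * (A + 1 * B) \<le> 1 * A + 1 * C" if "0 < A" "0 < C" "B \<le> A" for A B C :: real
        using that by simp
      from this[OF l3(1,2) pq] show ?thesis unfolding 1 .
    next
      case 2
      have "1/2 * (A + -1 * B) \<le> 1 * A + -1 * C" if "B \<le> A" "C \<le> B" for A B C :: real
        using that by simp
      from this[OF pq key] show ?thesis unfolding 2 .
    qed
  qed
  have "phase2 lam Lam 1 \<tau> x * (lam / (2 * x * (wkb_freq lam x)\<^sup>2)) \<ge> 0"
    using h0 assms by (intro mult_nonneg_nonneg divide_nonneg_nonneg) auto
  then show "phase3 lam Lam 1 \<tau> x \<ge> 0" using ge by linarith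
qed

lemma phase_integral_convex:
  assumes lam: "1 \<le> lam" "lam \<le> Lam" and ab: "1 \<le> a" "a \<le> b" "b\<^sup>2 < lam" and L: "L > 0"
    and S: "\<And>x. x \<in> {a..b} \<Longrightarrow> (S has_real_derivative wkb_freq lam x) (at x within {a..b})"
    and T: "\<And>x. x \<in> {a..b} \<Longrightarrow> (T has_real_derivative wkb_freq Lam x) (at x within {a..b})"
    and large: "\<And>x. x \<in> {a..b} \<Longrightarrow> k * \<beta> * (\<beta> - 1) * x powr (\<beta> - 2) - phase2 lam Lam \<sigma> \<tau> x \<ge> 1 / L\<^sup>2"
  shows "cmod (osc_integral a b (phase k \<beta> \<sigma> \<tau> S T)) \<le> 8 * L"
proof -
  have x2: "x > 0" "x\<^sup>2 < lam" if "x \<in> {a..b}" for x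
  proof -
    have "x\<^sup>2 \<le> b\<^sup>2" using that ab by (intro power_mono) auto
    then show "x\<^sup>2 < lam" using ab(3) by linarith
    show "x > 0" using ab that by auto
  qed
  show ?thesis
    by (rule second_derivative_test[OF ab(2) L phase_derivs(1)[OF lam(2) _ x2 S T] phase_derivs(2)[OF lam(2) _ x2 S T] large])
qed

text \<open>For \<sigma> = -1 both parts of the second derivative are nonnegative. For \<sigma> = 1
  the interval is cut where \<open>phase2\<close> reaches half of the curvature \<open>r\<close> of
  k x^\<beta>; one cut suffices because \<open>phase2\<close> is nondecreasing and \<open>r\<close>
  nonincreasing. Left of it the second derivative is at least r / 2. Right of it
  \<open>phase3\<close> is large, and it acts with the same sign as the third derivative of k
  x^\<beta>, which is nonpositive for \<beta> \<le> 2. Hence 8 + 18.\<close>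

lemma phase_integral_le:
  assumes lam: "1 \<le> lam" "lam \<le> Lam" and ab: "1 \<le> a" "a \<le> b" "b\<^sup>2 < lam" and L: "L > 0"
    and S: "\<And>x. x \<in> {a..b} \<Longrightarrow> (S has_real_derivative wkb_freq lam x) (at x within {a..b})"
    and T: "\<And>x. x \<in> {a..b} \<Longrightarrow> (T has_real_derivative wkb_freq Lam x) (at x within {a..b})"
    and st: "\<sigma> \<in> {1, -1}" "\<tau> \<in> {1, -1}"
    and k: "k > 0" and \<beta>: "1 < \<beta>" "\<beta> \<le> 2"
    and \<delta>: "\<delta> > 0" "\<And>x. x \<in> {a..b} \<Longrightarrow> (wkb_freq lam x)\<^sup>2 \<le> \<delta> * lam"
    and L2: "k * \<beta> * (\<beta> - 1) * lam powr ((\<beta> - 2) / 2) \<ge> 2 / L\<^sup>2"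
    and L3: "k * \<beta> * (\<beta> - 1) * lam powr ((\<beta> - 2) / 2) \<ge> 4 * sqrt lam * \<delta> / L ^ 3"
  shows "cmod (osc_integral a b (phase k \<beta> \<sigma> \<tau> S T)) \<le> 26 * L"
proof -
  define p0 where "p0 = k * \<beta> * (\<beta> - 1) * lam powr ((\<beta> - 2) / 2)"
  define r where "r = (\<lambda>x. k * \<beta> * (\<beta> - 1) * x powr (\<beta> - 2))"
  have \<kappa>: "k * \<beta> * (\<beta> - 1) > 0" using k \<beta> by simp
  have p0: "p0 > 0" unfolding p0_def using \<kappa> lam by simp
  have x2: "x > 0" "x\<^sup>2 < lam" if "x \<in> {a..b}" for x
  proof -
    have "x\<^sup>2 \<le> b\<^sup>2" using that ab by (intro power_mono) auto
    then show "x\<^sup>2 < lam" using ab(3) by linarith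
    show "x > 0" using ab that by auto
  qed
  have xs: "x \<le> sqrt lam" if "x \<in> {a..b}" for x
    using x2[OF that] by (simp add: real_le_rsqrt)
  have r: "r x \<ge> p0" if x: "x \<in> {a..b}" for x
  proof -
    have "lam powr ((\<beta> - 2) / 2) = (sqrt lam) powr (\<beta> - 2)"
      using lam by (simp add: powr_half_sqrt[symmetric] powr_powr)
    also have "\<dots> \<le> x powr (\<beta> - 2)"
      using \<beta> xs[OF x] x2[OF x] by (intro powr_mono2') auto
    finally show ?thesis unfolding r_def p0_def using \<kappa> by (intro mult_left_mono) auto
  qed
  have cvx: "cmod (osc_integral s t (phase k \<beta> \<sigma> \<tau> S T)) \<le> 8 * L"
    if "a \<le> s" "s \<le> t" "t \<le> b" and le: "\<forall>x\<in>{s..t}. phase2 lam Lam \<sigma> \<tau> x \<le> r x / 2" for s t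
  proof (rule phase_integral_convex[OF lam _ \<open>s \<le> t\<close> _ L])
    show "1 \<le> s" using that ab by simp
    show "t\<^sup>2 < lam" using x2(2)[of t] that by simp
    show "(S has_real_derivative wkb_freq lam x) (at x within {s..t})" if "x \<in> {s..t}" for x
      using S[of x] that \<open>a \<le> s\<close> \<open>t \<le> b\<close> by (auto intro: DERIV_subset)
    show "(T has_real_derivative wkb_freq Lam x) (at x within {s..t})" if "x \<in> {s..t}" for x
      using T[of x] that \<open>a \<le> s\<close> \<open>t \<le> b\<close> by (auto intro: DERIV_subset)
    fix x assume x: "x \<in> {s..t}"
    then have "r x \<ge> p0" using r that by auto
    moreover have "p0 / 2 \<ge> 1 / L\<^sup>2" using L2 unfolding p0_def by simp
    moreover have "phase2 lam Lam \<sigma> \<tau> x \<le> r x / 2" using le x by blast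
    moreover have "r x = k * \<beta> * (\<beta> - 1) * x powr (\<beta> - 2)" by (simp add: r_def)
    ultimately show "k * \<beta> * (\<beta> - 1) * x powr (\<beta> - 2) - phase2 lam Lam \<sigma> \<tau> x \<ge> 1 / L\<^sup>2"
      by linarith
  qed
  show ?thesis
  proof (cases "\<sigma> = 1")
    case False
    then have "\<sigma> = -1" using st by auto
    have "phase2 lam Lam \<sigma> \<tau> x \<le> r x / 2" if x: "x \<in> {a..b}" for x
    proof -
      have "phase2 lam Lam \<sigma> \<tau> x \<le> 0"
        using abs_phase2_le(3)[OF lam(2) _ x2(2)[OF x] st \<open>\<sigma> = -1\<close>] x2(1)[OF x] by simp
      then show ?thesis using r[OF x] p0 by linarith
    qed
    then show ?thesis using cvx[of a b] ab L by fastforce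
  next
    case True
    define g where "g = (\<lambda>x. phase2 lam Lam \<sigma> \<tau> x - 1/2 * r x)"
    define g' where "g' = (\<lambda>x. phase3 lam Lam \<sigma> \<tau> x - 1/2 * (k * \<beta> * (\<beta> - 1) * (\<beta> - 2) * x powr (\<beta> - 3)))"
    have dg: "(g has_real_derivative g' x) (at x within {a..b})" if x: "x \<in> {a..b}" for x
      unfolding g_def g'_def r_def
      by (rule DERIV_diff[OF phase_derivs(4)[OF lam(2) x x2[OF x] S[OF x] T[OF x]]
            DERIV_cmult[OF phase_derivs(5)[OF lam(2) x x2[OF x] S[OF x] T[OF x]]]])
    have r': "k * \<beta> * (\<beta> - 1) * (\<beta> - 2) * x powr (\<beta> - 3) \<le> 0" if "x \<in> {a..b}" for x
      using \<kappa> \<beta> by (intro mult_nonpos_nonneg mult_nonneg_nonpos) auto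
    have p3: "phase3 lam Lam \<sigma> \<tau> x \<ge> 0" if x: "x \<in> {a..b}" for x
      using phase3_ge(2)[OF lam x2[OF x] st(2)] True by simp
    obtain c where c: "a \<le> c" "c \<le> b" "c = a \<or> (\<forall>x\<in>{a..c}. g x \<le> 0)" "c = b \<or> (\<forall>x\<in>{c..b}. g x \<ge> 0)"
    proof (rule sign_change_point[OF ab(2) dg])
      show "g' x \<ge> 0" if "x \<in> {a..b}" for x
        using p3[OF that] r'[OF that] by (simp add: g'_def)
    qed
    have 1: "cmod (osc_integral a c (phase k \<beta> \<sigma> \<tau> S T)) \<le> 8 * L"
    proof (cases "c = a")
      case False
      then show ?thesis using c by (intro cvx) (auto simp: g_def)
    qed (use L in auto)
    have 2: "cmod (osc_integral c b (phase k \<beta> \<sigma> \<tau> S T)) \<le> 18 * L"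
    proof (cases "c = b")
      case False
      have sub: "x \<in> {a..b}" if "x \<in> {c..b}" for x using that c by auto
      have D: "((\<lambda>x. - f x) has_real_derivative - D) (at x within {c..b})"
        if "(f has_real_derivative D) (at x within {a..b})" for f D x
        using that c(1) by (intro DERIV_minus) (auto intro: DERIV_subset)
      note pd = phase_derivs[OF lam(2) sub x2[OF sub] S[OF sub] T[OF sub]]
      have "cmod (osc_integral c b (\<lambda>x. - (k * x powr \<beta> + \<sigma> * S x + \<tau> * T x))) \<le> 18 * L"
      proof (rule third_derivative_test[OF c(2) L D[OF pd(1)] D[OF pd(2)] D[OF pd(3)]])
        fix x assume x: "x \<in> {c..b}"
        note xa = sub[OF x]
        have h: "phase2 lam Lam \<sigma> \<tau> x \<ge> p0 / 2"
          using c(4) False x r[OF xa] unfolding g_def by fastforce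
        have "phase3 lam Lam \<sigma> \<tau> x \<ge> phase2 lam Lam \<sigma> \<tau> x * (lam / (2 * x * (wkb_freq lam x)\<^sup>2))"
          using phase3_ge(1)[OF lam x2[OF xa] st(2)] True by simp
        \<comment> \<open>By x \<le> \<surd>\<open>lam\<close> and q^2 \<le> \<delta>
          \<open>lam\<close>, the lower bound for the ratio of \<open>phase3\<close> to
          \<open>phase2\<close> is at least 1 / (2 \<surd>\<open>lam\<close> \<delta>): the third
          derivative gains as the piece approaches the turning point.\<close>
        moreover have "p0 / 2 * (lam / (2 * sqrt lam * (\<delta> * lam))) \<le> phase2 lam Lam \<sigma> \<tau> x * (lam / (2 * x * (wkb_freq lam x)\<^sup>2))"
        proof (rule mult_mono[OF h])
          have "2 * x * (wkb_freq lam x)\<^sup>2 \<le> 2 * sqrt lam * (\<delta> * lam)"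
            using xs[OF xa] \<delta>(2)[OF xa] x2[OF xa] lam by (intro mult_mono) auto
          moreover have "0 < 2 * x * (wkb_freq lam x)\<^sup>2"
            using x2[OF xa] wkb_freq_pos[OF x2(2)[OF xa]] by simp
          ultimately show "lam / (2 * sqrt lam * (\<delta> * lam)) \<le> lam / (2 * x * (wkb_freq lam x)\<^sup>2)"
            using lam \<delta>(1) x2(1)[OF xa] by (intro divide_left_mono mult_pos_pos) auto
        qed (use h p0 lam \<delta>(1) in auto)
        moreover have "p0 / 2 * (lam / (2 * sqrt lam * (\<delta> * lam))) = p0 / (4 * sqrt lam * \<delta>)"
          using lam by simp
        moreover have "p0 / (4 * sqrt lam * \<delta>) \<ge> 1 / L ^ 3"
        proof -
          have "4 * sqrt lam * \<delta> / L ^ 3 / (4 * sqrt lam * \<delta>) \<le> p0 / (4 * sqrt lam * \<delta>)"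
            using L3 lam \<delta>(1) unfolding p0_def by (intro divide_right_mono) auto
          moreover have "4 * sqrt lam * \<delta> / L ^ 3 / (4 * sqrt lam * \<delta>) = 1 / L ^ 3"
            using lam \<delta>(1) by simp
          ultimately show ?thesis by simp
        qed
        ultimately show "- (k * \<beta> * (\<beta> - 1) * (\<beta> - 2) * x powr (\<beta> - 3) - phase3 lam Lam \<sigma> \<tau> x) \<ge> 1 / L ^ 3"
          using r'[OF xa] by linarith
      qed
      then show ?thesis by (simp only: cmod_integral_cis_uminus)
    qed (use L in auto)
    have cont: "continuous_on {a..b} (phase k \<beta> \<sigma> \<tau> S T)"
      by (rule DERIV_continuous_on, rule phase_derivs(1)[OF lam(2) _ x2 S T])
    have i: "(\<lambda>x. exp (\<i> * complex_of_real (k * x powr \<beta> + \<sigma> * S x + \<tau> * T x))) integrable_on {a..b}"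
      by (intro integrable_continuous_interval continuous_intros cont)
    \<comment> \<open>The middle piece is the single point \<open>c\<close>.\<close>
    have "cmod (osc_integral a b (phase k \<beta> \<sigma> \<tau> S T)) \<le> 8 * L + 0 + 18 * L"
      by (rule cmod_integral_combine_three[OF c(1) order_refl c(2) i 1 _ 2]) simp
    then show ?thesis by simp
  qed
qed

section \<open>The half-line bound\<close>

lemma set_integral_split_ray:
  fixes f :: "real \<Rightarrow> complex"
  assumes int: "set_integrable lborel {a..} f" and "a \<le> b"
  shows "(LINT x:{a..}|lborel. f x) = integral {a..b} f + (LINT x:{b..}|lborel. f x)"
proof -
  have i1: "set_integrable lborel {a..b} f"
    by (rule set_integrable_subset[OF int]) auto
  have i2: "set_integrable lborel {b..} f"
    by (rule set_integrable_subset[OF int]) (use \<open>a \<le> b\<close> in auto)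
  have "AE x in lborel. x \<noteq> b" by (rule AE_lborel_singleton)
  then have "AE x in lborel. \<not> (x \<in> {a..b} \<and> x \<in> {b..})" by eventually_elim auto
  then have "(LINT x:{a..b} \<union> {b..}|lborel. f x) = (LINT x:{a..b}|lborel. f x) + (LINT x:{b..}|lborel. f x)"
    by (rule set_integral_Un_AE) (use i1 i2 in auto)
  moreover have "{a..b} \<union> {b..} = {a..}" using \<open>a \<le> b\<close> by auto
  ultimately show ?thesis using set_borel_integral_eq_integral(2)[OF i1] by simp
qed

lemma set_integral_cmod_le:
  fixes f :: "real \<Rightarrow> complex"
  assumes "set_integrable lborel A f" "set_integrable lborel A g" "\<And>x. x \<in> A \<Longrightarrow> cmod (f x) \<le> g x"
  shows "cmod (LINT x:A|lborel. f x) \<le> (LINT x:A|lborel. g x)"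
  unfolding set_lebesgue_integral_def
proof (rule Bochner_Integration.integral_norm_bound_integral)
  show "integrable lborel (\<lambda>x. indicator A x *\<^sub>R f x)" "integrable lborel (\<lambda>x. indicator A x *\<^sub>R g x)"
    using assms by (auto simp: set_integrable_def)
  show "norm (indicator A x *\<^sub>R f x) \<le> indicator A x *\<^sub>R g x" for x
    using assms(3)[of x] by (auto split: split_indicator)
qed

definition trivial_const :: "real \<Rightarrow> real" where
  "trivial_const \<mu> = 4 * sqrt (2 * 2 powr \<mu> + 4 * tail_const \<mu>)"

text \<open>Large enough for both ranges of \<beta>. Center and interior need 9988 = 4 + 3 * 3328
  for \<beta> \<le> 2 and 1028 = 4 + 1024 for \<beta> > 2. The second term is the edge, and the last
  one covers decay factors of at least 1/4 by the trivial bound.\<close>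

definition half_line_const :: "real \<Rightarrow> real" where
  "half_line_const \<mu> = 10000 * 2 powr (\<mu> / 2) + 4 * sqrt (24 * tail_const \<mu>) + 4 * trivial_const \<mu>"

lemma trivial_const_nonneg: "trivial_const \<mu> \<ge> 0"
  unfolding trivial_const_def using tail_const_pos[of \<mu>] by simp

section \<open>The integrand on the half line: center, middle and edge\<close>

context oscillator_pair
begin

definition integrand :: "real \<Rightarrow> real \<Rightarrow> real \<Rightarrow> real \<Rightarrow> complex" where
  "integrand \<mu> k \<beta> x = complex_of_real (weight \<mu> x) * exp (\<i> * complex_of_real (k * \<bar>x\<bar> powr \<beta>))
     * complex_of_real (u x) * complex_of_real (v x)"

lemma integrand_integrable:
  assumes "\<beta> > 1" "X \<ge> 0"
  shows "set_integrable lborel {X..} (integrand \<mu> k \<beta>)"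
proof -
  have "continuous_on UNIV (\<lambda>x::real. \<bar>x\<bar> powr \<beta>)"
    using assms by (intro continuous_on_powr' continuous_intros) auto
  then have "continuous_on UNIV (\<lambda>x::real. exp (\<i> * complex_of_real (k * \<bar>x\<bar> powr \<beta>)))"
    by (intro continuous_on_exp continuous_on_mult continuous_on_const continuous_on_of_real)
  from integrable_product(1)[OF this _ assms(2)] show ?thesis unfolding integrand_def by simp
qed

lemma integrand_norm: "cmod (integrand \<mu> k \<beta> x) = weight \<mu> x * \<bar>u x\<bar> * \<bar>v x\<bar>"
  using weight_pos[of \<mu> x] by (simp add: integrand_def norm_mult)

lemma integrand_tail_le:
  assumes "\<beta> > 1" "X \<ge> 0"
  shows "cmod (LINT x:{X..}|lborel. integrand \<mu> k \<beta> x) \<le> (LINT x:{X..}|lborel. weight \<mu> x * \<bar>u x\<bar> * \<bar>v x\<bar>)"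
  using assms by (intro set_integral_cmod_le integrand_integrable integrable_product(2)[of "\<lambda>_. 0"]) (auto simp: integrand_norm)

lemma trivial_bound:
  assumes "\<mu> \<ge> 0" "\<beta> > 1"
  shows "cmod (LINT x:{0..}|lborel. integrand \<mu> k \<beta> x) \<le> trivial_const \<mu> * (lam powr (\<mu> / 2) * \<rho>)"
  using order_trans[OF integrand_tail_le[OF assms(2) order_refl] product_total_le[OF assms(1)]]
  by (simp add: trivial_const_def mult.assoc)

lemma center_bound:
  assumes "\<mu> \<ge> 0" "\<beta> > 1" "lam \<ge> 2"
  shows "cmod (integral {0..1} (integrand \<mu> k \<beta>)) \<le> 4 * 2 powr (\<mu> / 2) * \<rho> * lam powr (- 1/2)"
proof -
  have i: "set_integrable lborel {0..1} (integrand \<mu> k \<beta>)"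
    by (rule set_integrable_subset[OF integrand_integrable[of \<beta> 0]]) (use assms in auto)
  have "cmod (LINT x:{0..1}|lborel. integrand \<mu> k \<beta> x) \<le> (LINT x:{0..1}|lborel. weight \<mu> x * \<bar>u x\<bar> * \<bar>v x\<bar>)"
    by (intro set_integral_cmod_le i set_integrable_subset[OF integrable_product(2)[of "\<lambda>_. 0" 0]])
      (auto simp: integrand_norm)
  then show ?thesis
    using product_center_le[OF assms(1,3)] set_borel_integral_eq_integral(2)[OF i] by simp
qed

lemma edge_bound:
  assumes "\<mu> \<ge> 0" "\<beta> > 1" "0 < \<delta>" "\<delta> \<le> 3/4" "\<delta> ^ 3 * lam\<^sup>2 \<ge> 1"
  shows "cmod (LINT x:{edge lam \<delta>..}|lborel. integrand \<mu> k \<beta> x)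
    \<le> 4 * sqrt (24 * tail_const \<mu>) * lam powr (\<mu> / 2) * \<rho> * \<delta> powr (1/4)"
  using integrand_tail_le[OF assms(2) edge_properties(1)[OF assms(3-5)]] product_edge_le[OF assms(1,3-5)]
  by (rule order_trans)

text \<open>The amplitude 1 / q is largest at the edge, where q = \<surd>(\<delta>
  \<open>lam\<close>).\<close>

lemma middle_bound:
  assumes \<mu>: "\<mu> \<ge> 0" and \<delta>: "0 < \<delta>" "\<delta> \<le> 3/4" "\<delta> ^ 3 * lam\<^sup>2 \<ge> 1"
    and a: "1 \<le> a" "a \<le> edge lam \<delta>"
    and V: "\<And>S T \<sigma> \<tau> t. (\<And>x. x \<in> {a..edge lam \<delta>} \<Longrightarrow> (S has_real_derivative wkb_freq lam x) (at x within {a..edge lam \<delta>})) \<Longrightarrow>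
       (\<And>x. x \<in> {a..edge lam \<delta>} \<Longrightarrow> (T has_real_derivative wkb_freq Lam x) (at x within {a..edge lam \<delta>})) \<Longrightarrow>
       \<sigma> \<in> {1, -1} \<Longrightarrow> \<tau> \<in> {1, -1} \<Longrightarrow> t \<in> {a..edge lam \<delta>} \<Longrightarrow>
       cmod (osc_integral a t (phase k \<beta> \<sigma> \<tau> S T)) \<le> V"
  shows "cmod (integral {a..edge lam \<delta>} (integrand \<mu> k \<beta>)) \<le> 64 * 2 powr (\<mu> / 2) * (lam powr (\<mu> / 2) * \<rho>) * (V / sqrt (\<delta> * lam))"
proof -
  define b where "b = edge lam \<delta>"
  note e = edge_properties[OF \<delta>, folded b_def]
  have l: "lam \<ge> 1" using u.lam_ge .
  have cont: "continuous_on {a..b} (\<lambda>x. k * x powr \<beta>)"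
    using a by (intro continuous_intros) auto
  have "integral {a..b} (integrand \<mu> k \<beta>) = integral {a..b} (\<lambda>x. complex_of_real (weight \<mu> x) * exp (\<i> * complex_of_real (k * x powr \<beta>))
      * complex_of_real (u x) * complex_of_real (v x))"
    using a by (intro Henstock_Kurzweil_Integration.integral_cong) (auto simp: integrand_def)
  also have "cmod \<dots> \<le> 64 * V * \<rho> * weight \<mu> b / wkb_freq lam b"
    using a e unfolding b_def[symmetric]
    by (intro interior_piece_le \<mu> cont V[folded b_def]) auto
  also have "wkb_freq lam b = sqrt (\<delta> * lam)"
    using e(4,5) real_sqrt_unique[of "wkb_freq lam b" "\<delta> * lam"] by simp
  also have "64 * V * \<rho> * weight \<mu> b / sqrt (\<delta> * lam) = 64 * \<rho> * (V / sqrt (\<delta> * lam)) * weight \<mu> b" by simp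
  also have "\<dots> \<le> 64 * \<rho> * (V / sqrt (\<delta> * lam)) * (2 powr (\<mu> / 2) * lam powr (\<mu> / 2))"
  proof (intro mult_left_mono weight_le_lam \<mu> l)
    show "b\<^sup>2 \<le> lam" using e(2) by simp
    \<comment> \<open>Antiderivatives are produced here in order to instantiate the assumption on
      \<open>V\<close> and to read off that \<open>V\<close> is nonnegative.\<close>
    obtain S where S: "\<And>x. x \<in> {a..b} \<Longrightarrow> (S has_real_derivative wkb_freq lam x) (at x within {a..b})"
    proof -
      have "continuous_on {a..b} (wkb_freq lam)"
        unfolding wkb_freq_def by (intro continuous_intros)
      from antiderivative_continuous[OF this] show ?thesis
        using that by (auto simp: has_real_derivative_iff_has_vector_derivative)
    qed
    obtain T where T: "\<And>x. x \<in> {a..b} \<Longrightarrow> (T has_real_derivative wkb_freq Lam x) (at x within {a..b})"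
    proof -
      have "continuous_on {a..b} (wkb_freq Lam)"
        unfolding wkb_freq_def by (intro continuous_intros)
      from antiderivative_continuous[OF this] show ?thesis
        using that by (auto simp: has_real_derivative_iff_has_vector_derivative)
    qed
    have "V \<ge> 0"
      using order_trans[OF norm_ge_zero V[folded b_def, OF S T, of 1 1 a]] a by (simp add: b_def)
    then show "0 \<le> 64 * \<rho> * (V / sqrt (\<delta> * lam))" using \<rho>_pos \<delta> l by simp
  qed
  finally show ?thesis by (simp add: b_def mult_ac)
qed

text \<open>Piece \<open>i\<close> ends at \<delta> = y^(4 + 2i), where the amplitude costs 1 /
  (y^(2 + i) \<surd>\<open>lam\<close>), so \<open>L\<close> of order y^(4 + i)
  \<surd>\<open>lam\<close> produces y^2. By \<open>p\<close>, the two size conditions of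
  \<open>phase_integral_le\<close> reduce to 8 + 2i \<le> 12, which is \<open>i \<le> 2\<close>, and
  to \<delta>' \<le> 2 y^(3i), which says how far from the turning point the piece may
  begin.\<close>

lemma small_beta_piece:
  assumes \<mu>: "\<mu> \<ge> 0" and k: "k > 0" and \<beta>: "1 < \<beta>" "\<beta> \<le> 2"
    and y: "0 < y" "y \<le> 1" "y ^ 4 \<le> 3/4" "y ^ 12 * lam \<ge> 1"
    and p: "k * \<beta> * (\<beta> - 1) * lam powr ((\<beta> - 2) / 2) * (y ^ 12 * lam) \<ge> 1"
    and i: "i \<le> 2" and \<delta>': "0 < \<delta>'" "\<delta>' \<le> 2 * y ^ (3 * i)"
    and a: "1 \<le> a" "a \<le> edge lam (y ^ (4 + 2 * i))"
    and q: "\<And>x. x \<ge> a \<Longrightarrow> x \<le> edge lam (y ^ (4 + 2 * i)) \<Longrightarrow> (wkb_freq lam x)\<^sup>2 \<le> \<delta>' * lam"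
  shows "cmod (integral {a..edge lam (y ^ (4 + 2 * i))} (integrand \<mu> k \<beta>)) \<le> 3328 * 2 powr (\<mu> / 2) * (lam powr (\<mu> / 2) * \<rho>) * y\<^sup>2"
proof -
  have l: "lam \<ge> 1" using u.lam_ge .
  define \<delta> where "\<delta> = y ^ (4 + 2 * i)"
  define L where "L = 2 * y ^ (4 + i) * sqrt lam"
  define p0 where "p0 = k * \<beta> * (\<beta> - 1) * lam powr ((\<beta> - 2) / 2)"
  have L: "L > 0" using y l by (simp add: L_def)
  have \<delta>0: "\<delta> > 0" using y by (simp add: \<delta>_def)
  have "y ^ (4 + 2 * i) \<le> y ^ 4" using y by (intro power_decreasing) auto
  then have \<delta>1: "\<delta> \<le> 3/4" using y by (simp add: \<delta>_def)
  have \<delta>3: "\<delta> ^ 3 * lam\<^sup>2 \<ge> 1"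
  proof -
    have "1 \<le> (y ^ 12 * lam)\<^sup>2" using y(4) by (simp add: one_le_power)
    also have "\<dots> = y ^ 24 * lam\<^sup>2" by (simp add: power_mult_distrib power_mult[symmetric])
    also have "\<dots> \<le> y ^ ((4 + 2 * i) * 3) * lam\<^sup>2"
      using y i by (intro mult_right_mono power_decreasing) auto
    finally show ?thesis unfolding \<delta>_def by (simp only: power_mult)
  qed
  have ylam: "0 < y ^ 12 * lam" using y l by simp
  have p0: "1 / (y ^ 12 * lam) \<le> p0"
    using p ylam unfolding p0_def by (simp add: pos_divide_le_eq)
  have c2: "p0 \<ge> 2 / L\<^sup>2"
  proof -
    have "y ^ 12 \<le> y ^ (8 + 2 * i)" using y i by (intro power_decreasing) auto
    also have "\<dots> \<le> 2 * y ^ (8 + 2 * i)" using y by simp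
    finally have "y ^ 12 * lam \<le> 2 * y ^ (8 + 2 * i) * lam" using l by (intro mult_right_mono) auto
    also have "\<dots> = L\<^sup>2 / 2"
      using l by (simp add: L_def power_mult_distrib power_add power_mult[symmetric] mult.commute)
    finally have "1 / (L\<^sup>2 / 2) \<le> 1 / (y ^ 12 * lam)" using ylam L by (intro divide_left_mono) auto
    then show ?thesis using p0 by simp
  qed
  have c3: "p0 \<ge> 4 * sqrt lam * \<delta>' / L ^ 3"
  proof -
    have "L ^ 3 = 8 * (y ^ 12 * y ^ (3 * i)) * (sqrt lam) ^ 3"
      by (simp add: L_def power_mult_distrib power_add power_mult[symmetric] mult.commute)
    also have "(sqrt lam) ^ 3 = lam * sqrt lam" using l by (simp add: power3_eq_cube)
    finally have L3: "L ^ 3 = 8 * (y ^ 12 * y ^ (3 * i)) * (lam * sqrt lam)" .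
    have yi: "y ^ (3 * i) > 0" using y by simp
    have "4 * sqrt lam * \<delta>' / L ^ 3 = (\<delta>' / (2 * y ^ (3 * i))) * (1 / (y ^ 12 * lam))"
      unfolding L3 using l y by (simp add: field_simps)
    also have "\<dots> \<le> 1 * (1 / (y ^ 12 * lam))"
      using \<delta>' yi ylam by (intro mult_right_mono) auto
    finally show ?thesis using p0 by simp
  qed
  have e2: "(edge lam \<delta>)\<^sup>2 < lam" using edge_properties(2)[OF \<delta>0 \<delta>1 \<delta>3] .
  have "cmod (integral {a..edge lam \<delta>} (integrand \<mu> k \<beta>)) \<le> 64 * 2 powr (\<mu> / 2) * (lam powr (\<mu> / 2) * \<rho>) * (26 * L / sqrt (\<delta> * lam))"
  proof (rule middle_bound[OF \<mu> \<delta>0 \<delta>1 \<delta>3])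
    show "1 \<le> a" "a \<le> edge lam \<delta>" using a by (auto simp: \<delta>_def)
    fix S T and \<sigma> \<tau> t :: real
    assume S: "\<And>x. x \<in> {a..edge lam \<delta>} \<Longrightarrow> (S has_real_derivative wkb_freq lam x) (at x within {a..edge lam \<delta>})"
      and T: "\<And>x. x \<in> {a..edge lam \<delta>} \<Longrightarrow> (T has_real_derivative wkb_freq Lam x) (at x within {a..edge lam \<delta>})"
      and st: "\<sigma> \<in> {1, -1}" "\<tau> \<in> {1, -1}" and t: "t \<in> {a..edge lam \<delta>}"
    show "cmod (osc_integral a t (phase k \<beta> \<sigma> \<tau> S T)) \<le> 26 * L"
    proof (rule phase_integral_le[OF l lam_le_Lam a(1) _ _ L _ _ st k \<beta> \<delta>'(1) _ c2[unfolded p0_def] c3[unfolded p0_def]])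
      show "a \<le> t" using t by simp
      have "t\<^sup>2 \<le> (edge lam \<delta>)\<^sup>2" using t a by (intro power_mono) auto
      then show "t\<^sup>2 < lam" using e2 by linarith
      show "(S has_real_derivative wkb_freq lam x) (at x within {a..t})" if "x \<in> {a..t}" for x
        using S[of x] that t by (auto intro: DERIV_subset)
      show "(T has_real_derivative wkb_freq Lam x) (at x within {a..t})" if "x \<in> {a..t}" for x
        using T[of x] that t by (auto intro: DERIV_subset)
      show "(wkb_freq lam x)\<^sup>2 \<le> \<delta>' * lam" if "x \<in> {a..t}" for x
        using q[of x] that t by (simp add: \<delta>_def)
    qed
  qed
  \<comment> \<open>With \<open>L\<close> containing a factor 2 this is 52, and 64 * 52 =
    3328.\<close>
  also have "26 * L / sqrt (\<delta> * lam) = 52 * y\<^sup>2"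
  proof -
    have "sqrt \<delta> = y ^ (2 + i)"
    proof (rule real_sqrt_unique)
      have "(2 + i) * 2 = 4 + 2 * i" by simp
      then show "(y ^ (2 + i))\<^sup>2 = \<delta>" unfolding \<delta>_def by (metis power_mult)
    qed (use y in simp)
    then have "26 * L / sqrt (\<delta> * lam) = 52 * (y ^ (4 + i) / y ^ (2 + i))"
      using l by (simp add: L_def real_sqrt_mult)
    also have "y ^ (4 + i) / y ^ (2 + i) = y\<^sup>2" using y by (simp add: power_add field_simps power2_eq_square power4_eq_xxxx)
    finally show ?thesis .
  qed
  finally show ?thesis by (simp add: \<delta>_def mult_ac)
qed

lemma edge_mono: "lam \<ge> 0 \<Longrightarrow> \<delta> \<le> \<delta>' \<Longrightarrow> edge lam \<delta>' \<le> edge lam \<delta>"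
  unfolding edge_def by (simp add: mult_left_mono)

text \<open>
  The cuts at \<open>\<delta> = y\<^sup>4, y\<^sup>6, y\<^sup>8\<close> are chosen such that each of the three interior pieces and the edge
  contribute \<open>O(y\<^sup>2)\<close>.
\<close>

lemma small_beta_bound:
  assumes \<mu>: "\<mu> \<ge> 0" and k: "k > 0" and \<beta>: "1 < \<beta>" "\<beta> \<le> 2"
    and y: "0 < y" "y \<le> 1" "y ^ 4 \<le> 3/4" "y ^ 12 * lam \<ge> 1" and lam4: "lam \<ge> 4"
    and p: "k * \<beta> * (\<beta> - 1) * lam powr ((\<beta> - 2) / 2) * (y ^ 12 * lam) \<ge> 1"
  shows "cmod (LINT x:{0..}|lborel. integrand \<mu> k \<beta> x) \<le> half_line_const \<mu> * (lam powr (\<mu> / 2) * \<rho>) * y\<^sup>2"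
proof -
  define B where "B = lam powr (\<mu> / 2) * \<rho>"
  have l: "lam \<ge> 1" using u.lam_ge .
  have B: "B > 0" "B \<ge> \<rho>"
  proof -
    show "B > 0" using \<rho>_pos l by (simp add: B_def)
    have "1 \<le> lam powr (\<mu> / 2)" using l \<mu> by (simp add: ge_one_powr_ge_zero)
    then show "B \<ge> \<rho>" unfolding B_def using \<rho>_pos mult_right_mono[of 1 "lam powr (\<mu> / 2)" \<rho>] by simp
  qed
  define X where "X = (\<lambda>i. edge lam (y ^ (4 + 2 * i)))"
  have XE: "X i = edge lam (y ^ (4 + 2 * i))" for i by (simp add: X_def)
  have yy: "y ^ (4 + 2 * i) \<le> y ^ (4 + 2 * j)" if "j \<le> i" for i j
    using y that by (intro power_decreasing) auto
  have X1: "1 \<le> X 0"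
  proof -
    have "4 * (1/4) \<le> lam * (1 - y ^ 4)" using lam4 y by (intro mult_mono) auto
    then show ?thesis unfolding X_def edge_def by simp
  qed
  have Xm: "X j \<le> X i" if "j \<le> i" for i j
    unfolding X_def using yy[OF that] l by (intro edge_mono) auto
  have qX: "(wkb_freq lam x)\<^sup>2 \<le> y ^ (4 + 2 * j) * lam" if x: "X j \<le> x" "x \<le> X i" "j \<le> i" for x i j
  proof -
    have y1: "y ^ (4 + 2 * n) \<le> 1" for n using y by (intro power_le_one) auto
    have "X j \<ge> 0" using X1 Xm[of 0 j] by simp
    then have "(X j)\<^sup>2 \<le> x\<^sup>2" "x\<^sup>2 \<le> (X i)\<^sup>2" using x by (auto intro!: power_mono)
    moreover have "(X n)\<^sup>2 = lam * (1 - y ^ (4 + 2 * n))" for n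
      unfolding X_def using l y1 by (intro edge_sq) auto
    moreover have "lam * (1 - y ^ (4 + 2 * i)) \<le> lam" using l y by simp
    ultimately have "x\<^sup>2 \<le> lam" "lam * (1 - y ^ (4 + 2 * j)) \<le> x\<^sup>2" by (metis order_trans, simp)
    then show ?thesis by (simp add: wkb_freq_sq algebra_simps)
  qed
  have fi: "set_integrable lborel {x..} (integrand \<mu> k \<beta>)" if "x \<ge> 0" for x
    using that \<beta> by (intro integrand_integrable) auto
  have X0: "X i \<ge> 0" for i using X1 Xm[of 0 i] by simp
  have split: "(LINT x:{0..}|lborel. integrand \<mu> k \<beta> x) =
    integral {0..1} (integrand \<mu> k \<beta>) + (integral {1..X 0} (integrand \<mu> k \<beta>) + (integral {X 0..X 1} (integrand \<mu> k \<beta>)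
     + (integral {X 1..X 2} (integrand \<mu> k \<beta>) + (LINT x:{X 2..}|lborel. integrand \<mu> k \<beta> x))))"
    using set_integral_split_ray[OF fi, of 0 1] set_integral_split_ray[OF fi, of 1 "X 0"]
      set_integral_split_ray[OF fi[OF X0], of 0 "X 1"] set_integral_split_ray[OF fi[OF X0], of 1 "X 2"] X1 Xm[of 0 1] Xm[of 1 2]
    by simp
  have b0: "cmod (integral {0..1} (integrand \<mu> k \<beta>)) \<le> 4 * 2 powr (\<mu> / 2) * B * y\<^sup>2"
  proof -
    \<comment> \<open>The condition y^12 \<open>lam\<close> \<ge> 1 bounds the left side by
      y^6.\<close>
    have "lam powr (- 1/2) \<le> y\<^sup>2"
    proof -
      have "1 \<le> sqrt (y ^ 12 * lam)" using y(4) by simp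
      also have "\<dots> = y ^ 6 * sqrt lam"
      proof -
        have "sqrt (y ^ 12) = y ^ 6"
          by (rule real_sqrt_unique) (use y in \<open>auto simp: power_mult[symmetric]\<close>)
        then show ?thesis by (simp add: real_sqrt_mult)
      qed
      also have "\<dots> \<le> y\<^sup>2 * sqrt lam" using y l by (intro mult_right_mono power_decreasing) auto
      finally have "1 / sqrt lam \<le> y\<^sup>2" using l by (simp add: pos_divide_le_eq)
      then show ?thesis using l by (simp add: powr_minus_divide powr_half_sqrt)
    qed
    then have "4 * 2 powr (\<mu> / 2) * \<rho> * lam powr (- 1/2) \<le> 4 * 2 powr (\<mu> / 2) * B * y\<^sup>2"
      using B \<rho>_pos by (intro mult_mono) auto
    moreover have "lam \<ge> 2" using lam4 by simp
    ultimately show ?thesis using center_bound[OF \<mu> \<beta>(1), of k] by (meson order_trans)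
  qed
  have b1: "cmod (integral {1..X 0} (integrand \<mu> k \<beta>)) \<le> 3328 * 2 powr (\<mu> / 2) * B * y\<^sup>2"
    unfolding X_def B_def
  proof (rule small_beta_piece[OF \<mu> k \<beta> y p, of _ 1])
    show "(wkb_freq lam x)\<^sup>2 \<le> 1 * lam" if "1 \<le> x" "x \<le> edge lam (y ^ (4 + 2 * 0))" for x
    proof -
      have "edge lam (y ^ (4 + 2 * 0)) \<ge> 0" using X0[of 0] by (simp add: X_def)
      then have "x\<^sup>2 \<le> (edge lam (y ^ (4 + 2 * 0)))\<^sup>2" using that by (intro power_mono) auto
      also have "\<dots> = lam * (1 - y ^ 4)" using l y by (subst edge_sq) auto
      also have "\<dots> \<le> lam" using l y by simp
      finally show ?thesis by (simp add: wkb_freq_sq)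
    qed
  qed (use X1 in \<open>auto simp: X_def\<close>)
  have b2: "cmod (integral {X 0..X 1} (integrand \<mu> k \<beta>)) \<le> 3328 * 2 powr (\<mu> / 2) * B * y\<^sup>2"
    unfolding B_def XE[of 1]
  proof (rule small_beta_piece[OF \<mu> k \<beta> y p, of _ "y ^ 4"])
    \<comment> \<open>A piece begins at the previous cut, so \<delta>' = y^(2 + 2i) has to be at
      most 2 y^(3i). For i = 1 there is a power of y to spare; for i = 2 the exponents
      agree.\<close>
    show "y ^ 4 \<le> 2 * y ^ (3 * 1)"
    proof -
      have "y ^ 4 \<le> y ^ 3" using y by (intro power_decreasing) auto
      moreover have "y ^ 3 > 0" using y by simp
      ultimately show ?thesis unfolding mult_1_right by linarith
    qed
    show "(wkb_freq lam x)\<^sup>2 \<le> y ^ 4 * lam" if "X 0 \<le> x" "x \<le> edge lam (y ^ (4 + 2 * 1))" for x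
      using qX[of 0 x 1] that by (simp add: X_def)
    show "X 0 \<le> edge lam (y ^ (4 + 2 * 1))" using Xm[of 0 1] by (simp add: X_def)
  qed (use X1 y in auto)
  have b3: "cmod (integral {X 1..X 2} (integrand \<mu> k \<beta>)) \<le> 3328 * 2 powr (\<mu> / 2) * B * y\<^sup>2"
    unfolding B_def XE[of 2]
  proof (rule small_beta_piece[OF \<mu> k \<beta> y p, of _ "y ^ 6"])
    show "(wkb_freq lam x)\<^sup>2 \<le> y ^ 6 * lam" if "X 1 \<le> x" "x \<le> edge lam (y ^ (4 + 2 * 2))" for x
      using qX[of 1 x 2] that by (simp add: X_def)
    show "X 1 \<le> edge lam (y ^ (4 + 2 * 2))" using Xm[of 1 2] by (simp add: X_def)
    show "1 \<le> X 1" using X1 Xm[of 0 1] by simp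
  qed (use y in auto)
  have b4: "cmod (LINT x:{X 2..}|lborel. integrand \<mu> k \<beta> x) \<le> 4 * sqrt (24 * tail_const \<mu>) * B * y\<^sup>2"
  proof -
    have "y ^ 8 \<le> y ^ 4" using y by (intro power_decreasing) auto
    then have "y ^ 8 \<le> 3/4" using y by simp
    \<comment> \<open>For \<delta> = \<open>y ^ 8\<close> the Airy condition is y^24
      \<open>lam\<close>^2 \<ge> 1.\<close>
    moreover have "1 \<le> (y ^ 12 * lam)\<^sup>2" using y(4) by (simp add: one_le_power)
    then have "(y ^ 8) ^ 3 * lam\<^sup>2 \<ge> 1" by (simp add: power_mult_distrib power_mult[symmetric])
    ultimately have "cmod (LINT x:{edge lam (y ^ 8)..}|lborel. integrand \<mu> k \<beta> x)
       \<le> 4 * sqrt (24 * tail_const \<mu>) * lam powr (\<mu> / 2) * \<rho> * (y ^ 8) powr (1/4)"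
      using y by (intro edge_bound \<mu> \<beta>) auto
    moreover have "(y ^ 8) powr (1/4) = y\<^sup>2"
    proof -
      have "(y powr real 8) powr (1/4) = y powr real 2" by (simp add: powr_powr)
      then show ?thesis unfolding powr_realpow[OF y(1)] .
    qed
    ultimately show ?thesis by (simp add: X_def B_def mult_ac)
  qed
  have "cmod (LINT x:{0..}|lborel. integrand \<mu> k \<beta> x) \<le> 4 * 2 powr (\<mu> / 2) * B * y\<^sup>2 + (3328 * 2 powr (\<mu> / 2) * B * y\<^sup>2
     + (3328 * 2 powr (\<mu> / 2) * B * y\<^sup>2 + (3328 * 2 powr (\<mu> / 2) * B * y\<^sup>2 + 4 * sqrt (24 * tail_const \<mu>) * B * y\<^sup>2)))"
    unfolding split by (intro norm_triangle_mono b0 b1 b2 b3 b4)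
  also have "\<dots> = (9988 * 2 powr (\<mu> / 2) + 4 * sqrt (24 * tail_const \<mu>)) * (B * y\<^sup>2)"
    by (simp add: algebra_simps)
  also have "\<dots> \<le> half_line_const \<mu> * (B * y\<^sup>2)"
    unfolding half_line_const_def using B trivial_const_nonneg[of \<mu>] by (intro mult_right_mono) auto
  finally show ?thesis by (simp add: B_def mult.assoc)
qed

end

section \<open>Choice of the cuts and the half-line bounds for both ranges of \<beta>\<close>

context oscillator_pair
begin

text \<open>\<open>z\<close> plays the role of y^2 in \<open>small_beta_bound\<close>.
  \<open>D\<close> is the smallest number with D \<ge> 1 and \<kappa> D^6 \<ge> 1; the first
  inequality yields the Airy condition y^12 \<open>lam\<close> \<ge> 1, the second the curvature
  condition. If z > 1/2, the claim follows from the trivial bound at the cost of a factor 2.\<close>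

lemma half_line_small_beta:
  assumes \<mu>: "\<mu> \<ge> 0" and k: "k > 0" and \<beta>: "1 < \<beta>" "\<beta> \<le> 2"
  shows "cmod (LINT x:{0..}|lborel. integrand \<mu> k \<beta> x) \<le>
    half_line_const \<mu> * (lam powr (\<mu> / 2) * \<rho>) * (max 1 ((k * \<beta> * (\<beta> - 1)) powr (- 1/6)) * lam powr (- \<beta> / 12))"
proof -
  have l: "lam \<ge> 1" using u.lam_ge .
  define \<kappa> where "\<kappa> = k * \<beta> * (\<beta> - 1)"
  have \<kappa>: "\<kappa> > 0" using k \<beta> by (simp add: \<kappa>_def)
  define D where "D = max 1 (\<kappa> powr (- 1/6))"
  define z where "z = D * lam powr (- \<beta> / 12)"
  define B where "B = lam powr (\<mu> / 2) * \<rho>"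
  have B: "B > 0" using \<rho>_pos l by (simp add: B_def)
  have D1: "D \<ge> 1" by (simp add: D_def)
  have z0: "z > 0" using D1 l by (simp add: z_def)
  have z6: "z ^ 6 * lam = D ^ 6 * lam powr (1 - \<beta> / 2)"
  proof -
    have "(lam powr (- \<beta> / 12)) ^ 6 * lam = lam powr (- \<beta> / 2) * lam powr 1"
      using l by (simp add: powr_powr flip: powr_numeral powr_realpow)
    also have "\<dots> = lam powr (1 - \<beta> / 2)" unfolding powr_add[symmetric] by simp
    finally show ?thesis by (simp add: z_def power_mult_distrib)
  qed
  have D6: "D ^ 6 \<ge> 1" using D1 by simp
  have D6': "\<kappa> * D ^ 6 \<ge> 1"
  proof -
    have "\<kappa> * (\<kappa> powr (- 1/6)) ^ 6 = \<kappa> * \<kappa> powr (- 1)"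
      using \<kappa> by (simp add: powr_powr flip: powr_numeral powr_realpow)
    also have "\<dots> = 1" using \<kappa> by (simp add: powr_minus_divide)
    finally have "1 = \<kappa> * (\<kappa> powr (- 1/6)) ^ 6" by simp
    also have "\<dots> \<le> \<kappa> * D ^ 6"
      using \<kappa> by (intro mult_left_mono power_mono) (auto simp: D_def)
    finally show ?thesis .
  qed
  have z61: "z ^ 6 * lam \<ge> 1"
    unfolding z6 using D6 l \<beta> mult_mono[of 1 "D ^ 6" 1 "lam powr (1 - \<beta> / 2)"] by (simp add: ge_one_powr_ge_zero)
  have "cmod (LINT x:{0..}|lborel. integrand \<mu> k \<beta> x) \<le> half_line_const \<mu> * B * z"
  proof (cases "z \<le> 1/2")
    case True
    define y where "y = sqrt z"
    have y0: "y > 0" using z0 by (simp add: y_def)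
    have y2: "y\<^sup>2 = z" using z0 by (simp add: y_def)
    have "y ^ 4 = (y\<^sup>2)\<^sup>2" "y ^ 12 = (y\<^sup>2) ^ 6" by (simp_all add: power_mult[symmetric])
    then have y4: "y ^ 4 = z\<^sup>2" and y12: "y ^ 12 = z ^ 6" unfolding y2 by auto
    have z2: "z\<^sup>2 \<le> 1/4" using power_mono[OF True, of 2] z0 by (simp add: power2_eq_square)
    have "z ^ 6 \<le> (1/2) ^ 6" using True z0 by (intro power_mono) auto
    then have "z ^ 6 * lam \<le> (1/2) ^ 6 * lam" using l by (intro mult_right_mono) auto
    \<comment> \<open>In fact z^6 \<open>lam\<close> \<ge> 1 and z \<le> 1/2 give \<open>lam\<close>
      \<ge> 64.\<close>
    then have lam4: "lam \<ge> 4" using z61 by (simp add: power_divide)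
    have "cmod (LINT x:{0..}|lborel. integrand \<mu> k \<beta> x) \<le> half_line_const \<mu> * (lam powr (\<mu> / 2) * \<rho>) * y\<^sup>2"
    proof (rule small_beta_bound[OF \<mu> k \<beta> y0 _ _ _ lam4])
      show "y \<le> 1" unfolding y_def using True by (simp add: real_sqrt_le_1_iff)
      show "y ^ 4 \<le> 3/4" unfolding y4 using z2 by simp
      show "1 \<le> y ^ 12 * lam" unfolding y12 by (rule z61)
      have "k * \<beta> * (\<beta> - 1) * lam powr ((\<beta> - 2) / 2) * (y ^ 12 * lam) = \<kappa> * D ^ 6 * (lam powr ((\<beta> - 2) / 2) * lam powr (1 - \<beta> / 2))"
        unfolding y12 z6 \<kappa>_def by (simp add: mult_ac)
      also have "lam powr ((\<beta> - 2) / 2) * lam powr (1 - \<beta> / 2) = lam powr 0"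
        unfolding powr_add[symmetric] by (simp add: field_simps)
      also have "\<kappa> * D ^ 6 * lam powr 0 = \<kappa> * D ^ 6" using l by simp
      finally show "1 \<le> k * \<beta> * (\<beta> - 1) * lam powr ((\<beta> - 2) / 2) * (y ^ 12 * lam)" using D6' by simp
    qed
    then show ?thesis unfolding y2 B_def .
  next
    case False
    have "cmod (LINT x:{0..}|lborel. integrand \<mu> k \<beta> x) \<le> trivial_const \<mu> * B * 1"
      using trivial_bound[OF \<mu> \<beta>(1), of k] by (simp add: B_def)
    also have "\<dots> \<le> trivial_const \<mu> * B * (2 * z)"
      using False B trivial_const_nonneg[of \<mu>] by (intro mult_left_mono) auto
    also have "\<dots> = 2 * trivial_const \<mu> * (B * z)" by simp
    also have "\<dots> \<le> half_line_const \<mu> * (B * z)"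
      unfolding half_line_const_def using B z0 trivial_const_nonneg[of \<mu>] tail_const_pos[of \<mu>]
      by (intro mult_right_mono) (auto intro!: add_nonneg_nonneg)
    finally show ?thesis by (simp add: mult.assoc)
  qed
  then show ?thesis unfolding B_def z_def D_def \<kappa>_def .
qed

text \<open>The curvature of k x^\<beta> is at least four times x / q, twice the largest possible
  value of \<open>phase2\<close>, so half of it survives. After inserting the bounds on q and
  \<kappa> this becomes \<open>lam powr (3 * \<theta> - 1/2) \<le> x powr (\<beta> - 3)\<close>. For
  \<beta> \<ge> 3 the right side is at least 1 and 3\<theta> \<le> 1/2; otherwise x \<le>
  \<surd>\<open>lam\<close> and 3\<theta> \<le> (\<beta> - 2) / 2.\<close>

lemma large_beta_phase:
  assumes \<beta>: "\<beta> > 2" and x: "1 \<le> x" "x\<^sup>2 < lam" and q: "wkb_freq lam x \<ge> lam powr (1/2 - 2 * \<theta>)"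
    and \<theta>: "\<theta> = (\<beta> - 2) / (8 * \<beta> - 4)" and \<kappa>: "\<kappa> \<ge> 4 * lam powr (- \<theta>)"
    and st: "\<sigma> \<in> {1, -1}" "\<tau> \<in> {1, -1}"
  shows "\<kappa> * x powr (\<beta> - 2) - phase2 lam Lam \<sigma> \<tau> x \<ge> \<kappa> / 2"
proof -
  have l: "lam \<ge> 1" using u.lam_ge .
  have \<kappa>0: "0 \<le> \<kappa>" using \<kappa> by (smt (verit) powr_ge_zero)
  have xs: "x \<le> sqrt lam" using x by (simp add: real_le_rsqrt)
  have \<theta>1: "3 * \<theta> \<le> 1/2" "3 * \<theta> \<le> (\<beta> - 2) / 2"
  proof -
    have d: "8 * \<beta> - 4 > 0" using \<beta> by simp
    have "3 * (\<beta> - 2) \<le> 1/2 * (8 * \<beta> - 4)" using \<beta> by simp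
    then show "3 * \<theta> \<le> 1/2" unfolding \<theta> using d by (simp add: field_simps)
    have "(\<beta> - 2) / (8 * \<beta> - 4) \<le> (\<beta> - 2) / 6" using \<beta> by (intro divide_left_mono) auto
    then show "3 * \<theta> \<le> (\<beta> - 2) / 2" unfolding \<theta> by linarith
  qed
  have pw: "x powr (\<beta> - 3) \<ge> lam powr (3 * \<theta> - 1/2)"
  proof (cases "\<beta> \<ge> 3")
    case True
    have "lam powr (3 * \<theta> - 1/2) \<le> lam powr 0" using l \<theta>1 by (intro powr_mono) auto
    also have "\<dots> \<le> x powr (\<beta> - 3)" using x l True by (simp add: ge_one_powr_ge_zero)
    finally show ?thesis .
  next
    case False
    have "lam powr (3 * \<theta> - 1/2) \<le> lam powr ((\<beta> - 3) / 2)" using l \<theta>1 by (intro powr_mono) auto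
    also have "\<dots> = sqrt lam powr (\<beta> - 3)"
      using l by (simp add: powr_half_sqrt[symmetric] powr_powr)
    also have "\<dots> \<le> x powr (\<beta> - 3)" using False xs x by (intro powr_mono2') auto
    finally show ?thesis .
  qed
  have "x / wkb_freq lam x \<le> x / lam powr (1/2 - 2 * \<theta>)"
    using q x l by (intro divide_left_mono mult_pos_pos) (auto intro: less_le_trans[OF _ q])
  also have "\<dots> = x * (lam powr (- \<theta>) * lam powr (3 * \<theta> - 1/2))"
    unfolding powr_add[symmetric] using powr_minus_divide[of lam "1/2 - 2 * \<theta>"] by simp
  also have "\<dots> \<le> x * (\<kappa> / 4 * x powr (\<beta> - 3))"
    using pw \<kappa> \<kappa>0 x l by (intro mult_left_mono mult_mono) auto
  also have "\<dots> = \<kappa> / 4 * x powr (\<beta> - 2)"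
  proof -
    have "x powr (\<beta> - 2) = x powr (1 + (\<beta> - 3))" by simp
    also have "\<dots> = x * x powr (\<beta> - 3)" using x unfolding powr_add by simp
    finally show ?thesis by simp
  qed
  finally have "x / wkb_freq lam x \<le> \<kappa> / 4 * x powr (\<beta> - 2)" .
  then have "4 * (x / wkb_freq lam x) \<le> 4 * (\<kappa> / 4 * x powr (\<beta> - 2))"
    by (rule mult_left_mono) simp
  also have "\<dots> = \<kappa> * x powr (\<beta> - 2)" by simp
  finally have "4 * (x / wkb_freq lam x) \<le> \<kappa> * x powr (\<beta> - 2)" .
  moreover have "phase2 lam Lam \<sigma> \<tau> x \<le> 2 * (x / wkb_freq lam x)"
    using abs_phase2_le(1)[OF lam_le_Lam _ x(2) st] x(1) by (simp add: abs_le_iff)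
  moreover have "\<kappa> * 1 \<le> \<kappa> * x powr (\<beta> - 2)"
  proof (rule mult_left_mono)
    show "1 \<le> x powr (\<beta> - 2)" using x \<beta> by (simp add: ge_one_powr_ge_zero)
    show "0 \<le> \<kappa>" by (rule \<kappa>0)
  qed
  ultimately show ?thesis by linarith
qed

text \<open>One interior piece suffices. It ends at \<delta> =
  \<open>lam powr (- 4 * \<theta>)\<close>, so that the edge contributes the factor
  \<open>lam powr (- \<theta>)\<close>; the interior contributes
  \<open>lam powr (2 * \<theta> - 1/2)\<close>, which is no larger since \<theta> \<le> 1/8. The
  case z < 1/4 supplies the lower bound on \<kappa> that \<open>large_beta_phase\<close> needs;
  otherwise the trivial bound suffices.\<close>

lemma half_line_large_beta:
  assumes \<mu>: "\<mu> \<ge> 0" and k: "k > 0" and \<beta>: "\<beta> > 2"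
  shows "cmod (LINT x:{0..}|lborel. integrand \<mu> k \<beta> x) \<le>
    half_line_const \<mu> * (lam powr (\<mu> / 2) * \<rho>) * (max 1 (1 / (\<beta> * k)) * lam powr (- ((\<beta> - 2) / (8 * \<beta> - 4))))"
proof -
  have l: "lam \<ge> 1" using u.lam_ge .
  define \<theta> where "\<theta> = (\<beta> - 2) / (8 * \<beta> - 4)"
  have \<theta>: "0 < \<theta>" "\<theta> \<le> 1/8"
    unfolding \<theta>_def using \<beta> by (auto simp: field_simps)
  define M where "M = max 1 (1 / (\<beta> * k))"
  have M: "M \<ge> 1" "M \<ge> 1 / (\<beta> * k)" by (auto simp: M_def)
  define z where "z = M * lam powr (- \<theta>)"
  have z0: "z > 0" using M l by (simp add: z_def)
  have lz: "lam powr (- \<theta>) \<le> z" unfolding z_def using M l mult_right_mono[of 1 M "lam powr (- \<theta>)"] by simp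
  define B where "B = lam powr (\<mu> / 2) * \<rho>"
  have B: "B > 0" "\<rho> \<le> B"
  proof -
    show "B > 0" using \<rho>_pos l by (simp add: B_def)
    have "1 \<le> lam powr (\<mu> / 2)" using l \<mu> by (simp add: ge_one_powr_ge_zero)
    then show "B \<ge> \<rho>" unfolding B_def using \<rho>_pos mult_right_mono[of 1 "lam powr (\<mu> / 2)" \<rho>] by simp
  qed
  have "cmod (LINT x:{0..}|lborel. integrand \<mu> k \<beta> x) \<le> half_line_const \<mu> * B * z"
  proof (cases "z < 1/4")
    case False
    have "cmod (LINT x:{0..}|lborel. integrand \<mu> k \<beta> x) \<le> trivial_const \<mu> * B * 1"
      using trivial_bound[OF \<mu>, of \<beta> k] \<beta> by (simp add: B_def)
    also have "\<dots> \<le> trivial_const \<mu> * B * (4 * z)"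
      using False B trivial_const_nonneg[of \<mu>] by (intro mult_left_mono) auto
    also have "\<dots> = 4 * trivial_const \<mu> * (B * z)" by simp
    also have "\<dots> \<le> half_line_const \<mu> * (B * z)"
      unfolding half_line_const_def using B z0 tail_const_pos[of \<mu>] by (intro mult_right_mono) auto
    finally show ?thesis by (simp add: mult.assoc)
  next
    case True
    define \<delta> where "\<delta> = lam powr (- 4 * \<theta>)"
    define \<kappa> where "\<kappa> = k * \<beta> * (\<beta> - 1)"
    have \<delta>0: "0 < \<delta>" using l by (simp add: \<delta>_def)
    have \<delta>1: "\<delta> \<le> 3/4"
    proof -
      have "\<delta> = (lam powr (- \<theta>)) ^ 4"
        unfolding \<delta>_def using l by (simp add: powr_powr mult.commute flip: powr_numeral powr_realpow)
      also have "\<dots> \<le> (1/4) ^ 4" using lz True by (intro power_mono) auto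
      finally show ?thesis by (simp add: power_divide)
    qed
    have lam4: "lam \<ge> 4"
    proof -
      have "lam powr (-1) \<le> lam powr (- \<theta>)" using l \<theta> by (intro powr_mono) auto
      then have "lam powr (-1) \<le> 1/4" using lz True by linarith
      moreover have "lam powr (-1) = 1 / lam" using l by (simp add: powr_minus_divide)
      ultimately show ?thesis using l by (simp add: field_simps)
    qed
    \<comment> \<open>The left side is \<open>lam powr (2 - 12 * \<theta>)\<close>, and 12 \<theta>
      is at most 3/2.\<close>
    have \<delta>3: "\<delta> ^ 3 * lam\<^sup>2 \<ge> 1"
    proof -
      have "\<delta> ^ 3 * lam\<^sup>2 = lam powr (- 12 * \<theta>) * lam powr 2"
        unfolding \<delta>_def using l by (simp add: powr_powr mult.commute flip: powr_numeral powr_realpow)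
      also have "\<dots> = lam powr (2 - 12 * \<theta>)" unfolding powr_add[symmetric] by simp
      finally show ?thesis using l \<theta> by (simp add: ge_one_powr_ge_zero)
    qed
    have bk: "\<beta> * k > 0" using \<beta> k by simp
    have \<kappa>b: "\<kappa> \<ge> \<beta> * k"
      using mult_left_mono[of 1 "\<beta> - 1" "k * \<beta>"] \<beta> k by (simp add: \<kappa>_def mult.commute)
    have \<kappa>4: "\<kappa> \<ge> 4 * lam powr (- \<theta>)"
    proof -
      have "1 / (\<beta> * k) * lam powr (- \<theta>) \<le> z"
        unfolding z_def using M(2) by (intro mult_right_mono) auto
      moreover have "1 / (\<beta> * k) * lam powr (- \<theta>) = lam powr (- \<theta>) / (\<beta> * k)" by simp
      ultimately have "lam powr (- \<theta>) / (\<beta> * k) \<le> 1/4" using True by linarith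
      then have "lam powr (- \<theta>) \<le> 1/4 * (\<beta> * k)" using bk by (simp only: pos_divide_le_eq)
      then show ?thesis using \<kappa>b by simp
    qed
    \<comment> \<open>\<open>2 * M\<close> becomes the parameter \<open>L\<close> of the second
      derivative test. It is admissible because \<kappa> \<ge> \<beta> k, M \<ge> 1 / (\<beta> k)
      and M \<ge> 1.\<close>
    have \<kappa>M: "\<kappa> / 2 \<ge> 1 / (2 * M)\<^sup>2"
    proof -
      have "1 / (\<beta> * k) * 1 \<le> M * M" using M bk by (intro mult_mono) auto
      then have "1 \<le> (\<beta> * k) * (M * M)" using bk by (simp add: pos_divide_le_eq mult.commute)
      also have "\<dots> \<le> \<kappa> * (M * M)" using \<kappa>b by (intro mult_right_mono) auto
      finally have "1 \<le> \<kappa> * (M * M)" .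
      then have "1 / (M * M) \<le> \<kappa>" using M by (simp add: pos_divide_le_eq)
      moreover have "\<kappa> > 0" using \<kappa>b bk by linarith
      moreover have "a / 4 \<le> b / 2" if "a \<le> b" "0 < b" for a b :: real
        using that by simp
      ultimately have "1 / (M * M) / 4 \<le> \<kappa> / 2" by blast
      then show ?thesis by (simp add: power2_eq_square)
    qed
    define X where "X = edge lam \<delta>"
    note e = edge_properties[OF \<delta>0 \<delta>1 \<delta>3, folded X_def]
    have sq: "sqrt (\<delta> * lam) = lam powr (1/2 - 2 * \<theta>)"
    proof (rule real_sqrt_unique)
      have "(lam powr (1/2 - 2 * \<theta>))\<^sup>2 = lam powr (- 4 * \<theta> + 1)"
        unfolding power2_eq_square powr_add[symmetric] by (simp add: algebra_simps)
      also have "\<dots> = \<delta> * lam" unfolding powr_add \<delta>_def using l by simp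
      finally show "(lam powr (1/2 - 2 * \<theta>))\<^sup>2 = \<delta> * lam" .
    qed simp
    have qX: "wkb_freq lam X = lam powr (1/2 - 2 * \<theta>)"
      using e(4,5) sq real_sqrt_unique[of "wkb_freq lam X" "\<delta> * lam"] by simp
    have X1: "1 \<le> X"
    proof -
      have "4 * (1/4) \<le> lam * (1 - \<delta>)" using lam4 \<delta>1 by (intro mult_mono) auto
      then show ?thesis unfolding X_def edge_def by simp
    qed
    have mid: "cmod (integral {1..X} (integrand \<mu> k \<beta>)) \<le> 64 * 2 powr (\<mu> / 2) * (lam powr (\<mu> / 2) * \<rho>) * (8 * (2 * M) / sqrt (\<delta> * lam))"
    proof (rule middle_bound[OF \<mu> \<delta>0 \<delta>1 \<delta>3, folded X_def])
      show "1 \<le> (1::real)" "1 \<le> X" using X1 by auto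
      fix S T and \<sigma> \<tau> t :: real
      assume S: "\<And>x. x \<in> {1..X} \<Longrightarrow> (S has_real_derivative wkb_freq lam x) (at x within {1..X})"
        and T: "\<And>x. x \<in> {1..X} \<Longrightarrow> (T has_real_derivative wkb_freq Lam x) (at x within {1..X})"
        and st: "\<sigma> \<in> {1, -1}" "\<tau> \<in> {1, -1}" and t: "t \<in> {1..X}"
      have x2: "x\<^sup>2 < lam" if "0 \<le> x" "x \<le> X" for x
      proof -
        have "x\<^sup>2 \<le> X\<^sup>2" using that by (intro power_mono) auto
        then show ?thesis using e(2) by linarith
      qed
      show "cmod (osc_integral 1 t (phase k \<beta> \<sigma> \<tau> S T)) \<le> 8 * (2 * M)"
      proof (rule phase_integral_convex[OF l lam_le_Lam order_refl])
        show "1 \<le> t" "t\<^sup>2 < lam" "2 * M > 0" using t x2[of t] M by auto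
        show "(S has_real_derivative wkb_freq lam x) (at x within {1..t})" if "x \<in> {1..t}" for x
          using S[of x] that t by (auto intro: DERIV_subset)
        show "(T has_real_derivative wkb_freq Lam x) (at x within {1..t})" if "x \<in> {1..t}" for x
          using T[of x] that t by (auto intro: DERIV_subset)
        fix x assume x: "x \<in> {1..t}"
        then have xX: "1 \<le> x" "x \<le> X" using t by auto
        have "lam powr (1/2 - 2 * \<theta>) \<le> wkb_freq lam x"
          unfolding qX[symmetric] using xX by (intro wkb_freq_antimono) auto
        from large_beta_phase[OF \<beta> xX(1) x2 this \<theta>_def \<kappa>4 st] xX
        have "\<kappa> * x powr (\<beta> - 2) - phase2 lam Lam \<sigma> \<tau> x \<ge> \<kappa> / 2" by simp
        then show "1 / (2 * M)\<^sup>2 \<le> k * \<beta> * (\<beta> - 1) * x powr (\<beta> - 2) - phase2 lam Lam \<sigma> \<tau> x"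
          using \<kappa>M unfolding \<kappa>_def by linarith
      qed
    qed
    have mid': "8 * (2 * M) / sqrt (\<delta> * lam) \<le> 16 * z"
    proof -
      have "1 / sqrt (\<delta> * lam) = lam powr (- (1/2 - 2 * \<theta>))" unfolding sq by (simp only: powr_minus_divide)
      also have "\<dots> \<le> lam powr (- \<theta>)" using l \<theta> by (intro powr_mono) auto
      finally have "16 * M * (1 / sqrt (\<delta> * lam)) \<le> 16 * M * lam powr (- \<theta>)"
        using M by (intro mult_left_mono) auto
      then show ?thesis unfolding z_def by simp
    qed
    have b1: "cmod (integral {1..X} (integrand \<mu> k \<beta>)) \<le> 1024 * 2 powr (\<mu> / 2) * (B * z)"
    proof -
      have "64 * 2 powr (\<mu> / 2) * B * (8 * (2 * M) / sqrt (\<delta> * lam)) \<le> 64 * 2 powr (\<mu> / 2) * B * (16 * z)"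
        using B by (intro mult_left_mono mid') auto
      then show ?thesis using mid unfolding B_def[symmetric] by simp
    qed
    have b0: "cmod (integral {0..1} (integrand \<mu> k \<beta>)) \<le> 4 * 2 powr (\<mu> / 2) * (B * z)"
    proof -
      have "lam powr (- 1/2) \<le> lam powr (- \<theta>)" using l \<theta> by (intro powr_mono) auto
      then have "\<rho> * lam powr (- 1/2) \<le> B * z" using lz B \<rho>_pos by (intro mult_mono) auto
      then have "4 * 2 powr (\<mu> / 2) * (\<rho> * lam powr (- 1/2)) \<le> 4 * 2 powr (\<mu> / 2) * (B * z)" by (intro mult_left_mono) auto
      moreover have "lam \<ge> 2" "\<beta> > 1" using lam4 \<beta> by auto
      ultimately show ?thesis using center_bound[OF \<mu>, of \<beta> k] by (simp only: mult.assoc) (meson order_trans)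
    qed
    have b2: "cmod (LINT x:{X..}|lborel. integrand \<mu> k \<beta> x) \<le> 4 * sqrt (24 * tail_const \<mu>) * (B * z)"
    proof -
      have "\<delta> powr (1/4) = lam powr (- \<theta>)" unfolding \<delta>_def by (simp add: powr_powr)
      then have "B * \<delta> powr (1/4) \<le> B * z" using lz B by (intro mult_left_mono) auto
      then have "4 * sqrt (24 * tail_const \<mu>) * (B * \<delta> powr (1/4)) \<le> 4 * sqrt (24 * tail_const \<mu>) * (B * z)"
        by (rule mult_left_mono) (use tail_const_pos[of \<mu>] in simp)
      then show ?thesis
        using edge_bound[OF \<mu> _ \<delta>0 \<delta>1 \<delta>3, of \<beta> k] \<beta> unfolding X_def B_def by (simp add: mult.assoc)
    qed
    have fi: "set_integrable lborel {x..} (integrand \<mu> k \<beta>)" if "x \<ge> 0" for x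
      using that \<beta> by (intro integrand_integrable) auto
    have split: "(LINT x:{0..}|lborel. integrand \<mu> k \<beta> x) =
      integral {0..1} (integrand \<mu> k \<beta>) + (integral {1..X} (integrand \<mu> k \<beta>) + (LINT x:{X..}|lborel. integrand \<mu> k \<beta> x))"
      using set_integral_split_ray[OF fi, of 0 1] set_integral_split_ray[OF fi, of 1 X] X1 by simp
    have "cmod (LINT x:{0..}|lborel. integrand \<mu> k \<beta> x) \<le> 4 * 2 powr (\<mu> / 2) * (B * z) + (1024 * 2 powr (\<mu> / 2) * (B * z)
       + 4 * sqrt (24 * tail_const \<mu>) * (B * z))"
      unfolding split by (intro norm_triangle_mono b0 b1 b2)
    also have "\<dots> = (1028 * 2 powr (\<mu> / 2) + 4 * sqrt (24 * tail_const \<mu>)) * (B * z)"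
      by (simp add: algebra_simps)
    also have "\<dots> \<le> half_line_const \<mu> * (B * z)"
      unfolding half_line_const_def using B z0 trivial_const_nonneg[of \<mu>] by (intro mult_right_mono) auto
    finally show ?thesis by (simp add: mult.assoc)
  qed
  then show ?thesis unfolding B_def z_def M_def \<theta>_def .
qed

end

section \<open>Hermite functions\<close>

lemma osc_const_ge_one:
  assumes "\<beta> > 1" "k \<noteq> 0"
  shows "osc_const k \<beta> \<ge> 1"
proof (cases "\<beta> < 2")
  case True
  \<comment> \<open>For \<bar>k\<bar> \<le> 1 the negative power is at least 1, for \<bar>k\<bar> >
    1 the other one, whose exponent is positive because \<beta> < 2.\<close>
  have "max (\<bar>k\<bar> powr (- 1)) (\<bar>k\<bar> powr (1 / (4 - 2 * \<beta>))) \<ge> 1"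
  proof (cases "\<bar>k\<bar> \<le> 1")
    case True
    then have "\<bar>k\<bar> powr (- 1) \<ge> 1" using assms(2) by (simp add: powr_minus_divide)
    then show ?thesis by simp
  next
    case False
    then have "\<bar>k\<bar> powr (1 / (4 - 2 * \<beta>)) \<ge> 1"
      using \<open>\<beta> < 2\<close> by (intro ge_one_powr_ge_zero) auto
    then show ?thesis by simp
  qed
  then show ?thesis using True unfolding osc_const_def by (simp add: le_max_iff_disj)
next
  case False
  then show ?thesis unfolding osc_const_def by simp
qed

lemma decay_exponent_zero_le:
  assumes "\<beta> > 1"
  shows "decay_exponent \<beta> 0 \<le> 1/4" and "decay_exponent \<beta> \<mu> = decay_exponent \<beta> 0 - \<mu> / 4"
proof -
  have "(\<beta> - 2) / (4 * \<beta> - 2) \<le> 1" using assms by (simp add: field_simps)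
  then show "decay_exponent \<beta> 0 \<le> 1/4" using assms by (auto simp: decay_exponent_def)
  show "decay_exponent \<beta> \<mu> = decay_exponent \<beta> 0 - \<mu> / 4"
    by (simp add: decay_exponent_def algebra_simps)
qed

text \<open>Lets the power -1/6 from the half-line bound be dominated by the powers -1/3 and -1 in
  \<open>osc_const\<close>.\<close>

lemma powr_neg_sixth_le:
  assumes "(x::real) > 0" "a \<ge> 1/6"
  shows "x powr (- 1/6) \<le> max 1 (x powr (- a))"
proof (cases "x \<ge> 1")
  case True
  then have "x powr (- 1/6) \<le> x powr 0" by (intro powr_mono) auto
  then show ?thesis using True by simp
next
  case False
  then have "x powr (- 1/6) \<le> x powr (- a)" using assms by (intro powr_mono') auto
  then show ?thesis by simp
qed

text \<open>For \<beta> < 2 the exponents of \<open>lam\<close> agree, and the factor 2 - \<beta> <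
  1 under a negative power only increases \<open>osc_const\<close>. For \<beta> = 2 the half-line
  bound decays like \<open>lam powr (- 1/6)\<close>, whereas \<open>lam powr (- 1/9)\<close> is
  claimed.\<close>

lemma small_beta_constant_le:
  assumes "k > 0" "1 < \<beta>" "\<beta> \<le> 2" "lam \<ge> 1"
  shows "max 1 ((k * \<beta> * (\<beta> - 1)) powr (- 1/6)) * lam powr (- \<beta> / 12) \<le> osc_const k \<beta> * lam powr (- 2 * decay_exponent \<beta> 0)"
proof -
  define \<kappa> where "\<kappa> = k * \<beta> * (\<beta> - 1)"
  have \<kappa>: "\<kappa> > 0" using assms by (simp add: \<kappa>_def)
  have one: "osc_const k \<beta> \<ge> 1" using assms by (intro osc_const_ge_one) auto
  show ?thesis
  proof (cases "\<beta> < 2")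
    case True
    define c where "c = \<bar>\<beta> * (\<beta> - 1) * (\<beta> - 2) * k\<bar>"
    have "c = \<kappa> * (2 - \<beta>)" using assms True unfolding c_def \<kappa>_def by (simp add: abs_mult mult_ac)
    then have c: "0 < c" "c \<le> \<kappa>" using \<kappa> True assms mult_left_mono[of "2 - \<beta>" 1 \<kappa>] by auto
    have "\<kappa> powr (- (1/3)) \<le> c powr (- (1/3))" using c by (intro powr_mono2') auto
    also have "\<dots> \<le> osc_const k \<beta>" using True by (simp add: osc_const_def c_def)
    finally have "\<kappa> powr (- (1/3)) \<le> osc_const k \<beta>" .
    then have "max 1 (\<kappa> powr (- 1/6)) \<le> osc_const k \<beta>"
      using powr_neg_sixth_le[OF \<kappa>, of "1/3"] one by simp
    then have "max 1 (\<kappa> powr (- 1/6)) * lam powr (- \<beta> / 12) \<le> osc_const k \<beta> * lam powr (- \<beta> / 12)"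
      by (rule mult_right_mono) simp
    moreover have "- 2 * decay_exponent \<beta> 0 = - \<beta> / 12" using True by (simp add: decay_exponent_def)
    ultimately show ?thesis unfolding \<kappa>_def by (simp only:)
  next
    case False
    then have b: "\<beta> = 2" using assms by simp
    have "(2 * k) powr (- 1) \<le> k powr (- 1)" using assms by (intro powr_mono2') auto
    also have "\<dots> \<le> osc_const k \<beta>" using assms by (simp add: osc_const_def b)
    finally have "(2 * k) powr (- 1) \<le> osc_const k \<beta>" .
    then have "max 1 (\<kappa> powr (- 1/6)) \<le> osc_const k \<beta>"
      using powr_neg_sixth_le[OF \<kappa>, of 1] one by (simp add: \<kappa>_def b mult.commute)
    moreover have "lam powr (- \<beta> / 12) \<le> lam powr (- 2 * decay_exponent \<beta> 0)"
      using assms by (intro powr_mono) (auto simp: b decay_exponent_def)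
    ultimately show ?thesis unfolding \<kappa>_def using one by (intro mult_mono) auto
  qed
qed

lemma large_beta_constant:
  assumes "k > 0" "\<beta> > 2"
  shows "max 1 (1 / (\<beta> * k)) * lam powr (- ((\<beta> - 2) / (8 * \<beta> - 4))) = osc_const k \<beta> * lam powr (- 2 * decay_exponent \<beta> 0)"
proof -
  have "- 2 * decay_exponent \<beta> 0 = - ((\<beta> - 2) / (8 * \<beta> - 4))"
    using assms by (simp add: decay_exponent_def field_simps)
  moreover have "osc_const k \<beta> = max 1 (1 / (\<beta> * k))"
    using assms by (simp add: osc_const_def powr_minus_divide max.commute)
  ultimately show ?thesis by simp
qed

lemma osc_const_uminus: "osc_const (- k) \<beta> = osc_const k \<beta>"
  by (simp add: osc_const_def)

lemma half_line_const_pos: "half_line_const \<mu> > 0"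
  unfolding half_line_const_def using trivial_const_nonneg[of \<mu>] tail_const_pos[of \<mu>]
  by (simp add: add_pos_nonneg)

section \<open>From real solutions on a half line to complex functions on the line\<close>

definition product_integrand :: "real \<Rightarrow> real \<Rightarrow> real \<Rightarrow> (real \<Rightarrow> complex) \<Rightarrow> (real \<Rightarrow> complex) \<Rightarrow> real \<Rightarrow> complex" where
  "product_integrand \<mu> k \<beta> f g x = complex_of_real (japanese x powr \<mu>) * exp (\<i> * complex_of_real (k * \<bar>x\<bar> powr \<beta>))
     * f x * cnj (g x)"

context oscillator_pair
begin

text \<open>Here \<rho> pays for the symmetric form: \<rho> \<le> \<open>(lam / Lam) powr d\<close>
  because d \<le> 1/4, and multiplication by \<open>lam powr (- 2 * d)\<close> leaves
  \<open>(lam * Lam) powr (- d)\<close>. The weight is handled by \<open>lam\<close> \<le>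
  \<surd>(\<open>lam * Lam\<close>).\<close>

lemma half_line_pos:
  assumes "\<mu> \<ge> 0" "\<beta> > 1" "k > 0"
  shows "cmod (LINT x:{0..}|lborel. integrand \<mu> k \<beta> x)
    \<le> half_line_const \<mu> * osc_const k \<beta> * (lam * Lam) powr (- decay_exponent \<beta> \<mu>)"
proof -
  have l: "lam \<ge> 1" "Lam \<ge> 1" using u.lam_ge v.lam_ge by auto
  define d where "d = decay_exponent \<beta> 0"
  define B where "B = lam powr (\<mu> / 2) * \<rho>"
  have B: "B > 0" using \<rho>_pos l by (simp add: B_def)
  have one: "osc_const k \<beta> \<ge> 1" using assms by (intro osc_const_ge_one) auto
  have "cmod (LINT x:{0..}|lborel. integrand \<mu> k \<beta> x) \<le> half_line_const \<mu> * B * (osc_const k \<beta> * lam powr (- 2 * d))"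
  proof (cases "\<beta> \<le> 2")
    case True
    have "cmod (LINT x:{0..}|lborel. integrand \<mu> k \<beta> x) \<le> half_line_const \<mu> * B *
        (max 1 ((k * \<beta> * (\<beta> - 1)) powr (- 1/6)) * lam powr (- \<beta> / 12))"
      using half_line_small_beta[OF assms(1,3,2) True] by (simp add: B_def)
    also have "\<dots> \<le> half_line_const \<mu> * B * (osc_const k \<beta> * lam powr (- 2 * d))"
      unfolding d_def using small_beta_constant_le[OF assms(3,2) True l(1)] B half_line_const_pos[of \<mu>]
      by (intro mult_left_mono) auto
    finally show ?thesis .
  next
    case False
    then have b2: "\<beta> > 2" by simp
    show ?thesis
      using half_line_large_beta[OF assms(1,3) b2] unfolding large_beta_constant[OF assms(3) b2] B_def d_def .
  qed
  also have "\<dots> = half_line_const \<mu> * osc_const k \<beta> * (lam powr (\<mu> / 2) * (\<rho> * lam powr (- 2 * d)))"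
    by (simp add: B_def mult_ac)
  also have "\<dots> \<le> half_line_const \<mu> * osc_const k \<beta> * ((lam * Lam) powr (\<mu> / 4) * (lam * Lam) powr (- d))"
  proof (intro mult_left_mono mult_mono)
    have "lam powr (\<mu> / 2) = (lam * lam) powr (\<mu> / 4)"
      using l by (simp add: powr_mult powr_add[symmetric])
    also have "\<dots> \<le> (lam * Lam) powr (\<mu> / 4)"
      using l lam_le_Lam assms(1) by (intro powr_mono2) auto
    finally show "lam powr (\<mu> / 2) \<le> (lam * Lam) powr (\<mu> / 4)" .
    have "\<rho> \<le> (lam / Lam) powr d"
      unfolding \<rho>_def d_def using l lam_le_Lam decay_exponent_zero_le(1)[OF assms(2)] by (intro powr_mono') auto
    then have "\<rho> * lam powr (- 2 * d) \<le> (lam / Lam) powr d * lam powr (- 2 * d)" by (intro mult_right_mono) auto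
    also have "\<dots> = (lam powr d * lam powr (- 2 * d)) * Lam powr (- d)"
      using l by (simp add: powr_divide powr_minus_divide[of Lam])
    also have "lam powr d * lam powr (- 2 * d) = lam powr (- d)"
      unfolding powr_add[symmetric] by simp
    also have "lam powr (- d) * Lam powr (- d) = (lam * Lam) powr (- d)" using l by (simp add: powr_mult)
    finally show "\<rho> * lam powr (- 2 * d) \<le> (lam * Lam) powr (- d)" .
  qed (use half_line_const_pos[of \<mu>] one \<rho>_pos in auto)
  also have "(lam * Lam) powr (\<mu> / 4) * (lam * Lam) powr (- d) = (lam * Lam) powr (- decay_exponent \<beta> \<mu>)"
    unfolding powr_add[symmetric] d_def decay_exponent_zero_le(2)[OF assms(2), of \<mu>] by simp
  finally show ?thesis .
qed

text \<open>Since the solutions are real, conjugation turns \<open>k\<close> into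
  \<open>- k\<close>.\<close>

lemma half_line:
  assumes "\<mu> \<ge> 0" "\<beta> > 1" "k \<noteq> 0"
  shows "cmod (LINT x:{0..}|lborel. integrand \<mu> k \<beta> x)
    \<le> half_line_const \<mu> * osc_const k \<beta> * (lam * Lam) powr (- decay_exponent \<beta> \<mu>)"
proof (cases "k > 0")
  case True
  then show ?thesis using half_line_pos assms by simp
next
  case False
  have "integrand \<mu> k \<beta> = (\<lambda>x. cnj (integrand \<mu> (- k) \<beta> x))"
    by (simp add: integrand_def exp_cnj fun_eq_iff)
  then have "(LINT x:{0..}|lborel. integrand \<mu> k \<beta> x) = cnj (LINT x:{0..}|lborel. integrand \<mu> (- k) \<beta> x)"
    unfolding set_lebesgue_integral_def by (simp flip: Bochner_Integration.integral_cnj)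
  then have "cmod (LINT x:{0..}|lborel. integrand \<mu> k \<beta> x) = cmod (LINT x:{0..}|lborel. integrand \<mu> (- k) \<beta> x)"
    by simp
  then show ?thesis using half_line_pos[OF assms(1,2), of "- k"] False assms(3) by (simp add: osc_const_uminus)
qed

end

text \<open>\<open>oscillator_pair\<close> orders the eigenvalues; for real solutions the integrand
  is symmetric, so the two may be exchanged.\<close>

lemma half_line_any_order:
  assumes u: "oscillator_solution u u' lam" and v: "oscillator_solution v v' Lam"
    and "\<mu> \<ge> 0" "\<beta> > 1" "k \<noteq> 0"
  shows "set_integrable lborel {0..} (product_integrand \<mu> k \<beta> (\<lambda>x. complex_of_real (u x)) (\<lambda>x. complex_of_real (v x)))"
    and "cmod (LINT x:{0..}|lborel. product_integrand \<mu> k \<beta> (\<lambda>x. complex_of_real (u x)) (\<lambda>x. complex_of_real (v x)) x)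
     \<le> half_line_const \<mu> * osc_const k \<beta> * (lam * Lam) powr (- decay_exponent \<beta> \<mu>)"
proof -
  have *: "set_integrable lborel {0..} (product_integrand \<mu> k \<beta> (\<lambda>x. complex_of_real (u x)) (\<lambda>x. complex_of_real (v x))) \<and>
     cmod (LINT x:{0..}|lborel. product_integrand \<mu> k \<beta> (\<lambda>x. complex_of_real (u x)) (\<lambda>x. complex_of_real (v x)) x)
     \<le> half_line_const \<mu> * osc_const k \<beta> * (lam * Lam) powr (- decay_exponent \<beta> \<mu>)"
    if u: "oscillator_solution u u' lam" and v: "oscillator_solution v v' Lam" and le: "lam \<le> Lam" for u u' v v' lam Lam
  proof -
    interpret oscillator_pair u u' v v' lam Lam
      using u v le by (simp add: oscillator_pair_def oscillator_pair_axioms_def)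
    have "product_integrand \<mu> k \<beta> (\<lambda>x. complex_of_real (u x)) (\<lambda>x. complex_of_real (v x)) = integrand \<mu> k \<beta>"
      by (simp add: product_integrand_def integrand_def weight_def fun_eq_iff)
    then show ?thesis using integrand_integrable[of \<beta> 0] half_line assms(3-5) by simp
  qed
  have swap: "product_integrand \<mu> k \<beta> (\<lambda>x. complex_of_real (u x)) (\<lambda>x. complex_of_real (v x))
     = product_integrand \<mu> k \<beta> (\<lambda>x. complex_of_real (v x)) (\<lambda>x. complex_of_real (u x))"
    by (simp add: product_integrand_def fun_eq_iff)
  show "set_integrable lborel {0..} (product_integrand \<mu> k \<beta> (\<lambda>x. complex_of_real (u x)) (\<lambda>x. complex_of_real (v x)))"
    and "cmod (LINT x:{0..}|lborel. product_integrand \<mu> k \<beta> (\<lambda>x. complex_of_real (u x)) (\<lambda>x. complex_of_real (v x)) x)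
     \<le> half_line_const \<mu> * osc_const k \<beta> * (lam * Lam) powr (- decay_exponent \<beta> \<mu>)"
    using *[OF u v] *[OF v u] swap by (cases "lam \<le> Lam"; simp add: mult.commute)+
qed

text \<open>\<open>h (- x)\<close> satisfies the same conditions as \<open>h\<close>, which reduces everything to the positive half line.\<close>

locale complex_eigenfunction =
  fixes f f' :: "real \<Rightarrow> complex" and lam :: real
  assumes df: "(f has_vector_derivative f' x) (at x)"
    and df': "(f' has_vector_derivative (x\<^sup>2 - lam) *\<^sub>R f x) (at x)"
    and sq: "integrable lborel (\<lambda>x. (cmod (f x))\<^sup>2)" "(LINT x|lborel. (cmod (f x))\<^sup>2) \<le> 1"
    and lam1: "lam \<ge> 1"
begin

lemma reflect: "complex_eigenfunction (\<lambda>x. f (- x)) (\<lambda>x. - f' (- x)) lam"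
proof
  have n: "(uminus has_real_derivative - 1) (at x)" for x :: real
    by (auto intro!: derivative_eq_intros)
  show "((\<lambda>x. f (- x)) has_vector_derivative - f' (- x)) (at x)" for x
    using vector_diff_chain_at[OF n[THEN has_real_derivative_iff_has_vector_derivative[THEN iffD1]] df]
    by (simp add: o_def)
  have d1: "((\<lambda>x. f' (- x)) has_vector_derivative (lam - x\<^sup>2) *\<^sub>R f (- x)) (at x)" for x
    using vector_diff_chain_at[OF n[THEN has_real_derivative_iff_has_vector_derivative[THEN iffD1]] df', of x]
    by (simp add: o_def)
  show "((\<lambda>x. - f' (- x)) has_vector_derivative (x\<^sup>2 - lam) *\<^sub>R f (- x)) (at x)" for x
  proof -
    have "- ((lam - x\<^sup>2) *\<^sub>R f (- x)) = (x\<^sup>2 - lam) *\<^sub>R f (- x)"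
      by (simp add: scaleR_minus_left[symmetric])
    then show ?thesis using has_vector_derivative_minus[OF d1[of x]] by simp
  qed
  show "integrable lborel (\<lambda>x. (cmod (f (- x)))\<^sup>2)"
    using lborel_integrable_real_affine[OF sq(1), of "-1" 0] by simp
  show "(LINT x|lborel. (cmod (f (- x)))\<^sup>2) \<le> 1"
    using lborel_integral_real_affine[of "-1" "\<lambda>x. (cmod (f x))\<^sup>2" 0] sq(2) by simp
  show "lam \<ge> 1" by (rule lam1)
qed

text \<open>The unimodular factor covers the real part (c = 1) and the imaginary part (c = -i) in
  one statement.\<close>

lemma real_part:
  assumes c: "cmod c = 1"
  shows "oscillator_solution (\<lambda>x. Re (c * f x)) (\<lambda>x. Re (c * f' x)) lam"
proof
  have Re: "((\<lambda>x. Re (c * g x)) has_real_derivative Re (c * d)) (at x)" if "(g has_vector_derivative d) (at x)" for g d x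
    using bounded_linear.has_vector_derivative[OF bounded_linear_Re has_vector_derivative_mult_right[OF that, of c]]
    by (simp add: has_real_derivative_iff_has_vector_derivative)
  show "((\<lambda>x. Re (c * f x)) has_real_derivative Re (c * f' x)) (at x)" for x by (rule Re[OF df])
  show "((\<lambda>x. Re (c * f' x)) has_real_derivative (x\<^sup>2 - lam) * Re (c * f x)) (at x)" for x
    using Re[OF df', of x] by (simp add: algebra_simps)
  have cont: "continuous_on S f" for S
    using df by (meson continuous_on_vector_derivative has_vector_derivative_at_within)
  have le: "(Re (c * f x))\<^sup>2 \<le> (cmod (f x))\<^sup>2" for x
    using power_mono[OF abs_Re_le_cmod[of "c * f x", unfolded norm_mult c mult_1_left] abs_ge_zero, of 2]
    by (simp only: power2_abs)
  have si: "set_integrable lborel {0..} (\<lambda>x. (cmod (f x))\<^sup>2)"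
    using integrable_mult_indicator[OF _ sq(1), of "{0..}"] by (simp add: set_integrable_def)
  show ri: "set_integrable lborel {0..} (\<lambda>x. (Re (c * f x))\<^sup>2)"
  proof (rule set_integrable_bound[OF si])
    have "continuous_on {0..} (\<lambda>x. (Re (c * f x))\<^sup>2)" by (intro continuous_intros cont)
    from borel_measurable_continuous_on_indicator[OF _ this]
    show "set_borel_measurable lborel {0..} (\<lambda>x. (Re (c * f x))\<^sup>2)" unfolding set_borel_measurable_def by simp
  qed (use le in auto)
  have "(LINT x:{0..}|lborel. (Re (c * f x))\<^sup>2) \<le> (LINT x:{0..}|lborel. (cmod (f x))\<^sup>2)"
    by (rule set_integral_mono[OF ri si]) (rule le)
  also have "\<dots> \<le> (LINT x|lborel. (cmod (f x))\<^sup>2)"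
    unfolding set_lebesgue_integral_def
    by (rule integral_mono[OF _ sq(1)]) (use si in \<open>auto simp: set_integrable_def split: split_indicator\<close>)
  finally show "(LINT x:{0..}|lborel. (Re (c * f x))\<^sup>2) \<le> 1" using sq(2) by simp
  show "lam \<ge> 1" by (rule lam1)
qed

end

text \<open>Both functions are split into real and imaginary parts, written with the factors 1 and
  -i so that every summand is an instance of \<open>real_part\<close>.\<close>

lemma product_integrand_reim:
  "product_integrand \<mu> k \<beta> f g x =
     product_integrand \<mu> k \<beta> (\<lambda>x. complex_of_real (Re (1 * f x))) (\<lambda>x. complex_of_real (Re (1 * g x))) x
   + product_integrand \<mu> k \<beta> (\<lambda>x. complex_of_real (Re (- \<i> * f x))) (\<lambda>x. complex_of_real (Re (- \<i> * g x))) x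
   + (\<i> * product_integrand \<mu> k \<beta> (\<lambda>x. complex_of_real (Re (- \<i> * f x))) (\<lambda>x. complex_of_real (Re (1 * g x))) x
   - \<i> * product_integrand \<mu> k \<beta> (\<lambda>x. complex_of_real (Re (1 * f x))) (\<lambda>x. complex_of_real (Re (- \<i> * g x))) x)"
proof -
  define w where "w = complex_of_real (japanese x powr \<mu>) * exp (\<i> * complex_of_real (k * \<bar>x\<bar> powr \<beta>))"
  obtain a b c d where fg: "f x = Complex a b" "g x = Complex c d" by (meson complex.exhaust)
  have "f x * cnj (g x) = complex_of_real (a * c + b * d) + \<i> * complex_of_real (b * c - a * d)"
    unfolding fg by (simp add: complex_eq_iff)
  note eq = this
  have "w * (f x * cnj (g x)) = w * complex_of_real (a * c) + w * complex_of_real (b * d)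
     + (\<i> * (w * complex_of_real (b * c)) - \<i> * (w * complex_of_real (a * d)))"
    unfolding eq by (simp add: algebra_simps)
  then show ?thesis
    unfolding product_integrand_def w_def[symmetric] by (simp add: fg mult.assoc)
qed

lemma half_line_complex:
  assumes f: "complex_eigenfunction f f' lam" and g: "complex_eigenfunction g g' Lam"
    and "\<mu> \<ge> 0" "\<beta> > 1" "k \<noteq> 0"
  shows "set_integrable lborel {0..} (product_integrand \<mu> k \<beta> f g)"
    and "cmod (LINT x:{0..}|lborel. product_integrand \<mu> k \<beta> f g x)
     \<le> 4 * (half_line_const \<mu> * osc_const k \<beta> * (lam * Lam) powr (- decay_exponent \<beta> \<mu>))"
proof -
  define K where "K = half_line_const \<mu> * osc_const k \<beta> * (lam * Lam) powr (- decay_exponent \<beta> \<mu>)"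
  define G where "G = (\<lambda>c d. product_integrand \<mu> k \<beta> (\<lambda>x. complex_of_real (Re (c * f x))) (\<lambda>x. complex_of_real (Re (d * g x))))"
  have Gi: "set_integrable lborel {0..} (G c d)" and Gb: "cmod (LINT x:{0..}|lborel. G c d x) \<le> K"
    if "cmod c = 1" "cmod d = 1" for c d
    unfolding G_def K_def
    using half_line_any_order[OF complex_eigenfunction.real_part[OF f that(1)] complex_eigenfunction.real_part[OF g that(2)] assms(3-5)]
    by auto
  have eq: "product_integrand \<mu> k \<beta> f g = (\<lambda>x. G 1 1 x + G (- \<i>) (- \<i>) x + (\<i> * G (- \<i>) 1 x - \<i> * G 1 (- \<i>) x))"
    unfolding G_def by (rule ext) (rule product_integrand_reim)
  have i: "set_integrable lborel {0..} (G 1 1)" "set_integrable lborel {0..} (G (- \<i>) (- \<i>))"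
    "set_integrable lborel {0..} (\<lambda>x. \<i> * G (- \<i>) 1 x)" "set_integrable lborel {0..} (\<lambda>x. \<i> * G 1 (- \<i>) x)"
    by (auto intro!: Gi)
  show "set_integrable lborel {0..} (product_integrand \<mu> k \<beta> f g)"
    unfolding eq by (rule set_integral_add(1)[OF set_integral_add(1)[OF i(1,2)] set_integral_diff(1)[OF i(3,4)]])
  have "(LINT x:{0..}|lborel. product_integrand \<mu> k \<beta> f g x) =
     (LINT x:{0..}|lborel. G 1 1 x) + (LINT x:{0..}|lborel. G (- \<i>) (- \<i>) x)
     + (\<i> * (LINT x:{0..}|lborel. G (- \<i>) 1 x) - \<i> * (LINT x:{0..}|lborel. G 1 (- \<i>) x))"
    unfolding eq set_integral_add(2)[OF set_integral_add(1)[OF i(1,2)] set_integral_diff(1)[OF i(3,4)]]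
      set_integral_add(2)[OF i(1,2)] set_integral_diff(2)[OF i(3,4)] set_integral_mult_right ..
  also have "cmod \<dots> \<le> (K + K) + (K + K)"
    by (intro norm_triangle_mono norm_triangle_le_diff add_mono) (auto simp: norm_mult intro!: Gb)
  finally show "cmod (LINT x:{0..}|lborel. product_integrand \<mu> k \<beta> f g x)
     \<le> 4 * (half_line_const \<mu> * osc_const k \<beta> * (lam * Lam) powr (- decay_exponent \<beta> \<mu>))"
    by (simp add: K_def)
qed

text \<open>Weight and phase are even, so the negative half line is the positive one for the
  reflected functions, which doubles the constant 4. The point 0, counted twice by the closed half
  lines, is a null set.\<close>

lemma whole_line_complex:
  assumes f: "complex_eigenfunction f f' lam" and g: "complex_eigenfunction g g' Lam"
    and "\<mu> \<ge> 0" "\<beta> > 1" "k \<noteq> 0"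
  shows "cmod (LINT x|lborel. product_integrand \<mu> k \<beta> f g x)
     \<le> 8 * (half_line_const \<mu> * osc_const k \<beta> * (lam * Lam) powr (- decay_exponent \<beta> \<mu>))"
proof -
  define F where "F = product_integrand \<mu> k \<beta> f g"
  define R where "R = product_integrand \<mu> k \<beta> (\<lambda>x. f (- x)) (\<lambda>x. g (- x))"
  have R: "R x = F (- x)" for x
    unfolding R_def F_def product_integrand_def japanese_def by simp
  note hf = half_line_complex[OF f g assms(3-5), folded F_def]
  note hr = half_line_complex[OF complex_eigenfunction.reflect[OF f] complex_eigenfunction.reflect[OF g] assms(3-5), folded R_def]
  define P where "P = (\<lambda>x. indicator {0..} x *\<^sub>R F x)"
  define Q where "Q = (\<lambda>x. indicator {0..} x *\<^sub>R R x)"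
  have Pi: "integrable lborel P" and Qi: "integrable lborel Q"
    using hf(1) hr(1) by (simp_all add: P_def Q_def set_integrable_def)
  have Qi': "integrable lborel (\<lambda>x. Q (- x))"
    using lborel_integrable_real_affine[OF Qi, of "-1" 0] by simp
  have Qe: "(LINT x|lborel. Q (- x)) = (LINT x|lborel. Q x)"
    using lborel_integral_real_affine[of "-1" Q 0] by simp
  have "AE x in lborel. x \<noteq> (0::real)" by (rule AE_lborel_singleton)
  then have ae: "AE x in lborel. F x = P x + Q (- x)"
    by eventually_elim (auto simp: P_def Q_def R split: split_indicator)
  have meas: "F \<in> borel_measurable lborel"
  proof -
    have cont: "continuous_on UNIV f" "continuous_on UNIV g"
      using complex_eigenfunction.df[OF f] complex_eigenfunction.df[OF g]
      by (meson continuous_on_vector_derivative has_vector_derivative_at_within)+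
    have "continuous_on UNIV (\<lambda>x::real. \<bar>x\<bar> powr \<beta>)"
      using assms by (intro continuous_on_powr' continuous_intros) auto
    then have "continuous_on UNIV F"
      unfolding F_def product_integrand_def[abs_def] weight_def[symmetric]
      by (intro continuous_on_exp continuous_on_mult continuous_on_const continuous_on_of_real continuous_on_cnj cont cont_weight)
    then show ?thesis by (simp add: borel_measurable_continuous_onI)
  qed
  have "(LINT x|lborel. F x) = (LINT x|lborel. P x + Q (- x))"
    using Pi Qi' by (intro integral_cong_AE meas ae) auto
  also have "\<dots> = (LINT x:{0..}|lborel. F x) + (LINT x:{0..}|lborel. R x)"
    using Pi Qi' Qe by (simp add: P_def Q_def set_lebesgue_integral_def)
  finally have "cmod (LINT x|lborel. F x) \<le> cmod (LINT x:{0..}|lborel. F x) + cmod (LINT x:{0..}|lborel. R x)"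
    by (simp add: norm_triangle_ineq)
  then show ?thesis using hf(2) hr(2) unfolding F_def by linarith
qed

lemma hermite_family_eigenfunction:
  assumes h: "hermite_family h" and m: "m \<ge> 1"
  shows "complex_eigenfunction (h m) (\<lambda>x. vector_derivative (h m) (at x)) (2 * real m - 1)"
proof
  have H: "twice_differentiable (h m)"
    "\<And>x. harmonic_oscillator (h m) x = complex_of_real (2 * real m - 1) * h m x"
    "square_integrable (h m)" "L2_norm_on_line (h m) = 1"
    using h m unfolding hermite_family_def by auto
  show "(h m has_vector_derivative vector_derivative (h m) (at x)) (at x)" for x
    using H(1) by (simp add: twice_differentiable_def vector_derivative_works[symmetric])
  show "((\<lambda>x. vector_derivative (h m) (at x)) has_vector_derivative (x\<^sup>2 - (2 * real m - 1)) *\<^sub>R h m x) (at x)" for x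
  proof -
    have "((\<lambda>x. vector_derivative (h m) (at x)) has_vector_derivative
        vector_derivative (\<lambda>y. vector_derivative (h m) (at y)) (at x)) (at x)"
      using H(1) by (simp add: twice_differentiable_def vector_derivative_works[symmetric])
    moreover have "vector_derivative (\<lambda>y. vector_derivative (h m) (at y)) (at x) = (x\<^sup>2 - (2 * real m - 1)) *\<^sub>R h m x"
      using H(2)[of x] unfolding harmonic_oscillator_def by (simp add: scaleR_conv_of_real algebra_simps)
    ultimately show ?thesis by simp
  qed
  show "integrable lborel (\<lambda>x. (cmod (h m x))\<^sup>2)" using H(3) by (simp add: square_integrable_def)
  show "(LINT x|lborel. (cmod (h m x))\<^sup>2) \<le> 1" using H(4) by (simp add: L2_norm_on_line_def)
  show "1 \<le> 2 * real m - 1" using m by simp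
qed

text \<open>The constant is chosen after \<mu> and before \<open>h\<close>, \<beta> and
  \<open>k\<close>. It depends on \<mu> through \<open>half_line_const\<close> and through the
  comparison of the product of the eigenvalues with \<open>m * n\<close>.\<close>

theorem lemma1p2:
  fixes \<mu> :: real
  assumes "\<mu> \<ge> 0"
  shows "\<exists>C>0. \<forall>h. hermite_family h \<longrightarrow>
    (\<forall>(\<beta>::real) (k::real) (m::nat) (n::nat).
       \<beta> > 1 \<longrightarrow> k \<noteq> 0 \<longrightarrow> m \<ge> 1 \<longrightarrow> n \<ge> 1 \<longrightarrow>
       cmod (LINT x|lborel. complex_of_real (japanese x powr \<mu>)
               * exp (\<i> * complex_of_real (k * \<bar>x\<bar> powr \<beta>)) * h m x * cnj (h n x))
         \<le> C * osc_const k \<beta> * (real m * real n) powr (- decay_exponent \<beta> \<mu>))"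
proof (intro exI[of _ "8 * half_line_const \<mu> * 4 powr (\<mu> / 4)"] conjI allI impI)
  show "8 * half_line_const \<mu> * 4 powr (\<mu> / 4) > 0" using half_line_const_pos[of \<mu>] by simp
  fix h and \<beta> k :: real and m n :: nat
  assume h: "hermite_family h" and \<beta>: "\<beta> > 1" and k: "k \<noteq> 0" and m: "m \<ge> 1" and n: "n \<ge> 1"
  define lam where "lam = 2 * real m - 1"
  define Lam where "Lam = 2 * real n - 1"
  define N where "N = real m * real n"
  define e where "e = - decay_exponent \<beta> \<mu>"
  have one: "osc_const k \<beta> \<ge> 1" by (rule osc_const_ge_one[OF \<beta> k])
  have "decay_exponent \<beta> 0 \<ge> 0" using \<beta> by (auto simp: decay_exponent_def)
  then have e: "e \<le> \<mu> / 4" unfolding e_def using decay_exponent_zero_le(2)[OF \<beta>, of \<mu>] by simp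
  have N: "N \<ge> 1" unfolding N_def using m n mult_mono[of 1 "real m" 1 "real n"] by simp
  \<comment> \<open>The product of the eigenvalues agrees with \<open>N\<close> up to a factor
    between 1 and 4. The exponent \<open>e\<close> may have either sign, but it is at most \<mu> /
    4, so \<open>t powr e\<close> costs at most \<open>4 powr (\<mu> / 4)\<close>.\<close>
  define t where "t = lam * Lam / N"
  have t: "1 \<le> t" "t \<le> 4"
  proof -
    have "real m * real n \<le> lam * Lam" unfolding lam_def Lam_def using m n by (intro mult_mono) auto
    then show "1 \<le> t" unfolding t_def N_def using N by (simp add: N_def)
    have "lam * Lam \<le> (2 * real m) * (2 * real n)" unfolding lam_def Lam_def using m n by (intro mult_mono) auto
    then show "t \<le> 4" unfolding t_def using N by (simp add: N_def pos_divide_le_eq)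
  qed
  have "(lam * Lam) powr e = N powr e * t powr e"
    using N t by (simp add: powr_mult[symmetric] t_def)
  also have "\<dots> \<le> N powr e * 4 powr (\<mu> / 4)"
  proof (intro mult_left_mono)
    have "t powr e \<le> t powr (\<mu> / 4)" using t e by (intro powr_mono) auto
    also have "\<dots> \<le> 4 powr (\<mu> / 4)" using t assms by (intro powr_mono2) auto
    finally show "t powr e \<le> 4 powr (\<mu> / 4)" .
  qed simp
  finally have le: "(lam * Lam) powr e \<le> N powr e * 4 powr (\<mu> / 4)" .
  have "cmod (LINT x|lborel. product_integrand \<mu> k \<beta> (h m) (h n) x) \<le> 8 * (half_line_const \<mu> * osc_const k \<beta> * (lam * Lam) powr e)"
    unfolding e_def lam_def Lam_def
    by (rule whole_line_complex[OF hermite_family_eigenfunction[OF h m] hermite_family_eigenfunction[OF h n] assms \<beta> k])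
  also have "\<dots> \<le> 8 * (half_line_const \<mu> * osc_const k \<beta> * (N powr e * 4 powr (\<mu> / 4)))"
    using le one half_line_const_pos[of \<mu>] by (intro mult_left_mono) auto
  finally show "cmod (LINT x|lborel. complex_of_real (japanese x powr \<mu>)
               * exp (\<i> * complex_of_real (k * \<bar>x\<bar> powr \<beta>)) * h m x * cnj (h n x))
         \<le> 8 * half_line_const \<mu> * 4 powr (\<mu> / 4) * osc_const k \<beta> * (real m * real n) powr (- decay_exponent \<beta> \<mu>)"
    unfolding product_integrand_def N_def e_def by (simp only: mult_ac)
qed

end
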